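(* Let $\Omega\subset\mathbb{R}^d$ be compact and convex, let $\mu,\nu\in\mathcal{P}(\Omega)$ with $\mu\ll\mathcal{L}_d$, and let $u_0$ be a Kantorovich potential for the pair $(\mu,\nu)$. Let $\eta_0>0$ be a step size, define $f_0:\Omega\to\mathbb{R}^d$ by $$f_0(x)=\begin{cases}x-\eta_0\nabla u_0(x)&\text{if }\nabla u_0(x)\text{ exists},\\ x&\text{else,}\end{cases}$$ and set $\tilde\mu=(f_0)_\#\mu$. Let $T_0$ be an optimal transport map for the pair $(\mu,\nu)$. If $\eta_0<\ell_0(T_0)$, then: (i) $u_0$ is a Kantorovich potential for the pair $(\tilde\mu,\nu)$; (ii) $W_1(\tilde\mu,\nu)=W_1(\mu,\nu)-\eta_0$; (iii) with $g_0:\Omega\to\mathbb{R}^d$ defined by $$g_0(x)=\begin{cases}x+\eta_0\nabla u_0(x)&\text{if }\nabla u_0(x)\text{ exists},\\ x&\text{else,}\end{cases}$$ the map $T_1:=T_0\circ g_0$ is an optimal transport map for the pair $(\tilde\mu,\nu)$, and $\ell_0(T_1)\ge \ell_0(T_0)-\eta_0$; (iv) $\tilde\mu$ has a density $\tilde\rho$ (with respect to $\mathcal{L}_d$) satisfying, for $\mu$-almost all $x$, $$\tilde\rho(f_0(x))=\rho(x)\,|Dg_0(f_0(x))|,$$ where $\rho$ is the density of $\mu$.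
   Context: $\mathcal{P}(\Omega)$ is the set of probability measures on $\Omega$; $\mathcal{L}_d$ is Lebesgue measure on $\mathbb{R}^d$; $\mu\ll\mathcal{L}_d$ means that $\mu$ has a density with respect to $\mathcal{L}_d$; $|\cdot|$ is the Euclidean norm. The pushforward is $T_\#\mu(E)=\mu(T^{-1}(E))$. $W_1(\mu,\nu)=\min_{\gamma\in\Pi(\mu,\nu)}\int_{\Omega\times\Omega}|x-y|\,d\gamma$, where $\Pi(\mu,\nu)$ is the set of probability measures on $\Omega\times\Omega$ with first marginal $\mu$ and second marginal $\nu$. A Kantorovich potential for the pair $(\mu,\nu)$ is a maximizer $u_0$ of $\int_\Omega u\,d\mu-\int_\Omega u\,d\nu$ over all functions $u:\Omega\to\mathbb{R}$ that are Lipschitz with constant $1$. An optimal transport map for $(\mu,\nu)$ is a map $T_0:\Omega\to\Omega$ that minimizes $\int_\Omega|x-T(x)|\,d\mu$ over maps $T:\Omega\to\Omega$ with $T_\#\mu=\nu$. The map $T_0\circ g_0$ only needs to be defined almost everywhere with respect to $\tilde\mu$. For $\mu\ll\mathcal{L}_d$ and an optimal transport map $T_0$ for $(\mu,\nu)$, $$\ell_0(T_0):=\operatorname{ess\,inf}_\mu|I-T_0|=\sup\{\ell\in\mathbb{R}\mid \mu(\{x\in\Omega\mid |x-T_0(x)|<\ell\})=0\}.$$ $\ell_0(T_1)$ is defined in the same way, with $\tilde\mu$ in place of $\mu$. $|Dg_0(y)|$ denotes the absolute value of the determinant of the Jacobian of $g_0$ at $y$, where the Jacobian is understood in the almost-everywhere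 (approximate derivative) sense in which it appears in the area formula for a map that is Lipschitz on a measurable subset of $\mathbb{R}^d$. *)

theory Defs
  imports "HOL-Probability.Probability"
begin

text \<open>
  Measures on \<open>\<Omega>\<close> are Borel measures on the whole space that do not charge the complement
  of \<open>\<Omega>\<close>. Functions and maps on \<open>\<Omega>\<close> are total functions of which only the values
  on \<open>\<Omega>\<close> matter.
\<close>

definition prob_measures_on :: "'a::euclidean_space set \<Rightarrow> 'a measure set" where
  "prob_measures_on \<Omega> = {\<mu>. prob_space \<mu> \<and> sets \<mu> = sets borel \<and> emeasure \<mu> (- \<Omega>) = 0}"

definition pushforward :: "'a::euclidean_space set \<Rightarrow> 'a measure \<Rightarrow> ('a \<Rightarrow> 'a) \<Rightarrow> 'a measure" where
  "pushforward \<Omega> \<mu> T = distr (restrict_space \<mu> \<Omega>) borel T"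

definition couplings ::
    "'a::euclidean_space set \<Rightarrow> 'a measure \<Rightarrow> 'a measure \<Rightarrow> ('a \<times> 'a) measure set" where
  "couplings \<Omega> \<mu> \<nu> =
     {\<gamma> \<in> prob_measures_on (\<Omega> \<times> \<Omega>). distr \<gamma> borel fst = \<mu> \<and> distr \<gamma> borel snd = \<nu>}"

definition W1 :: "'a::euclidean_space set \<Rightarrow> 'a measure \<Rightarrow> 'a measure \<Rightarrow> real" where
  "W1 \<Omega> \<mu> \<nu> = (INF \<gamma> \<in> couplings \<Omega> \<mu> \<nu>. (LINT z:\<Omega> \<times> \<Omega>|\<gamma>. norm (fst z - snd z)))"

definition kantorovich_potential ::
    "'a::euclidean_space set \<Rightarrow> 'a measure \<Rightarrow> 'a measure \<Rightarrow> ('a \<Rightarrow> real) \<Rightarrow> bool" where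
  "kantorovich_potential \<Omega> \<mu> \<nu> u \<longleftrightarrow>
     1-lipschitz_on \<Omega> u \<and>
     (\<forall>v. 1-lipschitz_on \<Omega> v \<longrightarrow>
        (LINT x:\<Omega>|\<mu>. v x) - (LINT x:\<Omega>|\<nu>. v x) \<le> (LINT x:\<Omega>|\<mu>. u x) - (LINT x:\<Omega>|\<nu>. u x))"

definition transport_map ::
    "'a::euclidean_space set \<Rightarrow> 'a measure \<Rightarrow> 'a measure \<Rightarrow> ('a \<Rightarrow> 'a) \<Rightarrow> bool" where
  "transport_map \<Omega> \<mu> \<nu> T \<longleftrightarrow>
     T \<in> restrict_space borel \<Omega> \<rightarrow>\<^sub>M restrict_space borel \<Omega> \<and> pushforward \<Omega> \<mu> T = \<nu>"

definition optimal_transport_map ::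
    "'a::euclidean_space set \<Rightarrow> 'a measure \<Rightarrow> 'a measure \<Rightarrow> ('a \<Rightarrow> 'a) \<Rightarrow> bool" where
  "optimal_transport_map \<Omega> \<mu> \<nu> T \<longleftrightarrow>
     transport_map \<Omega> \<mu> \<nu> T \<and>
     (\<forall>S. transport_map \<Omega> \<mu> \<nu> S \<longrightarrow>
        (LINT x:\<Omega>|\<mu>. norm (x - T x)) \<le> (LINT x:\<Omega>|\<mu>. norm (x - S x)))"

text \<open>
  The essential infimum of the transport distance. The condition that
  \<open>{x \<in> \<Omega>. norm (x - T x) < l}\<close> is a null set is expressed by an almost-everywhere quantifier.
\<close>

definition ell0 :: "'a::euclidean_space set \<Rightarrow> 'a measure \<Rightarrow> ('a \<Rightarrow> 'a) \<Rightarrow> real" where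
  "ell0 \<Omega> \<mu> T = Sup {l. AE x in \<mu>. \<not> (x \<in> \<Omega> \<and> norm (x - T x) < l)}"

definition lebesgue_density :: "'a::euclidean_space measure \<Rightarrow> ('a \<Rightarrow> real) \<Rightarrow> bool" where
  "lebesgue_density \<mu> \<rho> \<longleftrightarrow>
     \<rho> \<in> borel_measurable borel \<and> (\<forall>x. 0 \<le> \<rho> x) \<and> \<mu> = density lborel (\<lambda>x. ennreal (\<rho> x))"

text \<open>
  For a function on \<open>\<Omega>\<close> the gradient is only considered at interior points, where it does not
  depend on the values outside \<open>\<Omega>\<close>.
\<close>

definition gradient_exists :: "'a::euclidean_space set \<Rightarrow> ('a \<Rightarrow> real) \<Rightarrow> 'a \<Rightarrow> bool" where
  "gradient_exists \<Omega> u x \<longleftrightarrow> x \<in> interior \<Omega> \<and> (\<exists>D. GDERIV u x :> D)"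

definition gradient :: "('a::euclidean_space \<Rightarrow> real) \<Rightarrow> 'a \<Rightarrow> 'a" where
  "gradient u x = (THE D. GDERIV u x :> D)"

definition descent_map ::
    "'a::euclidean_space set \<Rightarrow> real \<Rightarrow> ('a \<Rightarrow> real) \<Rightarrow> 'a \<Rightarrow> 'a" where
  "descent_map \<Omega> \<eta> u x = (if gradient_exists \<Omega> u x then x - \<eta> *\<^sub>R gradient u x else x)"

definition ascent_map ::
    "'a::euclidean_space set \<Rightarrow> real \<Rightarrow> ('a \<Rightarrow> real) \<Rightarrow> 'a \<Rightarrow> 'a" where
  "ascent_map \<Omega> \<eta> u x = (if gradient_exists \<Omega> u x then x + \<eta> *\<^sub>R gradient u x else x)"

text \<open>
  Approximate derivative in the sense of Federer: for every \<open>\<epsilon> > 0\<close> the set of points outside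
  the domain \<open>\<Omega>\<close> or with difference quotient at least \<open>\<epsilon>\<close> has Lebesgue density 0 at \<open>y\<close>.
  The outer measure makes sense without measurability of \<open>g\<close>. Almost everywhere on a
  measurable subset of \<open>\<Omega>\<close> on which \<open>g\<close> is Lipschitz, it is the derivative of any
  Lipschitz extension of that restriction, as in the area formula.
\<close>

definition has_density_zero_at :: "'a::euclidean_space set \<Rightarrow> 'a \<Rightarrow> bool" where
  "has_density_zero_at S y \<longleftrightarrow>
     ((\<lambda>r. outer_measure_of lborel (S \<inter> ball y r) / emeasure lborel (ball y r)) \<longlongrightarrow> 0) (at_right 0)"

definition has_approx_derivative ::
    "('a::euclidean_space \<Rightarrow> 'a) \<Rightarrow> ('a \<Rightarrow> 'a) \<Rightarrow> 'a set \<Rightarrow> 'a \<Rightarrow> bool" where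
  "has_approx_derivative g A \<Omega> y \<longleftrightarrow>
     y \<in> \<Omega> \<and> linear A \<and>
     (\<forall>\<epsilon>>0. has_density_zero_at
        {z. \<not> (z \<in> \<Omega> \<and> norm (g z - g y - A (z - y)) / norm (z - y) < \<epsilon>)} y)"

end

theory Submission
  imports Defs
begin

text \<open>
  Extend \<open>u0\<close> to a 1-Lipschitz function \<open>U\<close> on the whole space. Since \<open>\<mu>\<close> has no atoms, the cost
  of transport maps comes arbitrarily close to the dual value \<open>\<integral>U d\<mu> - \<integral>U d\<nu>\<close> (cut \<open>\<Omega>\<close> into small
  pieces, solve the finite problem, and realise its plan by maps between the pieces). Hence an
  optimal map attains this value, and \<open>U x - U (T0 x) = norm (x - T0 x)\<close> for almost all \<open>x\<close>:
  \<open>x\<close> and \<open>T0 x\<close> lie on a transport ray, a segment on which \<open>U\<close> has slope 1.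

  Inside a ray \<open>U\<close> is differentiable and its gradient is the direction of the ray; upper end points of
  rays of length at least \<open>l > 0\<close> form a null set. So \<open>f0\<close> moves almost every point a distance \<open>\<eta>0\<close> along
  its ray towards \<open>T0 x\<close>, without passing it, and \<open>g0\<close> moves it back. This shortens every
  path by exactly \<open>\<eta>0\<close> while the dual value decreases by \<open>\<eta>0\<close>, so that \<open>U\<close> and \<open>T0 \<circ> g0\<close> remain optimal. The
  directions of the rays depend on the point in a Lipschitz way at a fixed distance from the ends of the rays.
  Hence \<open>g0\<close> is Lipschitz on the image of \<open>f0\<close>, up to null sets, and the change of variables formula yields
  the density.
\<close>

section \<open>Density points and Rademacher's theorem\<close>

text \<open>The hypotheses compare \<open>u0\<close> only with other potentials and
  \<open>T0\<close> only with other maps, so they do not say that the two optimal values agree.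
  Closing this gap is the reason for the finite duality and the approximating maps; an inequality up
  to every positive error suffices, because \<open>u0\<close> and \<open>T0\<close> are given as
  optimal. Afterwards every optimality claim follows from weak duality, by exhibiting a map and a
  potential with equal values. The strict inequality \<open>\<eta>0 < ell0 \<Omega> \<mu> T0\<close>
  leaves room for some \<open>l\<close> with \<open>\<eta>0 < l\<close>. A moved point then has a
  piece of ray of length \<open>l - \<eta>0\<close> below it and one of length
  \<open>\<eta>0\<close> above it, and this two-sided margin bounds the Lipschitz constant of
  \<open>g0\<close>. No uniform margin is available at the sources, which may lie close to upper
  ends of rays. The change of variables is therefore carried out for \<open>g0\<close>, with
  \<open>f0\<close> as its Borel inverse. Rademacher's theorem serves the Jacobian of
  \<open>g0\<close>; at the relevant points the gradient of \<open>U\<close> comes from the geometry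
  of the rays.\<close>

lemma negligible_iff_null_sets_lborel:
  fixes A :: "'a::euclidean_space set"
  assumes "A \<in> sets borel"
  shows "negligible A \<longleftrightarrow> A \<in> null_sets lborel"
  using assms by (auto simp: negligible_iff_null_sets null_sets_def)

text \<open>A Vitali argument: around the exceptional points there are balls inside an open
  \<open>U\<close> of little excess over \<open>S\<close> that have more than the fraction
  \<open>e\<close> of their volume in \<open>U - S\<close>. A disjoint selection covers almost all
  of these points and has total volume at most the excess divided by \<open>e\<close>.\<close>

lemma lebesgue_density_fixed:
  fixes S :: "'a::euclidean_space set"
  assumes S: "S \<in> sets lebesgue" and e: "0 < e"
  shows "negligible {x \<in> S. \<forall>d>0. \<exists>r. 0 < r \<and> r < d \<and>
    ennreal e * emeasure lebesgue (ball x r) < emeasure lebesgue (ball x r - S)}" (is "negligible ?E")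
proof (subst negligible_outer, intro allI impI)
  fix \<epsilon> :: real assume \<epsilon>: "0 < \<epsilon>"
  \<comment> \<open>The factor \<open>e\<close> is used up when the volume of the balls is compared
    with that of \<open>U - S\<close>; half of \<epsilon> leaves room for the strict inequality at
    the end.\<close>
  obtain U where U: "open U" "S \<subseteq> U" "U - S \<in> lmeasurable" "emeasure lebesgue (U - S) < ennreal (\<epsilon> * e / 2)"
    by (rule sets_lebesgue_outer_open[OF S, of "\<epsilon> * e / 2"]) (use \<epsilon> e in simp)
  define bad where "bad x r \<longleftrightarrow> ennreal e * emeasure lebesgue (ball x r) < emeasure lebesgue (ball x r - S)" for x r
  define K where "K = {(x, r). 0 < r \<and> ball x r \<subseteq> U \<and> bad x r}"
  define E where "E = {x \<in> S. \<forall>d>0. \<exists>r. 0 < r \<and> r < d \<and> bad x r}"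
  have E: "?E = E" by (simp only: E_def bad_def)
  have "\<exists>i. i \<in> K \<and> x \<in> ball (fst i) (snd i) \<and> snd i < d" if x: "x \<in> E" and "0 < d" for x d
  proof -
    have "x \<in> U" using x U(2) by (auto simp: E_def)
    then obtain d' where d': "0 < d'" "ball x d' \<subseteq> U"
      using U(1) open_contains_ball_eq by blast
    have "0 < min d d'" using d'(1) that(2) by simp
    then obtain r where r: "0 < r" "r < min d d'" "bad x r"
      using x unfolding E_def by blast
    then have "ball x r \<subseteq> U" using d'(2) by auto
    then show ?thesis using r by (intro exI[of _ "(x, r)"]) (simp add: K_def)
  qed
  then obtain C where C: "countable C" "C \<subseteq> K"
     "pairwise (\<lambda>i j. disjnt (ball (fst i) (snd i)) (ball (fst j) (snd j))) C"
     "negligible (E - (\<Union>i \<in> C. ball (fst i) (snd i)))"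
    using Vitali_covering_theorem_balls[of E K fst snd] by blast
  let ?B = "\<lambda>i. ball (fst i) (snd i :: real)"
  have dj: "disjoint_family_on ?B C" "disjoint_family_on (\<lambda>i. ?B i - S) C"
    using C(3) by (fastforce simp: disjoint_family_on_def pairwise_def disjnt_def)+
  have "ennreal e * emeasure lebesgue (\<Union>i\<in>C. ?B i)
      = (\<integral>\<^sup>+i. ennreal e * emeasure lebesgue (?B i) \<partial>count_space C)"
    using C(1) dj(1) by (simp add: emeasure_UN_countable nn_integral_cmult)
  also have "\<dots> \<le> (\<integral>\<^sup>+i. emeasure lebesgue (?B i - S) \<partial>count_space C)"
    using C(2) by (intro nn_integral_mono) (auto simp: K_def bad_def intro: less_imp_le)
  also have "\<dots> = emeasure lebesgue (\<Union>i\<in>C. ?B i - S)"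
    using C(1) dj(2) S by (subst emeasure_UN_countable) auto
  also have "\<dots> \<le> emeasure lebesgue (U - S)"
    using C(2) U(3) by (intro emeasure_mono) (fastforce simp: K_def)+
  also have "\<dots> \<le> ennreal (\<epsilon> * e / 2)" using U by simp
  finally have le: "ennreal e * emeasure lebesgue (\<Union>i\<in>C. ?B i) \<le> ennreal e * ennreal (\<epsilon> / 2)"
    using e \<epsilon> by (simp add: ennreal_mult[symmetric] mult.commute)
  then have le: "emeasure lebesgue (\<Union>i\<in>C. ?B i) \<le> ennreal (\<epsilon> / 2)"
    using e by (subst (asm) ennreal_mult_le_mult_iff) auto
  define N where "N = E - (\<Union>i \<in> C. ?B i)"
  define V where "V = (\<Union>i\<in>C. ?B i)"
  have N: "N \<in> null_sets lebesgue" using C(4) by (simp add: negligible_iff_null_sets N_def)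
  have V: "V \<in> sets lebesgue" "emeasure lebesgue V \<le> ennreal (\<epsilon> / 2)"
  proof -
    have "open V" by (auto simp: V_def)
    then show "V \<in> sets lebesgue" by (intro sets_completionI_sets) simp
  qed (use le in \<open>simp add: V_def\<close>)
  then have eq: "emeasure lebesgue (V \<union> N) \<le> ennreal (\<epsilon> / 2)"
    using N by (subst emeasure_Un_null_set) auto
  then have fm: "V \<union> N \<in> lmeasurable"
    using V N by (intro fmeasurableI sets.Un null_setsD2[OF N] le_less_trans[OF eq]) auto
  have "measure lebesgue (V \<union> N) \<le> \<epsilon> / 2"
    unfolding measure_def using eq \<epsilon> by (intro enn2real_leI) auto
  then have "measure lebesgue (V \<union> N) < \<epsilon>" using \<epsilon> by simp
  moreover have "E \<subseteq> V \<union> N" by (auto simp: V_def N_def)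
  ultimately show "\<exists>T. ?E \<subseteq> T \<and> T \<in> lmeasurable \<and> measure lebesgue T < \<epsilon>"
    using fm unfolding E by blast
qed

lemma lebesgue_density:
  fixes S :: "'a::euclidean_space set"
  assumes S: "S \<in> sets lebesgue"
  shows "negligible {x \<in> S. \<not> (\<forall>e>0. \<exists>d>0. \<forall>r. 0 < r \<longrightarrow> r < d \<longrightarrow>
    emeasure lebesgue (ball x r - S) \<le> ennreal e * emeasure lebesgue (ball x r))}" (is "negligible ?E")
proof -
  let ?F = "\<lambda>e. {x \<in> S. \<forall>d>0. \<exists>r. 0 < r \<and> r < d \<and>
    ennreal e * emeasure lebesgue (ball x r) < emeasure lebesgue (ball x r - S)}"
  have "?E \<subseteq> (\<Union>n::nat. ?F (1 / Suc n))"
  proof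
    fix x assume "x \<in> ?E"
    then obtain e where x: "x \<in> S" and e: "e > 0"
      and *: "\<And>d. d > 0 \<Longrightarrow> \<exists>r. 0 < r \<and> r < d \<and>
        ennreal e * emeasure lebesgue (ball x r) < emeasure lebesgue (ball x r - S)"
      by (auto simp: not_le)
    obtain n where n: "1 / Suc n < e" using e nat_approx_posE by blast
    have "ennreal (1 / Suc n) * c \<le> ennreal e * c" for c
      using n by (intro mult_right_mono ennreal_leI) auto
    then have "\<exists>r. 0 < r \<and> r < d \<and>
        ennreal (1 / Suc n) * emeasure lebesgue (ball x r) < emeasure lebesgue (ball x r - S)" if "d > 0" for d
      using *[OF that] le_less_trans by blast
    then have "x \<in> ?F (1 / Suc n)" using x by simp
    then show "x \<in> (\<Union>n::nat. ?F (1 / Suc n))" by blast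
  qed
  moreover have "negligible (\<Union>n::nat. ?F (1 / Suc n))"
    by (intro negligible_Union_nat lebesgue_density_fixed[OF S]) auto
  ultimately show ?thesis by (rule negligible_subset[rotated])
qed

text \<open>A gap of \<open>S\<close> around \<open>x + h\<close> of radius proportional to
  \<open>norm h\<close> would fill a fixed fraction of the ball of radius \<open>2 * norm h\<close>
  about \<open>x\<close>. Density thus provides nearby points of \<open>S\<close> in every
  direction, which is the form used for Rademacher's theorem.\<close>

lemma lebesgue_density_near:
  fixes S :: "'a::euclidean_space set"
  assumes dens: "\<forall>e>0. \<exists>d>0. \<forall>r. 0 < r \<longrightarrow> r < d \<longrightarrow>
    emeasure lebesgue (ball x r - S) \<le> ennreal e * emeasure lebesgue (ball x r)"
    and S: "S \<in> sets lebesgue" and \<epsilon>: "0 < \<epsilon>"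
  obtains d where "0 < d" "\<And>h. norm h < d \<Longrightarrow> h \<noteq> 0 \<Longrightarrow> \<exists>s\<in>S. dist s (x + h) \<le> \<epsilon> * norm h"
proof -
  \<comment> \<open>The cap 1 keeps the gap ball of radius \<open>c * norm h\<close> inside the ball
    of radius \<open>2 * norm h\<close>. Their volume ratio is \<open>(c / 2) ^ DIM('a)\<close>;
    \<open>e\<close> is half of it.\<close>
  define c where "c = min \<epsilon> 1"
  have c: "0 < c" "c \<le> 1" "c \<le> \<epsilon>" using \<epsilon> by (auto simp: c_def)
  define e where "e = (c / 2) ^ DIM('a) / 2"
  have "0 < e" using c by (simp add: e_def)
  then obtain d where d: "0 < d" and le: "\<And>r. 0 < r \<Longrightarrow> r < d \<Longrightarrow>
      emeasure lebesgue (ball x r - S) \<le> ennreal e * emeasure lebesgue (ball x r)"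
    using dens by blast
  have "\<exists>s\<in>S. dist s (x + h) \<le> \<epsilon> * norm h" if h: "norm h < d / 2" "h \<noteq> 0" for h
  proof (rule ccontr)
    assume no: "\<not> (\<exists>s\<in>S. dist s (x + h) \<le> \<epsilon> * norm h)"
    let ?r = "2 * norm h" and ?t = "c * norm h"
    have t: "0 < ?t" "?t \<le> norm h" using c h by (simp_all add: mult_left_le_one_le)
    have "ball (x + h) ?t \<subseteq> ball x ?r - S"
    proof
      fix y assume y: "y \<in> ball (x + h) ?t"
      have "dist x y \<le> dist x (x + h) + dist (x + h) y" by (rule dist_triangle)
      moreover have "dist x (x + h) = norm h" "dist (x + h) y < ?t" using y by (simp_all add: dist_norm)
      ultimately have "y \<in> ball x ?r" using t by simp
      moreover have "?t \<le> \<epsilon> * norm h" using c by (simp add: mult_right_mono)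
      then have "dist y (x + h) \<le> \<epsilon> * norm h" using y by (simp add: dist_commute)
      then have "y \<notin> S" using no by blast
      ultimately show "y \<in> ball x ?r - S" by blast
    qed
    then have le1: "emeasure lebesgue (ball (x + h) ?t) \<le> emeasure lebesgue (ball x ?r - S)"
      by (rule emeasure_mono) (intro sets.Diff S, simp)
    have le2: "emeasure lebesgue (ball x ?r - S) \<le> ennreal e * emeasure lebesgue (ball x ?r)"
      by (rule le) (use h in auto)
    have fin: "emeasure lebesgue (ball y t) = ennreal (measure lborel (ball y t))" for y :: 'a and t
      using emeasure_eq_measure2[OF lmeasurable_ball, of y t] by simp
    have "ennreal (measure lborel (ball (x + h) ?t)) \<le> ennreal e * ennreal (measure lborel (ball x ?r))"
      using order_trans[OF le1 le2] unfolding fin .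
    then have "ennreal (measure lborel (ball (x + h) ?t)) \<le> ennreal (e * measure lborel (ball x ?r))"
      using \<open>0 < e\<close> by (subst ennreal_mult) auto
    then have "measure lborel (ball (x + h) ?t) \<le> e * measure lborel (ball x ?r)"
      using \<open>0 < e\<close> by (subst (asm) ennreal_le_iff) auto
    moreover have "measure lborel (ball (x + h) ?t) = ?t ^ DIM('a) * measure lborel (ball (0::'a) 1)"
      by (rule content_ball_conv_unit_ball) (use t in simp)
    moreover have "measure lborel (ball x ?r) = ?r ^ DIM('a) * measure lborel (ball (0::'a) 1)"
      by (rule content_ball_conv_unit_ball) simp
    moreover have pos: "0 < measure lborel (ball (0::'a) 1)" by (rule content_ball_pos) simp
    ultimately have "?t ^ DIM('a) * measure lborel (ball (0::'a) 1) \<le> (e * ?r ^ DIM('a)) * measure lborel (ball (0::'a) 1)"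
      by (simp only: mult.assoc)
    then have "?t ^ DIM('a) \<le> e * ?r ^ DIM('a)"
      using pos by (simp only: mult_le_cancel_right_pos)
    also have "e * ?r ^ DIM('a) = ?t ^ DIM('a) / 2"
      by (simp add: e_def power_mult_distrib power_divide)
    finally have "?t ^ DIM('a) \<le> ?t ^ DIM('a) / 2" .
    moreover have "0 < ?t ^ DIM('a)" using t by (intro zero_less_power) auto
    ultimately show False by linarith
  qed
  then show thesis using that[of "d / 2"] d by auto
qed

text \<open>\<open>F\<close> is a homeomorphism of the line whose inverse pushes Lebesgue measure to
  a measure giving each interval the increment of \<open>F\<close>. The upper bound makes
  \<open>F\<close> map null sets to null sets, so this measure is absolutely continuous, and
  \<open>G\<close> is its Radon-Nikodym derivative.\<close>

lemma bi_lipschitz_density: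
  fixes F :: "real \<Rightarrow> real"
  assumes lo: "\<And>x y. x \<le> y \<Longrightarrow> y - x \<le> F y - F x"
    and up: "\<And>x y. x \<le> y \<Longrightarrow> F y - F x \<le> C * (y - x)"
  obtains G where "\<And>a b. a \<le> b \<Longrightarrow> (G has_integral (F b - F a)) {a..b}"
proof -
  have C: "0 \<le> C" using lo[of 0 1] up[of 0 1] by simp
  have lip: "\<bar>F y - F x\<bar> \<le> C * \<bar>y - x\<bar>" for x y
  proof (cases "x \<le> y")
    case True then show ?thesis using lo[of x y] up[of x y] by simp
  next
    case False then show ?thesis using lo[of y x] up[of y x] by (simp add: abs_minus_commute)
  qed
  have lo': "\<bar>y - x\<bar> \<le> \<bar>F y - F x\<bar>" for x y
  proof (cases "x \<le> y")
    case True then show ?thesis using lo[of x y] by simp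
  next
    case False then show ?thesis using lo[of y x] by simp
  qed
  have "C-lipschitz_on UNIV F"
    by (rule lipschitz_onI) (use lip C in \<open>auto simp: dist_real_def\<close>)
  then have contF: "continuous_on UNIV F" by (rule lipschitz_on_continuous_on)
  have le_iff: "F x \<le> F y \<longleftrightarrow> x \<le> y" for x y
    by (cases "x \<le> y") (use lo[of x y] lo[of y x] in auto)
  have inj: "inj F" by (rule injI) (metis le_iff order_antisym order_refl)
  have "\<exists>x. F x = y" for y
  proof -
    let ?t = "\<bar>y - F 0\<bar>"
    have "F (- ?t) \<le> y" "y \<le> F ?t" using lo[of "- ?t" 0] lo[of 0 ?t] by linarith+
    then show ?thesis using IVT'[of F "- ?t" y ?t] contF
      by (meson abs_ge_zero continuous_on_subset neg_le_0_iff_le order_trans subset_UNIV)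
  qed
  then have surj: "surj F" by (metis surjI)
  define H where "H = inv F"
  have FH: "F (H y) = y" and HF: "H (F x) = x" for x y
    using surj inj by (auto simp: H_def surj_f_inv_f inv_f_f)
  have "1-lipschitz_on UNIV H"
    by (rule lipschitz_onI) (use lo'[of "H _" "H _"] FH in \<open>auto simp: dist_real_def\<close>)
  then have "continuous_on UNIV H" by (rule lipschitz_on_continuous_on)
  then have H[measurable]: "H \<in> borel_measurable borel" by (rule borel_measurable_continuous_onI)
  define M where "M = distr lborel borel H"
  have M_ivl: "emeasure M {a..b} = ennreal (F b - F a)" if "a \<le> b" for a b
  proof -
    have "H -` {a..b} = {F a..F b}" using le_iff FH by (auto; metis)
    then show ?thesis using that le_iff[of a b] by (simp add: M_def emeasure_distr)
  qed
  have "absolutely_continuous lborel M"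
    unfolding absolutely_continuous_def
  proof
    fix A :: "real set" assume A: "A \<in> null_sets lborel"
    then have [measurable]: "A \<in> sets borel" by auto
    have "negligible A" using A by (simp add: negligible_iff_null_sets_lborel)
    then have "negligible (F ` A)"
      by (rule negligible_locally_Lipschitz_image[OF order_refl])
        (use lip in \<open>auto intro!: exI[of _ UNIV] exI[of _ C]\<close>)
    moreover have "H -` A = F ` A" by (auto simp: HF) (metis FH imageI)
    moreover have "H -` A \<in> sets borel" by (rule measurable_sets_borel[OF H]) fact
    ultimately have "H -` A \<in> null_sets lborel" by (simp add: negligible_iff_null_sets_lborel)
    then have "emeasure lborel (H -` A) = 0" by blast
    then show "A \<in> null_sets M" by (auto simp: M_def null_sets_def emeasure_distr)
  qed
  then obtain g where g[measurable]: "g \<in> borel_measurable borel" and gM: "density lborel g = M"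
    using sigma_finite_measure.Radon_Nikodym[OF lborel.sigma_finite_measure_axioms, of M]
    by (auto simp: M_def)
  have int_g: "(\<integral>\<^sup>+x. g x * indicator {a..b} x \<partial>lborel) = ennreal (F b - F a)" if "a \<le> b" for a b
    using M_ivl[OF that] emeasure_density[of g lborel "{a..b}"] by (simp add: gM)
  \<comment> \<open>The derivative may take the value \<infinity>; its integral over each bounded
    interval is finite, so this happens only on a null set.\<close>
  have "AE x in lborel. x \<in> {-real n..real n} \<longrightarrow> g x \<noteq> \<infinity>" for n
  proof -
    have "AE x in lborel. g x * indicator {-real n..real n} x \<noteq> \<infinity>"
      using int_g[of "-real n" "real n"] by (intro nn_integral_PInf_AE) auto
    then show ?thesis by eventually_elim auto
  qed
  then have "AE x in lborel. \<forall>n. x \<in> {-real n..real n} \<longrightarrow> g x \<noteq> \<infinity>"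
    unfolding AE_all_countable by blast
  then have fin: "AE x in lborel. ennreal (enn2real (g x)) = g x"
  proof eventually_elim
    case (elim x)
    obtain n where "\<bar>x\<bar> \<le> real n" using real_arch_simple by blast
    then have "x \<in> {-real n..real n}" by auto
    then have "g x \<noteq> \<infinity>" using elim by blast
    then show ?case by (simp add: less_top)
  qed
  have "((\<lambda>x. enn2real (g x)) has_integral (F b - F a)) {a..b}" if "a \<le> b" for a b
  proof -
    have "(\<integral>\<^sup>+x. ennreal (indicator {a..b} x * enn2real (g x)) \<partial>lborel) = (\<integral>\<^sup>+x. g x * indicator {a..b} x \<partial>lborel)"
      using fin by (intro nn_integral_cong_AE) (auto simp: indicator_def)
    then have "((\<lambda>x. indicator {a..b} x * enn2real (g x)) has_integral (F b - F a)) UNIV"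
      using int_g[OF that] le_iff[of a b] that by (intro nn_integral_has_integral) auto
    moreover have "(\<lambda>x. indicator {a..b} x * enn2real (g x)) = (\<lambda>x. if x \<in> {a..b} then enn2real (g x) else 0)"
      by (auto simp: indicator_def)
    ultimately have "((\<lambda>x. if x \<in> {a..b} then enn2real (g x) else 0) has_integral (F b - F a)) UNIV"
      by simp
    then show ?thesis by (simp only: has_integral_restrict_UNIV)
  qed
  then show thesis using that by blast
qed

text \<open>Adding a linear function makes \<open>f\<close> increasing and bi-Lipschitz, hence an
  indefinite integral; Lebesgue's differentiation theorem then gives the derivative.\<close>

lemma lipschitz_real_differentiable_ae:
  fixes f :: "real \<Rightarrow> real"
  assumes f: "L-lipschitz_on UNIV f"
  shows "negligible {x. \<not> (\<exists>q. \<forall>e>0. \<exists>d>0. \<forall>t. \<bar>t\<bar> < d \<longrightarrow> \<bar>f (x + t) - f x - q * t\<bar> \<le> e * \<bar>t\<bar>)}"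
proof -
  \<comment> \<open>The slopes of \<open>F\<close> lie between 1 and
    \<open>2 * L + 1\<close>.\<close>
  define F where "F x = f x + (L + 1) * x" for x
  have fl: "\<bar>f y - f x\<bar> \<le> L * \<bar>y - x\<bar>" for x y
    using lipschitz_onD[OF f, of y x] by (simp add: dist_real_def)
  have lo: "y - x \<le> F y - F x" if "x \<le> y" for x y
    using fl[of y x] that by (simp add: F_def algebra_simps)
  have up: "F y - F x \<le> (2 * L + 1) * (y - x)" if "x \<le> y" for x y
    using fl[of y x] that by (simp add: F_def algebra_simps)
  obtain G where G: "\<And>a b. a \<le> b \<Longrightarrow> (G has_integral (F b - F a)) {a..b}"
    using bi_lipschitz_density[of F, OF lo up] by blast
  \<comment> \<open>The averages below are over intervals to the right of a point; left difference
    quotients at \<open>x\<close> are right ones of the reflected density at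
    \<open>- x\<close>.\<close>
  have G': "((\<lambda>x. G (- x)) has_integral (F (- a) - F (- b))) {a..b}" if "a \<le> b" for a b
    using G[of "-b" "-a"] that by (subst has_integral_reflect_real[symmetric]) simp
  have int: "G integrable_on cbox a b" "(\<lambda>x. G (- x)) integrable_on cbox a b" for a b
  proof -
    show "G integrable_on cbox a b"
      by (cases "a \<le> b") (use G in \<open>auto simp: integrable_on_def\<close>)
    show "(\<lambda>x. G (- x)) integrable_on cbox a b"
      by (cases "a \<le> b") (use G' in \<open>auto simp: integrable_on_def\<close>)
  qed
  obtain N where N: "negligible N" "\<And>x e. x \<notin> N \<Longrightarrow> 0 < e \<Longrightarrow>
      \<exists>d>0. \<forall>h. 0 < h \<and> h < d \<longrightarrow> norm (integral (cbox x (x + h *\<^sub>R One)) G /\<^sub>R h ^ DIM(real) - G x) < e"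
    by (rule integrable_ccontinuous_explicit[OF int(1)]) (rule that)
  obtain N' where N': "negligible N'" "\<And>x e. x \<notin> N' \<Longrightarrow> 0 < e \<Longrightarrow>
      \<exists>d>0. \<forall>h. 0 < h \<and> h < d \<longrightarrow>
        norm (integral (cbox x (x + h *\<^sub>R One)) (\<lambda>x. G (- x)) /\<^sub>R h ^ DIM(real) - G (- x)) < e"
    by (rule integrable_ccontinuous_explicit[OF int(2)]) (rule that)
  have "negligible (uminus ` N')"
    by (rule negligible_differentiable_image_negligible[OF order_refl N'(1)]) (auto intro!: derivative_intros)
  then have "negligible (N \<union> uminus ` N')" using N(1) by (rule negligible_Un[rotated])
  moreover have "\<exists>q. \<forall>e>0. \<exists>d>0. \<forall>t. \<bar>t\<bar> < d \<longrightarrow> \<bar>f (x + t) - f x - q * t\<bar> \<le> e * \<bar>t\<bar>"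
    if x: "x \<notin> N \<union> uminus ` N'" for x
  proof (rule exI[of _ "G x - (L + 1)"], intro allI impI)
    fix e :: real assume e: "0 < e"
    have xN: "x \<notin> N" "- x \<notin> N'" using x by force+
    obtain d where d: "d > 0" "\<And>h. 0 < h \<Longrightarrow> h < d \<Longrightarrow> \<bar>(F (x + h) - F x) / h - G x\<bar> < e"
    proof -
      obtain d where "d > 0" and d: "\<And>h. 0 < h \<Longrightarrow> h < d \<Longrightarrow>
         norm (integral (cbox x (x + h *\<^sub>R One)) G /\<^sub>R h ^ DIM(real) - G x) < e"
        using N(2)[OF xN(1) e] by (elim exE conjE) simp
      have "\<bar>(F (x + h) - F x) / h - G x\<bar> < e" if "0 < h" "h < d" for h
      proof -
        have "integral (cbox x (x + h *\<^sub>R One)) G = F (x + h) - F x"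
          using G[of x "x + h"] that by (intro integral_unique) simp
        then have "integral (cbox x (x + h *\<^sub>R One)) G /\<^sub>R h ^ DIM(real) = (F (x + h) - F x) / h"
          by (simp add: divide_inverse_commute)
        then show ?thesis using d[OF that] by (simp only: real_norm_def)
      qed
      then show thesis by (rule that[OF \<open>d > 0\<close>])
    qed
    obtain d' where d': "d' > 0" "\<And>h. 0 < h \<Longrightarrow> h < d' \<Longrightarrow> \<bar>(F x - F (x - h)) / h - G x\<bar> < e"
    proof -
      obtain d where "d > 0" and d: "\<And>h. 0 < h \<Longrightarrow> h < d \<Longrightarrow>
         norm (integral (cbox (- x) (- x + h *\<^sub>R One)) (\<lambda>x. G (- x)) /\<^sub>R h ^ DIM(real) - G (- (- x))) < e"
        using N'(2)[OF xN(2) e] by (elim exE conjE) simp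
      have "\<bar>(F x - F (x - h)) / h - G x\<bar> < e" if "0 < h" "h < d" for h
      proof -
        have "integral (cbox (- x) (- x + h *\<^sub>R One)) (\<lambda>x. G (- x)) = F x - F (x - h)"
          using G'[of "- x" "- x + h"] that by (intro integral_unique) simp
        then have "integral (cbox (- x) (- x + h *\<^sub>R One)) (\<lambda>x. G (- x)) /\<^sub>R h ^ DIM(real) = (F x - F (x - h)) / h"
          by (simp add: divide_inverse_commute)
        then show ?thesis using d[OF that] by (simp only: real_norm_def minus_minus)
      qed
      then show thesis by (rule that[OF \<open>d > 0\<close>])
    qed
    have "\<bar>f (x + t) - f x - (G x - (L + 1)) * t\<bar> \<le> e * \<bar>t\<bar>" if t: "\<bar>t\<bar> < min d d'" for t
    proof (cases t "0 :: real" rule: linorder_cases)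
      case greater
      have "\<bar>((F (x + t) - F x) / t - G x) * t\<bar> \<le> e * \<bar>t\<bar>"
        unfolding abs_mult using d(2)[of t] greater t by (intro mult_right_mono) auto
      moreover have "((F (x + t) - F x) / t - G x) * t = f (x + t) - f x - (G x - (L + 1)) * t"
        using greater by (simp add: field_simps F_def)
      ultimately show ?thesis by simp
    next
      case less
      have "\<bar>((F x - F (x - (- t))) / (- t) - G x) * t\<bar> \<le> e * \<bar>t\<bar>"
        unfolding abs_mult using d'(2)[of "- t"] less t by (intro mult_right_mono) auto
      moreover have "((F x - F (x - (- t))) / (- t) - G x) * t = f (x + t) - f x - (G x - (L + 1)) * t"
        using less by (simp add: field_simps F_def)
      ultimately show ?thesis by simp
    qed simp
    then show "\<exists>d>0. \<forall>t. \<bar>t\<bar> < d \<longrightarrow> \<bar>f (x + t) - f x - (G x - (L + 1)) * t\<bar> \<le> e * \<bar>t\<bar>"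
      using d(1) d'(1) by (intro exI[of _ "min d d'"]) auto
  qed
  ultimately show ?thesis
    by - (rule negligible_subset[of "N \<union> uminus ` N'"], assumption, blast)
qed

text \<open>Letting the approximate gradient depend on the tolerance makes differentiability
  expressible by countably many conditions. Two approximate gradients at \<open>x\<close> differ by
  at most the sum of their tolerances, so they converge to the true one.\<close>

lemma gderiv_criterion:
  fixes f :: "'a::euclidean_space \<Rightarrow> real"
  assumes "\<And>e. 0 < e \<Longrightarrow> \<exists>q. \<exists>d>0. \<forall>h. norm h < d \<longrightarrow> \<bar>f (x + h) - f x - q \<bullet> h\<bar> \<le> e * norm h"
  shows "\<exists>q. GDERIV f x :> q"
proof -
  have "\<exists>q d. 0 < d \<and> (\<forall>h. norm h < d \<longrightarrow> \<bar>f (x + h) - f x - q \<bullet> h\<bar> \<le> 1 / real (Suc n) * norm h)" for n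
    using assms[of "1 / real (Suc n)"] by auto
  then obtain q d where d: "\<And>n. 0 < d n"
    and q: "\<And>n h. norm h < d n \<Longrightarrow> \<bar>f (x + h) - f x - q n \<bullet> h\<bar> \<le> 1 / real (Suc n) * norm h"
    by metis
  have diff: "norm (q n - q k) \<le> 1 / real (Suc n) + 1 / real (Suc k)" for n k
  proof (cases "q n = q k")
    case False
    \<comment> \<open>The two linear approximations are compared along \<open>q n - q k\<close>
      itself, where Cauchy-Schwarz is an equality, at half the smaller radius.\<close>
    define c where "c = min (d n) (d k) / (2 * norm (q n - q k))"
    define h where "h = c *\<^sub>R (q n - q k)"
    have c: "0 < c" using d[of n] d[of k] False by (simp add: c_def)
    have nh: "norm h = min (d n) (d k) / 2" using c d[of n] d[of k] False by (simp add: h_def c_def)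
    have "(q n - q k) \<bullet> h = c * (norm (q n - q k))\<^sup>2"
      by (simp add: h_def power2_norm_eq_inner)
    also have "\<dots> = norm (q n - q k) * norm h" using c by (simp add: h_def power2_eq_square)
    finally have "norm (q n - q k) * norm h = (q n - q k) \<bullet> h" ..
    also have "\<dots> \<le> \<bar>f (x + h) - f x - q n \<bullet> h\<bar> + \<bar>f (x + h) - f x - q k \<bullet> h\<bar>"
      by (simp add: inner_diff_left)
    also have "\<dots> \<le> 1 / real (Suc n) * norm h + 1 / real (Suc k) * norm h"
      using d[of n] d[of k] by (intro add_mono q) (simp_all add: nh)
    also have "\<dots> = (1 / real (Suc n) + 1 / real (Suc k)) * norm h" by (simp only: distrib_right)
    finally show ?thesis using d[of n] d[of k] by (subst (asm) mult_le_cancel_right_pos) (simp_all add: nh)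
  qed simp
  have lim0: "(\<lambda>n. 1 / real (Suc n)) \<longlonglongrightarrow> 0" using LIMSEQ_inverse_real_of_nat by (simp add: inverse_eq_divide)
  have small: "\<exists>n0. \<forall>n\<ge>n0. 1 / real (Suc n) < e" if "0 < e" for e
    using order_tendstoD(2)[OF lim0 that] by (auto simp: eventually_sequentially)
  have "Cauchy q"
  proof (rule metric_CauchyI)
    fix e :: real assume "0 < e"
    then obtain n0 where n0: "\<And>n. n \<ge> n0 \<Longrightarrow> 1 / real (Suc n) < e / 2" using small[of "e / 2"] by auto
    have "dist (q m) (q n) < e" if "m \<ge> n0" "n \<ge> n0" for m n
      using diff[of m n] n0[OF that(1)] n0[OF that(2)] by (simp add: dist_norm)
    then show "\<exists>M. \<forall>m\<ge>M. \<forall>n\<ge>M. dist (q m) (q n) < e" by blast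
  qed
  then obtain Q where Q: "q \<longlonglongrightarrow> Q" using Cauchy_convergent_iff convergent_def by blast
  have dQ: "norm (q n - Q) \<le> 1 / real (Suc n)" for n
  proof (rule LIMSEQ_le)
    show "(\<lambda>k. norm (q n - q k)) \<longlonglongrightarrow> norm (q n - Q)" by (intro tendsto_intros Q)
    show "(\<lambda>k. 1 / real (Suc n) + 1 / real (Suc k)) \<longlonglongrightarrow> 1 / real (Suc n)"
      using tendsto_add[OF tendsto_const lim0] by simp
  qed (use diff in blast)
  have "(f has_derivative (\<lambda>h. h \<bullet> Q)) (at x)"
    unfolding has_derivative_at_alt
  proof (intro conjI allI impI)
    fix e :: real assume "0 < e"
    then obtain n where n: "1 / real (Suc n) < e / 2" using small[of "e / 2"] by auto
    have "norm (f y - f x - (y - x) \<bullet> Q) \<le> e * norm (y - x)" if y: "norm (y - x) < d n" for y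
    proof -
      let ?h = "y - x"
      have "\<bar>f (x + ?h) - f x - q n \<bullet> ?h\<bar> \<le> 1 / real (Suc n) * norm ?h" by (rule q[OF y])
      moreover have "\<bar>(q n - Q) \<bullet> ?h\<bar> \<le> 1 / real (Suc n) * norm ?h"
        by (rule order_trans[OF Cauchy_Schwarz_ineq2]) (intro mult_right_mono dQ norm_ge_zero)
      moreover have "f y - f x - (y - x) \<bullet> Q = (f (x + ?h) - f x - q n \<bullet> ?h) + (q n - Q) \<bullet> ?h"
        by (simp add: inner_diff_left[of "q n" Q] inner_commute[of "y - x" Q])
      ultimately have "\<bar>f y - f x - (y - x) \<bullet> Q\<bar> \<le> 2 * (1 / real (Suc n)) * norm ?h" by linarith
      also have "\<dots> \<le> e * norm ?h" using n by (intro mult_right_mono) auto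
      finally show ?thesis by simp
    qed
    then show "\<exists>d>0. \<forall>y. norm (y - x) < d \<longrightarrow> norm (f y - f x - (y - x) \<bullet> Q) \<le> e * norm (y - x)"
      using d by blast
  qed (rule bounded_linear_inner_left)
  then show ?thesis unfolding gderiv_def by blast
qed

lemma gderivD:
  assumes "GDERIV f x :> q" "0 < e"
  obtains d where "0 < d" "\<And>h. norm h < d \<Longrightarrow> \<bar>f (x + h) - f x - q \<bullet> h\<bar> \<le> e * norm h"
proof -
  obtain d where "0 < d" "\<And>y. norm (y - x) < d \<Longrightarrow> norm (f y - f x - (y - x) \<bullet> q) \<le> e * norm (y - x)"
    using assms unfolding gderiv_def has_derivative_at_alt by blast
  then show thesis using that[of d] by (metis add_diff_cancel_left' inner_commute real_norm_def)
qed

section \<open>Measurability of the differentiability points, and null sets on lines\<close>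

lemma closed_linear_approx:
  fixes f :: "'a::euclidean_space \<Rightarrow> real"
  assumes f: "continuous_on UNIV f"
  shows "closed {x. \<forall>h\<in>H. \<bar>f (x + h) - f x - g h\<bar> \<le> e h}"
proof -
  have "{x. \<forall>h\<in>H. \<bar>f (x + h) - f x - g h\<bar> \<le> e h} = (\<Inter>h\<in>H. {x. \<bar>f (x + h) - f x - g h\<bar> \<le> e h})"
    by blast
  moreover have "closed {x. \<bar>f (x + h) - f x - g h\<bar> \<le> e h}" for h
    by (intro closed_Collect_le continuous_intros continuous_on_compose2[OF f]) auto
  ultimately show ?thesis by (auto intro: closed_INT)
qed

text \<open>Fubini over \<open>x\<close> and a shift \<open>t\<close> in [0, 1]: for fixed
  \<open>x\<close> the \<open>t\<close>-integral vanishes, and for fixed \<open>t\<close>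
  translation invariance turns the \<open>x\<close>-integral into the measure of \<open>N\<close>.
  This avoids splitting the space into the line of \<open>b\<close> and a complement.\<close>

lemma null_set_if_null_on_lines:
  fixes N :: "'a::euclidean_space set"
  assumes [measurable]: "N \<in> sets borel"
    and null: "\<And>x. negligible {t::real. x + t *\<^sub>R b \<in> N}"
  shows "negligible N"
proof -
  have [measurable]: "(\<lambda>t::real. x + t *\<^sub>R b) -` N \<in> sets borel" for x
    by (rule measurable_sets_borel[of _ borel]) auto
  have "(\<integral>\<^sup>+t. indicator {0..1::real} t * indicator N (x + t *\<^sub>R b) \<partial>lborel) = 0" for x
  proof -
    have "negligible ((\<lambda>t::real. x + t *\<^sub>R b) -` N)" using null[of x] by (simp add: vimage_def)
    then have "(\<lambda>t::real. x + t *\<^sub>R b) -` N \<in> null_sets lborel"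
      by (simp add: negligible_iff_null_sets_lborel)
    then have "AE t in lborel. t \<notin> (\<lambda>t::real. x + t *\<^sub>R b) -` N"
      by (rule AE_not_in)
    then have "(\<integral>\<^sup>+t. indicator {0..1::real} t * indicator N (x + t *\<^sub>R b) \<partial>lborel) = (\<integral>\<^sup>+t. 0 \<partial>(lborel :: real measure))"
      by (intro nn_integral_cong_AE) (auto simp: indicator_def)
    then show ?thesis by simp
  qed
  then have "0 = (\<integral>\<^sup>+x. (\<integral>\<^sup>+t. indicator {0..1::real} t * indicator N (x + t *\<^sub>R b) \<partial>lborel) \<partial>lborel)"
    by simp
  also have "\<dots> = (\<integral>\<^sup>+t. (\<integral>\<^sup>+x. indicator {0..1::real} t * indicator N (x + t *\<^sub>R b) \<partial>lborel) \<partial>lborel)"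
    by (rule lborel_pair.Fubini'[symmetric]) measurable
  also have "\<dots> = (\<integral>\<^sup>+t. indicator {0..1::real} t * emeasure lborel N \<partial>lborel)"
  proof (intro nn_integral_cong)
    fix t :: real
    have "(\<integral>\<^sup>+x. indicator N (x + t *\<^sub>R b) \<partial>lborel) = (\<integral>\<^sup>+x. indicator N x \<partial>distr lborel borel ((+) (t *\<^sub>R b)))"
      by (subst nn_integral_distr) (auto simp: add.commute)
    also have "\<dots> = emeasure lborel N" by (subst lborel_distr_plus) simp
    finally show "(\<integral>\<^sup>+x. indicator {0..1::real} t * indicator N (x + t *\<^sub>R b) \<partial>lborel)
        = indicator {0..1} t * emeasure lborel N"
      by (subst nn_integral_cmult) auto
  qed
  also have "\<dots> = emeasure lborel N" by (simp add: nn_integral_multc)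
  finally have "N \<in> null_sets lborel" by (auto simp: null_sets_def)
  then show ?thesis by (simp add: negligible_iff_null_sets_lborel)
qed

text \<open>By \<open>gderiv_criterion\<close> the gradient may be replaced, for each tolerance, by
  a nearby member of a countable dense set; what remains is a countable combination of closed
  sets.\<close>

lemma sets_gderiv_points:
  fixes f :: "'a::euclidean_space \<Rightarrow> real"
  assumes f: "continuous_on UNIV f"
  shows "{x. \<exists>q. GDERIV f x :> q} \<in> sets borel"
proof -
  obtain Q :: "'a set" where Q: "countable Q" "\<And>X. open X \<Longrightarrow> X \<noteq> {} \<Longrightarrow> \<exists>d\<in>Q. d \<in> X"
    using countable_dense_exists by blast
  define A where "A n q m = {x. \<forall>h\<in>ball 0 (1 / real (Suc m)).
      \<bar>f (x + h) - f x - q \<bullet> h\<bar> \<le> 1 / real (Suc n) * norm h}" for n q m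
  have "{x. \<exists>q. GDERIV f x :> q} = (\<Inter>n. \<Union>q\<in>Q. \<Union>m. A n q m)"
  proof (intro equalityI subsetI INT_I)
    fix x n assume "x \<in> {x. \<exists>q. GDERIV f x :> q}"
    then obtain p where p: "GDERIV f x :> p" by blast
    define e where "e = 1 / real (Suc n) / 2"
    have e: "0 < e" "1 / real (Suc n) * norm h = e * norm h + e * norm h" for h :: 'a
      unfolding e_def distrib_right[symmetric] field_sum_of_halves by simp_all
    obtain d where d: "0 < d" "\<And>h. norm h < d \<Longrightarrow> \<bar>f (x + h) - f x - p \<bullet> h\<bar> \<le> e * norm h"
      using gderivD[OF p e(1)] by blast
    obtain q where q: "q \<in> Q" "dist p q < e" using Q(2)[of "ball p e"] e(1) by auto
    obtain m where m: "1 / real (Suc m) < d" using d(1) by (rule nat_approx_posE)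
    have "\<bar>f (x + h) - f x - q \<bullet> h\<bar> \<le> 1 / real (Suc n) * norm h" if h: "norm h < 1 / real (Suc m)" for h
    proof -
      have "\<bar>f (x + h) - f x - p \<bullet> h\<bar> \<le> e * norm h" using d(2)[of h] h m by linarith
      moreover have "\<bar>(p - q) \<bullet> h\<bar> \<le> e * norm h"
        by (rule order_trans[OF Cauchy_Schwarz_ineq2])
          (intro mult_right_mono norm_ge_zero less_imp_le[OF q(2)[unfolded dist_norm]])
      moreover have "f (x + h) - f x - q \<bullet> h = (f (x + h) - f x - p \<bullet> h) + (p - q) \<bullet> h"
        by (simp add: inner_diff_left)
      ultimately show ?thesis unfolding e(2) by linarith
    qed
    then have "x \<in> A n q m" by (simp add: A_def)
    then show "x \<in> (\<Union>q\<in>Q. \<Union>m. A n q m)" using q(1) by blast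
  next
    fix x assume x: "x \<in> (\<Inter>n. \<Union>q\<in>Q. \<Union>m. A n q m)"
    have "\<exists>q. GDERIV f x :> q"
    proof (rule gderiv_criterion)
      fix e :: real assume "0 < e"
      then obtain n where n: "1 / real (Suc n) < e" by (rule nat_approx_posE)
      obtain q m where q: "x \<in> A n q m" using INT_D[OF x, of n] by auto
      have "\<bar>f (x + h) - f x - q \<bullet> h\<bar> \<le> e * norm h" if "norm h < 1 / real (Suc m)" for h
      proof -
        have "\<bar>f (x + h) - f x - q \<bullet> h\<bar> \<le> 1 / real (Suc n) * norm h" using q that by (simp add: A_def)
        also have "\<dots> \<le> e * norm h" using n by (intro mult_right_mono) auto
        finally show ?thesis .
      qed
      then show "\<exists>q. \<exists>d>0. \<forall>h. norm h < d \<longrightarrow> \<bar>f (x + h) - f x - q \<bullet> h\<bar> \<le> e * norm h"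
        by (intro exI[of _ q] exI[of _ "1 / real (Suc m)"]) auto
    qed
    then show "x \<in> {x. \<exists>q. GDERIV f x :> q}" by blast
  qed
  moreover have "A n q m \<in> sets borel" for n q m
    unfolding A_def by (intro borel_closed closed_linear_approx f)
  ultimately show ?thesis using Q(1) by (auto intro!: sets.countable_INT sets.countable_UN')
qed

text \<open>
  A Lipschitz function that is close to linear along each coordinate direction, with the same
  slopes \<open>v\<close>, at all points of a set \<open>S\<close>, is close to linear in all directions at every density
  point of \<open>S\<close>: change one coordinate at a time, each time starting from a nearby point of \<open>S\<close>.
\<close>

lemma linear_approx_at_density_point:
  fixes f :: "'a::euclidean_space \<Rightarrow> real"
  assumes f: "L-lipschitz_on UNIV f" and \<epsilon>: "0 \<le> \<epsilon>" and x: "x \<in> S"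
    and S: "\<And>s b t. s \<in> S \<Longrightarrow> b \<in> Basis \<Longrightarrow> \<bar>t\<bar> < d \<Longrightarrow> \<bar>f (s + t *\<^sub>R b) - f s - (v \<bullet> b) * t\<bar> \<le> \<epsilon> * \<bar>t\<bar>"
    and near: "\<And>h. norm h < d \<Longrightarrow> h \<noteq> 0 \<Longrightarrow> \<exists>s\<in>S. dist s (x + h) \<le> \<epsilon> * norm h"
    and h: "norm h < d"
  shows "\<bar>f (x + h) - f x - v \<bullet> h\<bar> \<le> real DIM('a) * ((1 + 2 * L) * \<epsilon> * norm h)"
proof -
  have L: "0 \<le> L" using f by (rule lipschitz_on_nonneg)
  have fl: "\<bar>f y - f z\<bar> \<le> L * dist y z" for y z
    using lipschitz_onD[OF f, of y z] by (simp add: dist_real_def)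
  define p where "p A = (\<Sum>b\<in>A. (h \<bullet> b) *\<^sub>R b)" for A
  have step: "\<bar>f (x + p A) - f x - v \<bullet> p A\<bar> \<le> real (card A) * ((1 + 2 * L) * \<epsilon> * norm h)"
    if "finite A" "A \<subseteq> Basis" for A
    using that
  proof (induction A rule: finite_induct)
    case empty then show ?case by (simp add: p_def)
  next
    case (insert b A)
    have b: "b \<in> Basis" "b \<notin> A" using insert by auto
    have pb: "p (insert b A) = p A + (h \<bullet> b) *\<^sub>R b"
      using insert by (simp add: p_def add.commute)
    have "norm (p A) \<le> norm h"
    proof (rule norm_le_componentwise)
      fix i :: 'a assume i: "i \<in> Basis"
      have "p A \<bullet> i = (if i \<in> A then h \<bullet> i else 0)"
      proof -
        have "p A \<bullet> i = (\<Sum>b\<in>A. if b = i then h \<bullet> b else 0)"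
          unfolding p_def inner_sum_left
          by (rule sum.cong) (use i insert.prems in \<open>auto simp: inner_Basis\<close>)
        then show ?thesis using insert.hyps by (simp add: sum.delta')
      qed
      then show "\<bar>p A \<bullet> i\<bar> \<le> \<bar>h \<bullet> i\<bar>" by simp
    qed
    have "\<exists>s\<in>S. dist s (x + p A) \<le> \<epsilon> * norm h"
    proof (cases "p A = 0")
      case True then show ?thesis using x \<epsilon> by (intro bexI[of _ x]) auto
    next
      case False
      then obtain s where "s \<in> S" "dist s (x + p A) \<le> \<epsilon> * norm (p A)"
        using near[of "p A"] h \<open>norm (p A) \<le> norm h\<close> by auto
      moreover have "\<epsilon> * norm (p A) \<le> \<epsilon> * norm h" using \<epsilon> \<open>norm (p A) \<le> norm h\<close> by (rule mult_left_mono[rotated])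
      ultimately show ?thesis by (intro bexI[of _ s]) auto
    qed
    then obtain s where s: "s \<in> S" "dist s (x + p A) \<le> \<epsilon> * norm h" by blast
    let ?t = "h \<bullet> b"
    have t: "\<bar>?t\<bar> \<le> norm h" by (rule Basis_le_norm[OF b(1)])
    have "\<bar>f (s + ?t *\<^sub>R b) - f s - (v \<bullet> b) * ?t\<bar> \<le> \<epsilon> * \<bar>?t\<bar>"
      using t h by (intro S s b) auto
    also have "\<dots> \<le> \<epsilon> * norm h" using t \<epsilon> by (rule mult_left_mono)
    finally have 1: "\<bar>f (s + ?t *\<^sub>R b) - f s - (v \<bullet> b) * ?t\<bar> \<le> \<epsilon> * norm h" .
    have Ls: "L * dist s (x + p A) \<le> L * (\<epsilon> * norm h)" using s(2) L by (rule mult_left_mono)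
    have 2: "\<bar>f s - f (x + p A)\<bar> \<le> L * (\<epsilon> * norm h)" using fl Ls by (rule order_trans)
    have "dist (s + ?t *\<^sub>R b) (x + p A + ?t *\<^sub>R b) = dist s (x + p A)" by (simp add: dist_norm)
    then have 3: "\<bar>f (s + ?t *\<^sub>R b) - f (x + p A + ?t *\<^sub>R b)\<bar> \<le> L * (\<epsilon> * norm h)"
      using fl[of "s + ?t *\<^sub>R b" "x + p A + ?t *\<^sub>R b"] Ls by simp
    have IH: "\<bar>f (x + p A) - f x - v \<bullet> p A\<bar> \<le> real (card A) * ((1 + 2 * L) * \<epsilon> * norm h)"
      using insert by auto
    have "v \<bullet> p (insert b A) = v \<bullet> p A + (v \<bullet> b) * ?t"
      by (simp add: pb inner_add_right)
    moreover have "x + p (insert b A) = x + p A + ?t *\<^sub>R b" by (simp add: pb)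
    \<comment> \<open>One error term comes from the slope along \<open>b\<close> at
      \<open>s\<close>; the two terms with factor \<open>L\<close> come from passing between
      \<open>x + p A\<close> and \<open>s\<close> before and after the move.\<close>
    ultimately have "\<bar>f (x + p (insert b A)) - f x - v \<bullet> p (insert b A)\<bar>
       \<le> real (card A) * ((1 + 2 * L) * \<epsilon> * norm h) + (\<epsilon> * norm h + L * (\<epsilon> * norm h) + L * (\<epsilon> * norm h))"
      using 1 2 3 IH by (simp only:)
    also have "\<dots> = real (card (insert b A)) * ((1 + 2 * L) * \<epsilon> * norm h)"
      using insert by (simp add: algebra_simps)
    finally show ?case .
  qed
  have "p Basis = h" by (simp add: p_def euclidean_representation)
  then show ?thesis using step[of Basis] by simp
qed

text \<open>Differentiability along each coordinate line holds off a null set by the one-dimensional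
  theorem and Fubini. Rational slopes and scales \<open>1 / Suc m\<close> sort the points into
  countably many sets \<open>S n v m\<close> on which the coordinatewise approximation is uniform;
  off the null sets \<open>Z n v m\<close>, their points are density points.\<close>

theorem rademacher:
  fixes f :: "'a::euclidean_space \<Rightarrow> real"
  assumes f: "L-lipschitz_on UNIV f"
  shows "negligible {x. \<not> (\<exists>q. GDERIV f x :> q)}"
proof -
  have cont: "continuous_on UNIV f" by (rule lipschitz_on_continuous_on[OF f])
  have L: "0 \<le> L" using f by (rule lipschitz_on_nonneg)
  define A where "A b n q m = {x. \<forall>h\<in>(\<lambda>t. t *\<^sub>R b) ` {t. \<bar>t\<bar> < 1 / real (Suc m)}.
      \<bar>f (x + h) - f x - q * (h \<bullet> b)\<bar> \<le> 1 / real (Suc n) * norm h}" for b n q m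
  define B where "B b = (\<Inter>n. \<Union>q\<in>\<rat>. \<Union>m. A b n q m)" for b
  have A_iff: "x \<in> A b n q m \<longleftrightarrow>
      (\<forall>t. \<bar>t\<bar> < 1 / real (Suc m) \<longrightarrow> \<bar>f (x + t *\<^sub>R b) - f x - q * t\<bar> \<le> 1 / real (Suc n) * \<bar>t\<bar>)"
    if "b \<in> Basis" for x b n q m
    using that by (simp add: A_def)
  have Bnull: "negligible (- B b)" if b: "b \<in> Basis" for b
  proof (rule null_set_if_null_on_lines)
    have "A b n q m \<in> sets borel" for n q m
      unfolding A_def by (intro borel_closed closed_linear_approx cont)
    then have "(\<Union>m. A b n q m) \<in> sets borel" for n q by auto
    then have "(\<Union>q\<in>\<rat>. \<Union>m. A b n q m) \<in> sets borel" for n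
      by (intro sets.countable_UN' countable_rat) auto
    then have "B b \<in> sets borel" unfolding B_def by (intro sets.countable_INT) auto
    then show "- B b \<in> sets borel" by (rule borel_comp)
    fix x
    let ?g = "\<lambda>s. f (x + s *\<^sub>R b)"
    have "L-lipschitz_on UNIV ?g"
    proof (rule lipschitz_onI[OF _ L])
      fix s t :: real
      have "dist (f (x + s *\<^sub>R b)) (f (x + t *\<^sub>R b)) \<le> L * dist (x + s *\<^sub>R b) (x + t *\<^sub>R b)"
        by (rule lipschitz_onD[OF f]) auto
      also have "dist (x + s *\<^sub>R b) (x + t *\<^sub>R b) = dist s t"
        using b by (simp add: dist_norm flip: scaleR_diff_left)
      finally show "dist (?g s) (?g t) \<le> L * dist s t" .
    qed
    note neg = lipschitz_real_differentiable_ae[OF this]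
    have "x + s *\<^sub>R b \<in> B b"
      if ex: "\<exists>q. \<forall>e>0. \<exists>d>0. \<forall>t. \<bar>t\<bar> < d \<longrightarrow> \<bar>?g (s + t) - ?g s - q * t\<bar> \<le> e * \<bar>t\<bar>" for s
      unfolding B_def
    proof (rule INT_I)
      fix n
      obtain p where p: "\<And>e. e > 0 \<Longrightarrow> \<exists>d>0. \<forall>t. \<bar>t\<bar> < d \<longrightarrow> \<bar>?g (s + t) - ?g s - p * t\<bar> \<le> e * \<bar>t\<bar>"
        using ex by blast
      define e where "e = 1 / real (Suc n) / 2"
      have e: "0 < e" "1 / real (Suc n) * r = e * r + e * r" for r
        unfolding e_def distrib_right[symmetric] field_sum_of_halves by simp_all
      obtain d where d: "0 < d" "\<And>t. \<bar>t\<bar> < d \<Longrightarrow> \<bar>?g (s + t) - ?g s - p * t\<bar> \<le> e * \<bar>t\<bar>"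
        using p[OF e(1)] by blast
      obtain q where q: "q \<in> \<rat>" "p < q" "q < p + e" using Rats_dense_in_real[of p "p + e"] e(1) by auto
      obtain m where m: "1 / real (Suc m) < d" using d(1) by (rule nat_approx_posE)
      have "\<bar>f (x + s *\<^sub>R b + t *\<^sub>R b) - f (x + s *\<^sub>R b) - q * t\<bar> \<le> 1 / real (Suc n) * \<bar>t\<bar>"
        if t: "\<bar>t\<bar> < 1 / real (Suc m)" for t
      proof -
        have "\<bar>?g (s + t) - ?g s - p * t\<bar> \<le> e * \<bar>t\<bar>" using t m by (intro d(2)) linarith
        moreover have "\<bar>(p - q) * t\<bar> \<le> e * \<bar>t\<bar>"
          unfolding abs_mult using q by (intro mult_right_mono) auto
        moreover have "f (x + s *\<^sub>R b + t *\<^sub>R b) - f (x + s *\<^sub>R b) - q * t = (?g (s + t) - ?g s - p * t) + (p - q) * t"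
          by (simp add: algebra_simps)
        ultimately show ?thesis unfolding e(2) by linarith
      qed
      then have "x + s *\<^sub>R b \<in> A b n q m" using A_iff[OF b] by blast
      then show "x + s *\<^sub>R b \<in> (\<Union>q\<in>\<rat>. \<Union>m. A b n q m)" using q(1) by blast
    qed
    then show "negligible {t. x + t *\<^sub>R b \<in> - B b}"
      by (intro negligible_subset[OF neg]) blast
  qed
  \<comment> \<open>Vectors with rational coordinates; their countability keeps the union of the
    exceptional sets \<open>Z n v m\<close> null.\<close>
  define V where "V = (\<lambda>c. \<Sum>b\<in>(Basis::'a set). c b *\<^sub>R b) ` (Basis \<rightarrow>\<^sub>E (\<rat>::real set))"
  have V: "countable V" unfolding V_def by (intro countable_image countable_PiE countable_rat finite_Basis)
  define S where "S n v m = (\<Inter>b\<in>Basis. A b n (v \<bullet> b) m)" for n v m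
  have S_meas: "S n v m \<in> sets lebesgue" for n v m
  proof -
    have "closed (S n v m)"
      unfolding S_def A_def by (intro closed_INT ballI closed_linear_approx cont)
    then show ?thesis by (intro sets_completionI_sets) auto
  qed
  define Z where "Z n v m = {x \<in> S n v m. \<not> (\<forall>e>0. \<exists>d>0. \<forall>r. 0 < r \<longrightarrow> r < d \<longrightarrow>
    emeasure lebesgue (ball x r - S n v m) \<le> ennreal e * emeasure lebesgue (ball x r))}" for n v m
  have "negligible (\<Union>b\<in>Basis. - B b)" using Bnull by (intro negligible_Union) auto
  moreover have "negligible (\<Union>v\<in>V. \<Union>n. \<Union>m. Z n v m)"
  proof -
    have "negligible (Z n v m)" for n v m unfolding Z_def by (rule lebesgue_density[OF S_meas])
    then have "negligible (\<Union>n. \<Union>m. Z n v m)" for v by (intro negligible_Union_nat)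
    then show ?thesis by (intro negligible_countable_Union countable_image V) auto
  qed
  ultimately have neg: "negligible ((\<Union>b\<in>Basis. - B b) \<union> (\<Union>v\<in>V. \<Union>n. \<Union>m. Z n v m))" by (rule negligible_Un)
  have diff: "\<exists>q. GDERIV f x :> q" if xB: "\<And>b. b \<in> Basis \<Longrightarrow> x \<in> B b" and xZ: "\<And>n v m. v \<in> V \<Longrightarrow> x \<notin> Z n v m" for x
  proof (rule gderiv_criterion)
    fix e :: real assume e: "0 < e"
    \<comment> \<open>\<open>K\<close> is the factor lost in
      \<open>linear_approx_at_density_point\<close>, so the tolerance \<open>1 / Suc n\<close> is
      taken below \<open>e / K\<close>.\<close>
    define K where "K = real DIM('a) * (1 + 2 * L)"
    have K: "0 < K" using L by (simp add: K_def)
    obtain n where n: "1 / real (Suc n) < e / K" using e K by (rule_tac nat_approx_posE[of "e / K"]) auto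
    have "\<exists>q m. q \<in> \<rat> \<and> x \<in> A b n q m" if "b \<in> Basis" for b
      using INT_D[OF xB[OF that, unfolded B_def], of n] by (simp add: Bex_def)
    then obtain q m where q: "\<And>b. b \<in> Basis \<Longrightarrow> q b \<in> \<rat>" and m: "\<And>b. b \<in> Basis \<Longrightarrow> x \<in> A b n (q b) (m b)"
      by metis
    define v where "v = (\<Sum>b\<in>Basis. q b *\<^sub>R b)"
    have v: "v \<bullet> b = q b" if "b \<in> Basis" for b
      using that by (simp add: v_def)
    have "v = (\<Sum>b\<in>Basis. restrict q Basis b *\<^sub>R b)" by (simp add: v_def)
    then have "v \<in> V" unfolding V_def using q by (auto intro!: image_eqI[of _ _ "restrict q Basis"])
    \<comment> \<open>The coordinates come with different scales; the largest index gives one that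
      is valid for all of them.\<close>
    define M where "M = Max (m ` Basis)"
    have "x \<in> A b n (v \<bullet> b) M" if b: "b \<in> Basis" for b
    proof -
      have "m b \<le> M" using b by (simp add: M_def)
      then have "1 / real (Suc M) \<le> 1 / real (Suc (m b))" by (intro divide_left_mono) auto
      then show ?thesis using m[OF b] unfolding v[OF b] A_iff[OF b] by (meson order_less_le_trans)
    qed
    then have xS: "x \<in> S n v M" by (simp add: S_def)
    let ?\<epsilon> = "1 / real (Suc n)"
    have "\<forall>e>0. \<exists>d>0. \<forall>r. 0 < r \<longrightarrow> r < d \<longrightarrow>
        emeasure lebesgue (ball x r - S n v M) \<le> ennreal e * emeasure lebesgue (ball x r)"
      using xZ[OF \<open>v \<in> V\<close>, of n M] xS unfolding Z_def by blast
    moreover have "0 < ?\<epsilon>" by simp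
    ultimately obtain d where d: "0 < d"
      "\<And>h. norm h < d \<Longrightarrow> h \<noteq> 0 \<Longrightarrow> \<exists>s\<in>S n v M. dist s (x + h) \<le> ?\<epsilon> * norm h"
      using lebesgue_density_near[OF _ S_meas] by metis
    define d' where "d' = min d (1 / real (Suc M))"
    have "\<bar>f (x + h) - f x - v \<bullet> h\<bar> \<le> e * norm h" if h: "norm h < d'" for h
    proof -
      have "\<bar>f (x + h) - f x - v \<bullet> h\<bar> \<le> real DIM('a) * ((1 + 2 * L) * ?\<epsilon> * norm h)"
      proof (rule linear_approx_at_density_point[OF f _ xS, where d = d'])
        fix s b :: 'a and t assume "s \<in> S n v M" "b \<in> Basis" "\<bar>t\<bar> < d'"
        then show "\<bar>f (s + t *\<^sub>R b) - f s - (v \<bullet> b) * t\<bar> \<le> ?\<epsilon> * \<bar>t\<bar>"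
          using A_iff[of b s n "v \<bullet> b" M] by (auto simp: S_def d'_def)
      qed (use d h in \<open>auto simp: d'_def\<close>)
      also have "\<dots> = K * ?\<epsilon> * norm h" by (simp add: K_def)
      also have "\<dots> \<le> e * norm h"
      proof (rule mult_right_mono)
        have "?\<epsilon> * K \<le> e" using n K by (subst pos_le_divide_eq[symmetric]) auto
        then show "K * ?\<epsilon> \<le> e" by (simp only: mult.commute)
      qed simp
      finally show ?thesis .
    qed
    moreover have "0 < d'" using d(1) by (simp add: d'_def)
    ultimately show "\<exists>q. \<exists>d>0. \<forall>h. norm h < d \<longrightarrow> \<bar>f (x + h) - f x - q \<bullet> h\<bar> \<le> e * norm h" by blast
  qed
  have "{x. \<not> (\<exists>q. GDERIV f x :> q)} \<subseteq> (\<Union>b\<in>Basis. - B b) \<union> (\<Union>v\<in>V. \<Union>n. \<Union>m. Z n v m)" (is "_ \<subseteq> ?W")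
  proof (rule subsetI, rule ccontr)
    fix x assume x: "x \<in> {x. \<not> (\<exists>q. GDERIV f x :> q)}" "x \<notin> ?W"
    have "x \<in> B b" if "b \<in> Basis" for b using x(2) that by simp
    moreover have "x \<notin> Z n v m" if "v \<in> V" for n v m using x(2) that by simp
    ultimately have "\<exists>q. GDERIV f x :> q" by (rule diff)
    then show False using x(1) by simp
  qed
  with neg show ?thesis by (rule negligible_subset)
qed

section \<open>Extension of Lipschitz functions\<close>

lemma mcshane_extension:
  fixes f :: "'a::metric_space \<Rightarrow> real"
  assumes f: "L-lipschitz_on S f"
  obtains g where "L-lipschitz_on UNIV g" "\<And>x. x \<in> S \<Longrightarrow> g x = f x"
proof (cases "S = {}")
  case True
  have "L-lipschitz_on UNIV (\<lambda>_::'a. 0::real)"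
    using lipschitz_on_nonneg[OF f] by (intro lipschitz_onI) auto
  then show thesis using that True by blast
next
  case False
  then obtain z0 where z0: "z0 \<in> S" by blast
  have L: "0 \<le> L" by (rule lipschitz_on_nonneg[OF f])
  have fl: "f y \<le> f z + L * dist y z" if "y \<in> S" "z \<in> S" for y z
    using lipschitz_onD[OF f that] by (simp add: dist_real_def)
  \<comment> \<open>The lower envelope of the upward cones of slope \<open>L\<close> with apexes on
    the graph of \<open>f\<close>.\<close>
  define g where "g x = (INF z\<in>S. f z + L * dist x z)" for x
  have bdd: "bdd_below ((\<lambda>z. f z + L * dist x z) ` S)" for x
  proof (rule bdd_belowI2)
    fix z assume z: "z \<in> S"
    have "L * dist z0 z \<le> L * (dist x z0 + dist x z)"
      using L by (intro mult_left_mono) (auto simp: dist_triangle3)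
    then show "f z0 - L * dist x z0 \<le> f z + L * dist x z"
      using fl[OF z0 z] by (simp add: distrib_left)
  qed
  have "g x \<le> g y + L * dist x y" for x y
  proof -
    have "g x - L * dist x y \<le> f z + L * dist y z" if z: "z \<in> S" for z
    proof -
      have "g x \<le> f z + L * dist x z" unfolding g_def by (rule cINF_lower[OF bdd z])
      moreover have "L * dist x z \<le> L * (dist x y + dist y z)"
        using L by (intro mult_left_mono) (auto simp: dist_triangle)
      ultimately show ?thesis by (simp add: distrib_left)
    qed
    then have "g x - L * dist x y \<le> g y" unfolding g_def[of y] by (intro cINF_greatest False)
    then show ?thesis by simp
  qed
  note gl = this
  have "L-lipschitz_on UNIV g"
  proof (rule lipschitz_onI[OF _ L])
    fix x y
    show "dist (g x) (g y) \<le> L * dist x y"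
      using gl[of x y] gl[of y x] by (simp add: dist_real_def dist_commute)
  qed
  moreover have "g x = f x" if x: "x \<in> S" for x
  proof (rule antisym)
    show "g x \<le> f x" unfolding g_def using cINF_lower[OF bdd x, of x] by simp
    show "f x \<le> g x" unfolding g_def using fl[OF x] by (intro cINF_greatest False) auto
  qed
  ultimately show thesis using that by blast
qed

text \<open>McShane's extension is applied to each coordinate. This may enlarge the Lipschitz
  constant of the vector-valued map, but Rademacher's theorem holds for every coordinate, and
  finitely many null sets have a null union.\<close>

lemma lipschitz_on_differentiable_extension:
  fixes f :: "'a::euclidean_space \<Rightarrow> 'b::euclidean_space"
  assumes f: "L-lipschitz_on S f"
  obtains G where "\<And>x. x \<in> S \<Longrightarrow> G x = f x" "negligible {x. \<not> G differentiable (at x)}"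
proof -
  have comp: "L-lipschitz_on S (\<lambda>x. f x \<bullet> b)" if "b \<in> Basis" for b
  proof (rule lipschitz_onI[OF _ lipschitz_on_nonneg[OF f]])
    fix x y assume "x \<in> S" "y \<in> S"
    then have "dist (f x) (f y) \<le> L * dist x y" by (rule lipschitz_onD[OF f])
    moreover have "dist (f x \<bullet> b) (f y \<bullet> b) \<le> dist (f x) (f y)"
      using Basis_le_norm[OF that, of "f x - f y"] by (simp add: dist_norm inner_diff_left)
    ultimately show "dist (f x \<bullet> b) (f y \<bullet> b) \<le> L * dist x y" by simp
  qed
  have "\<exists>g. L-lipschitz_on UNIV g \<and> (\<forall>x\<in>S. g x = f x \<bullet> b)" if "b \<in> Basis" for b
    by (rule mcshane_extension[OF comp[OF that]]) blast
  then obtain g where g: "\<And>b. b \<in> Basis \<Longrightarrow> L-lipschitz_on UNIV (g b)"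
    and gf: "\<And>b x. b \<in> Basis \<Longrightarrow> x \<in> S \<Longrightarrow> g b x = f x \<bullet> b" by metis
  define G where "G x = (\<Sum>b\<in>Basis. g b x *\<^sub>R b)" for x
  have neg: "negligible (\<Union>b\<in>Basis. {x. \<not> (\<exists>q. GDERIV (g b) x :> q)})"
    by (intro negligible_Union) (use rademacher[OF g] in auto)
  have diff: "G differentiable (at x)" if grad: "\<And>b. b \<in> Basis \<Longrightarrow> \<exists>q. GDERIV (g b) x :> q" for x
    unfolding G_def
  proof (rule differentiable_sum)
    show "\<forall>b\<in>Basis. (\<lambda>x. g b x *\<^sub>R b) differentiable (at x)"
    proof
      fix b :: 'b assume "b \<in> Basis"
      then obtain q where "GDERIV (g b) x :> q" using grad by blast
      then have "(g b has_derivative (\<lambda>h. h \<bullet> q)) (at x)" by (simp only: gderiv_def)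
      then have "((\<lambda>x. g b x *\<^sub>R b) has_derivative (\<lambda>h. (h \<bullet> q) *\<^sub>R b)) (at x)"
        by (rule has_derivative_scaleR_left)
      then show "(\<lambda>x. g b x *\<^sub>R b) differentiable (at x)" by (rule differentiableI)
    qed
  qed simp
  have "{x. \<not> G differentiable (at x)} \<subseteq> (\<Union>b\<in>Basis. {x. \<not> (\<exists>q. GDERIV (g b) x :> q)})"
    using diff by blast
  with neg have "negligible {x. \<not> G differentiable (at x)}" by (rule negligible_subset)
  moreover have "G x = f x" if "x \<in> S" for x
    using that by (simp add: G_def gf euclidean_representation)
  ultimately show thesis using that by blast
qed

section \<open>Change of variables and approximate derivatives\<close>

text \<open>
  The change of variables theorem of the library is stated for index types that carry a well-order.
  An arbitrary finite index type is replaced by a copy of itself that has one.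
\<close>

typedef 'n ordered_copy = "UNIV :: 'n set" morphisms of_copy to_copy by simp

lemma bij_of_copy: "bij of_copy" and bij_to_copy: "bij to_copy"
  by (auto intro!: bij_betw_byWitness[where f' = to_copy] bij_betw_byWitness[where f' = of_copy]
      simp: of_copy_inverse to_copy_inverse)

instance ordered_copy :: (finite) finite
proof
  have "surj (to_copy :: 'a \<Rightarrow> 'a ordered_copy)" by (rule bij_is_surj[OF bij_to_copy])
  then show "finite (UNIV :: 'a ordered_copy set)" by (metis finite finite_imageI)
qed

instantiation ordered_copy :: (finite) wellorder
begin

definition less_eq_ordered_copy :: "'a ordered_copy \<Rightarrow> 'a ordered_copy \<Rightarrow> bool" where
  "less_eq_ordered_copy a b \<longleftrightarrow> to_nat (of_copy a) \<le> to_nat (of_copy b)"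

definition less_ordered_copy :: "'a ordered_copy \<Rightarrow> 'a ordered_copy \<Rightarrow> bool" where
  "less_ordered_copy a b \<longleftrightarrow> to_nat (of_copy a) < to_nat (of_copy b)"

instance
proof
  fix P :: "'a ordered_copy \<Rightarrow> bool" and a
  assume "\<And>x. (\<And>y. y < x \<Longrightarrow> P y) \<Longrightarrow> P x"
  then show "P a"
    unfolding less_ordered_copy_def by (rule measure_induct_rule[of "\<lambda>a. to_nat (of_copy a)"])
qed (auto simp: less_ordered_copy_def less_eq_ordered_copy_def of_copy_inject)

end

text \<open>Conjugation with \<open>f\<close> is a sign-preserving bijection between the
  permutations of the two index types and matches the Leibniz products.\<close>

lemma det_reindex:
  fixes M :: "real^'n^'n"
  assumes f: "bij (f :: 'm::finite \<Rightarrow> 'n)"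
  shows "det (\<chi> i j. M $ f i $ f j) = det M"
proof -
  let ?g = "inv f"
  have g: "bij ?g" by (rule bij_imp_bij_inv[OF f])
  have inj: "inj f" "inj ?g" using f g by (auto simp: bij_def)
  have gf: "?g (f x) = x" and fg: "f (?g y) = y" for x y
    using f by (auto simp: bij_def surj_f_inv_f)
  let ?h = "map_permutation UNIV f"
  have "(\<Sum>p | p permutes (UNIV :: 'm set). of_int (sign p) * (\<Prod>i\<in>UNIV. M $ f i $ f (p i)))
      = (\<Sum>p | p permutes (UNIV :: 'n set). of_int (sign p) * (\<Prod>i\<in>UNIV. M $ i $ p i))"
  proof (rule sum.reindex_bij_witness[where j = ?h and i = "map_permutation UNIV ?g"], goal_cases)
    case (1 p)
    then show ?case using map_permutation_compose_inv[OF f, of p ?g] gf by auto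
  next
    case (2 p)
    then show ?case using map_permutation_permutes[OF f, of p] by auto
  next
    case (3 p)
    then show ?case using map_permutation_compose_inv[OF g, of p f] fg by auto
  next
    case (4 p)
    then show ?case using map_permutation_permutes[OF g, of p] by auto
  next
    case (5 p)
    then have p: "p permutes UNIV" by simp
    have "sign (?h p) = sign p" using p inj by (intro sign_map_permutation) auto
    moreover have "(\<Prod>i\<in>UNIV. M $ i $ ?h p i) = (\<Prod>i\<in>UNIV. M $ f i $ ?h p (f i))"
      by (rule prod.reindex_bij_betw[OF f, symmetric])
    ultimately show ?case using inj by (simp add: map_permutation_apply)
  qed
  then show ?thesis by (simp add: det_def)
qed

section \<open>Renaming coordinates by the ordered copy\<close>

definition copy_vec :: "real^'n \<Rightarrow> real^('n ordered_copy)" where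
  "copy_vec x = (\<chi> i. x $ of_copy i)"

definition uncopy_vec :: "real^('n ordered_copy) \<Rightarrow> real^'n" where
  "uncopy_vec y = (\<chi> j. y $ to_copy j)"

lemma uncopy_copy [simp]: "uncopy_vec (copy_vec x) = x" and copy_uncopy [simp]: "copy_vec (uncopy_vec y) = y"
  by (simp_all add: copy_vec_def uncopy_vec_def vec_eq_iff of_copy_inverse to_copy_inverse)

lemma bounded_linear_copy: "bounded_linear copy_vec" "bounded_linear uncopy_vec"
  by (auto intro!: linear_conv_bounded_linear[THEN iffD1] linearI simp: copy_vec_def uncopy_vec_def vec_eq_iff)

lemma borel_measurable_copy [measurable]: "copy_vec \<in> borel_measurable borel" "uncopy_vec \<in> borel_measurable borel"
  using bounded_linear_copy by (auto intro!: borel_measurable_continuous_onI linear_continuous_on)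

lemma prod_Basis_cart: "(\<Prod>b\<in>Basis. x \<bullet> b) = (\<Prod>i\<in>UNIV. x $ i)" for x :: "real^'n"
proof -
  have B: "(Basis :: (real^'n) set) = range (\<lambda>i. axis i 1)" by (auto simp: Basis_vec_def)
  have I: "inj (\<lambda>i::'n. axis i (1::real))" by (auto simp: inj_def axis_eq_axis)
  show ?thesis unfolding B by (subst prod.reindex[OF I]) (simp add: inner_axis)
qed

lemma lborel_distr_copy: "distr lborel borel copy_vec = (lborel :: (real^('n::finite ordered_copy)) measure)"
proof (rule lborel_eqI[symmetric])
  fix l u :: "real^('n::finite ordered_copy)"
  assume lu: "\<And>b. b \<in> Basis \<Longrightarrow> l \<bullet> b \<le> u \<bullet> b"
  have lu': "l $ i \<le> u $ i" for i using lu[of "axis i 1"] by (simp only: inner_axis axis_in_Basis_iff) simp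
  have "x \<in> copy_vec -` box l u \<longleftrightarrow> x \<in> box (uncopy_vec l) (uncopy_vec u)" for x
  proof -
    have "(\<forall>i. l $ i < copy_vec x $ i \<and> copy_vec x $ i < u $ i)
        \<longleftrightarrow> (\<forall>j. l $ to_copy j < copy_vec x $ to_copy j \<and> copy_vec x $ to_copy j < u $ to_copy j)"
      by (metis of_copy_inverse)
    then show ?thesis by (simp add: mem_box_cart copy_vec_def uncopy_vec_def to_copy_inverse)
  qed
  then have "copy_vec -` box l u = box (uncopy_vec l) (uncopy_vec u)" by blast
  moreover have "uncopy_vec l \<bullet> b \<le> uncopy_vec u \<bullet> b" if "b \<in> Basis" for b
    using that lu' by (auto simp: Basis_vec_def inner_axis uncopy_vec_def)
  ultimately have "emeasure (distr lborel borel copy_vec) (box l u) = (\<Prod>b\<in>Basis. (uncopy_vec u - uncopy_vec l) \<bullet> b)"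
    by (simp add: emeasure_distr emeasure_lborel_box)
  also have "(\<Prod>b\<in>Basis. (uncopy_vec u - uncopy_vec l) \<bullet> b) = (\<Prod>b\<in>Basis. (u - l) \<bullet> b)"
    unfolding prod_Basis_cart
    using prod.reindex_bij_betw[OF bij_to_copy, of "\<lambda>i. (u - l) $ i"] by (simp add: uncopy_vec_def)
  finally show "emeasure (distr lborel borel copy_vec) (box l u) = (\<Prod>b\<in>Basis. (u - l) \<bullet> b)" .
qed simp

text \<open>The function \<open>d\<close> is chosen before \<open>\<rho>\<close> and
  \<open>B\<close>, so that one Jacobian factor serves all test sets. It is a Borel version of the
  determinant, whose Lebesgue measurability is all that is known at first.\<close>

lemma change_of_variables_wellorder:
  fixes g f :: "real^'m::{finite,wellorder} \<Rightarrow> real^'m::_"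
  assumes S: "S \<in> sets borel" and gS: "g ` S \<in> sets borel"
    and der: "\<And>y. y \<in> S \<Longrightarrow> (g has_derivative g' y) (at y within S)"
    and f: "f \<in> borel_measurable borel" and fg: "\<And>y. y \<in> S \<Longrightarrow> f (g y) = y"
  obtains d where "d \<in> borel_measurable borel" "\<And>y. 0 \<le> d y"
    "AE y in lborel. y \<in> S \<longrightarrow> d y = \<bar>det (matrix (g' y))\<bar>"
    "\<And>\<rho> B. integrable lborel \<rho> \<Longrightarrow> (\<And>x. 0 \<le> \<rho> x) \<Longrightarrow> B \<in> sets borel \<Longrightarrow>
      (\<integral>\<^sup>+y. ennreal (\<rho> (g y) * d y) * indicator (S \<inter> B) y \<partial>lborel)
        = (\<integral>\<^sup>+x. ennreal (\<rho> x) * indicator (g ` S \<inter> f -` B) x \<partial>lborel)"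
proof -
  let ?D = "\<lambda>y. \<bar>det (matrix (g' y))\<bar>"
  have SL: "S \<in> sets lebesgue" using S by (intro sets_completionI_sets) simp
  have inj: "inj_on g S" by (rule inj_on_inverseI[of S f g]) (rule fg)
  have "?D \<in> borel_measurable (lebesgue_on S)"
    using borel_measurable_det_Jacobian[OF SL der] by measurable
  then have "(\<lambda>y. if y \<in> S then ?D y else 0) \<in> borel_measurable lebesgue"
    using SL by (subst borel_measurable_if) auto
  then obtain d0 where d0: "d0 \<in> borel_measurable borel" "AE y in lborel. (if y \<in> S then ?D y else 0) = d0 y"
    using completion_ex_borel_measurable_real[of "\<lambda>y. if y \<in> S then ?D y else 0" lborel] by auto
  define d where "d y = \<bar>d0 y\<bar>" for y
  have AE_d: "AE y in lborel. y \<in> S \<longrightarrow> d y = ?D y"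
    using d0(2) by eventually_elim (auto simp: d_def split: if_splits)
  show thesis
  proof (rule that[of d])
    show "d \<in> borel_measurable borel" using d0(1) unfolding d_def by measurable
    show "0 \<le> d y" for y by (simp add: d_def)
    show "AE y in lborel. y \<in> S \<longrightarrow> d y = ?D y" by (rule AE_d)
    fix \<rho> :: "real^'m::_ \<Rightarrow> real" and B :: "(real^'m::_) set"
    assume \<rho>: "integrable lborel \<rho>" "\<And>x. 0 \<le> \<rho> x" and B: "B \<in> sets borel"
    define T where "T = S \<inter> B"
    have T: "T \<in> sets borel" "T \<subseteq> S" using S B by (auto simp: T_def)
    have TL: "T \<in> sets lebesgue" using T by (intro sets_completionI_sets) simp
    \<comment> \<open>Since \<open>f\<close> inverts \<open>g\<close> on \<open>S\<close>, images of
      Borel sets are preimages under \<open>f\<close>, hence Borel again.\<close>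
    have gT: "g ` T = g ` S \<inter> f -` B" using fg by (auto simp: T_def)
    have "f -` B \<in> sets borel" using measurable_sets_borel[OF f B] .
    then have gTb: "g ` T \<in> sets borel" unfolding gT using gS by blast
    have gTL: "g ` T \<in> sets lebesgue" using gTb by (intro sets_completionI_sets) simp
    have der_T: "(g has_derivative g' y) (at y within T)" if "y \<in> T" for y
      using der[of y] that T(2) by (blast intro: has_derivative_subset)
    have "integrable lebesgue \<rho>" using \<rho>(1) by (simp add: integrable_completion borel_measurable_integrable)
    then have \<rho>T: "\<rho> absolutely_integrable_on (g ` T)"
      using gTL unfolding set_integrable_def by (intro integrable_mult_indicator)
    \<comment> \<open>Real integrands pass through the change of variables theorem as vectors with
      one component.\<close>
    let ?F = "\<lambda>x. vec (\<rho> x) :: real^1"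
    have "?F absolutely_integrable_on (g ` T) \<and> integral (g ` T) ?F = vec (integral (g ` T) \<rho>)"
      using \<rho>T by (simp add: absolutely_integrable_on_1_iff integral_on_1_eq)
    then have "(\<lambda>y. ?D y *\<^sub>R ?F (g y)) absolutely_integrable_on T \<and>
        integral T (\<lambda>y. ?D y *\<^sub>R ?F (g y)) = vec (integral (g ` T) \<rho>)"
      by (subst has_absolute_integral_change_of_variables[OF TL der_T inj_on_subset[OF inj T(2)]]) auto
    then have h: "(\<lambda>y. ?D y * \<rho> (g y)) absolutely_integrable_on T"
        "integral T (\<lambda>y. ?D y * \<rho> (g y)) = integral (g ` T) \<rho>"
      by (auto simp: absolutely_integrable_on_1_iff integral_on_1_eq vec_eq_iff)
    have nn: "(\<integral>\<^sup>+x. ennreal (indicator A x *\<^sub>R u x) \<partial>lborel) = ennreal (integral A u)"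
      if "u absolutely_integrable_on A" "\<And>x. 0 \<le> u x" for A and u :: "real^'m::_ \<Rightarrow> real"
    proof -
      have "(\<integral>\<^sup>+x. ennreal (indicator A x *\<^sub>R u x) \<partial>lebesgue) = ennreal (LINT x:A|lebesgue. u x)"
        using that unfolding set_lebesgue_integral_def set_integrable_def
        by (intro nn_integral_eq_integral) auto
      then show ?thesis
        using set_lebesgue_integral_eq_integral(2)[OF that(1)] by (simp add: nn_integral_completion)
    qed
    have "(\<integral>\<^sup>+y. ennreal (\<rho> (g y) * d y) * indicator (S \<inter> B) y \<partial>lborel)
        = (\<integral>\<^sup>+y. ennreal (indicator T y *\<^sub>R (?D y * \<rho> (g y))) \<partial>lborel)"
      using AE_d T_def by (intro nn_integral_cong_AE) (auto simp: indicator_def mult.commute)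
    also have "\<dots> = ennreal (integral (g ` T) \<rho>)"
      using nn[OF h(1)] \<rho>(2) h(2) by simp
    also have "\<dots> = (\<integral>\<^sup>+x. ennreal (indicator (g ` T) x *\<^sub>R \<rho> x) \<partial>lborel)"
      using nn[OF \<rho>T] \<rho>(2) by simp
    also have "\<dots> = (\<integral>\<^sup>+x. ennreal (\<rho> x) * indicator (g ` S \<inter> f -` B) x \<partial>lborel)"
      unfolding gT by (intro nn_integral_cong) (auto simp: indicator_def)
    finally show "(\<integral>\<^sup>+y. ennreal (\<rho> (g y) * d y) * indicator (S \<inter> B) y \<partial>lborel)
        = (\<integral>\<^sup>+x. ennreal (\<rho> x) * indicator (g ` S \<inter> f -` B) x \<partial>lborel)" .
  qed
qed

text \<open>Everything is conjugated with \<open>copy_vec\<close>, which preserves Lebesgue measure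
  and only renames the indices of the Jacobian matrix.\<close>

lemma change_of_variables:
  fixes g f :: "real^'n \<Rightarrow> real^'n"
  assumes S: "S \<in> sets borel" and gS: "g ` S \<in> sets borel"
    and der: "\<And>y. y \<in> S \<Longrightarrow> (g has_derivative g' y) (at y within S)"
    and f: "f \<in> borel_measurable borel" and g: "g \<in> borel_measurable borel"
    and fg: "\<And>y. y \<in> S \<Longrightarrow> f (g y) = y"
  obtains d where "d \<in> borel_measurable borel" "\<And>y. 0 \<le> d y"
    "AE y in lborel. y \<in> S \<longrightarrow> d y = \<bar>det (matrix (g' y))\<bar>"
    "\<And>\<rho> B. integrable lborel \<rho> \<Longrightarrow> (\<And>x. 0 \<le> \<rho> x) \<Longrightarrow> B \<in> sets borel \<Longrightarrow>
      (\<integral>\<^sup>+y. ennreal (\<rho> (g y) * d y) * indicator (S \<inter> B) y \<partial>lborel)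
        = (\<integral>\<^sup>+x. ennreal (\<rho> x) * indicator (g ` S \<inter> f -` B) x \<partial>lborel)"
proof -
  note [measurable] = f g
  let ?c = "copy_vec :: real^'n \<Rightarrow> _" and ?u = "uncopy_vec :: _ \<Rightarrow> real^'n"
  let ?S = "?u -` S" and ?g = "\<lambda>y. ?c (g (?u y))" and ?f = "\<lambda>y. ?c (f (?u y))"
  let ?g' = "\<lambda>y h. ?c (g' (?u y) (?u h))"
  have img: "?g ` ?S = ?u -` (g ` S)"
  proof (intro equalityI subsetI)
    fix y assume "y \<in> ?u -` (g ` S)"
    then obtain x where "x \<in> S" "?u y = g x" by auto
    then have "y = ?g (?c x)" by (metis copy_uncopy uncopy_copy)
    then show "y \<in> ?g ` ?S" using \<open>x \<in> S\<close> by (intro image_eqI[of _ _ "?c x"]) auto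
  qed auto
  have uS: "?u -` A \<in> sets borel" if "A \<in> sets borel" for A
    using that by (rule measurable_sets_borel[OF borel_measurable_copy(2)])
  have "(?g has_derivative ?g' y) (at y within ?S)" if "y \<in> ?S" for y
  proof -
    have "(?u has_derivative ?u) (at y within ?S)"
      by (rule bounded_linear_imp_has_derivative[OF bounded_linear_copy(2)])
    moreover have "(g has_derivative g' (?u y)) (at (?u y) within ?u ` ?S)"
      using der[of "?u y"] that by (auto intro: has_derivative_subset)
    ultimately have "((\<lambda>y. g (?u y)) has_derivative (\<lambda>h. g' (?u y) (?u h))) (at y within ?S)"
      by (rule has_derivative_in_compose)
    then show ?thesis by (rule bounded_linear.has_derivative[OF bounded_linear_copy(1)])
  qed
  moreover have "?f \<in> borel_measurable borel" by measurable
  moreover have "?f (?g y) = y" if "y \<in> ?S" for y using that fg by simp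
  ultimately obtain e where e: "e \<in> borel_measurable borel" "\<And>y. 0 \<le> e y"
    "AE y in lborel. y \<in> ?S \<longrightarrow> e y = \<bar>det (matrix (?g' y))\<bar>"
    and int: "\<And>\<rho> B. integrable lborel \<rho> \<Longrightarrow> (\<And>x. 0 \<le> \<rho> x) \<Longrightarrow> B \<in> sets borel \<Longrightarrow>
      (\<integral>\<^sup>+y. ennreal (\<rho> (?g y) * e y) * indicator (?S \<inter> B) y \<partial>lborel)
        = (\<integral>\<^sup>+x. ennreal (\<rho> x) * indicator (?g ` ?S \<inter> ?f -` B) x \<partial>lborel)"
    using change_of_variables_wellorder[OF uS[OF S] uS[OF gS, folded img], of ?g' ?f] by blast
  note [measurable] = e(1) S gS
  have distr: "(\<integral>\<^sup>+y. \<phi> y \<partial>lborel) = (\<integral>\<^sup>+x. \<phi> (?c x) \<partial>lborel)" if "\<phi> \<in> borel_measurable borel" for \<phi>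
    using that by (subst lborel_distr_copy[symmetric], subst nn_integral_distr) auto
  have mat: "\<bar>det (matrix (?g' (?c x)))\<bar> = \<bar>det (matrix (g' x))\<bar>" if "x \<in> S" for x
  proof -
    have ax: "?u (axis j 1) = axis (of_copy j) 1" for j
      by (auto simp: uncopy_vec_def vec_eq_iff axis_def to_copy_inverse of_copy_inverse)
    have "?c v $ i = v $ of_copy i" for v i by (simp add: copy_vec_def)
    then have "matrix (?g' (?c x)) = (\<chi> i j. matrix (g' x) $ of_copy i $ of_copy j)"
      by (simp add: matrix_def vec_eq_iff[where 'a = "real^'n ordered_copy"] vec_eq_iff[where 'a = real] ax)
    then show ?thesis using det_reindex[OF bij_of_copy, of "matrix (g' x)"] by simp
  qed
  show thesis
  proof (rule that[of "\<lambda>x. e (?c x)"])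
    have "AE x in lborel. ?c x \<in> ?S \<longrightarrow> e (?c x) = \<bar>det (matrix (?g' (?c x)))\<bar>"
    proof (rule AE_distrD[of ?c lborel borel])
      show "AE y in distr lborel borel ?c. y \<in> ?S \<longrightarrow> e y = \<bar>det (matrix (?g' y))\<bar>"
        unfolding lborel_distr_copy by (rule e(3))
    qed simp
    then show "AE x in lborel. x \<in> S \<longrightarrow> e (?c x) = \<bar>det (matrix (g' x))\<bar>"
      by eventually_elim (use mat in auto)
    fix \<rho> :: "real^'n \<Rightarrow> real" and B :: "(real^'n) set"
    assume \<rho>: "integrable lborel \<rho>" "\<And>x. 0 \<le> \<rho> x" and B[measurable]: "B \<in> sets borel"
    have [measurable]: "\<rho> \<in> borel_measurable borel" using \<rho>(1) by auto
    have "integrable (distr lborel borel ?c) (\<lambda>y. \<rho> (?u y))"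
      using \<rho>(1) by (subst integrable_distr_eq) auto
    then have i: "integrable lborel (\<lambda>y. \<rho> (?u y))" by (simp only: lborel_distr_copy)
    have "(\<integral>\<^sup>+y. ennreal (\<rho> (?u (?g y)) * e y) * indicator (?S \<inter> ?u -` B) y \<partial>lborel)
        = (\<integral>\<^sup>+x. ennreal (\<rho> (?u x)) * indicator (?g ` ?S \<inter> ?f -` (?u -` B)) x \<partial>lborel)"
      by (rule int[OF i]) (use \<rho>(2) uS[OF B] in auto)
    also have "?g ` ?S \<inter> ?f -` (?u -` B) = ?u -` (g ` S \<inter> f -` B)" unfolding img by auto
    also have "(\<integral>\<^sup>+x. ennreal (\<rho> (?u x)) * indicator (?u -` (g ` S \<inter> f -` B)) x \<partial>lborel)
        = (\<integral>\<^sup>+x. ennreal (\<rho> x) * indicator (g ` S \<inter> f -` B) x \<partial>lborel)"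
      by (subst distr) (auto simp: indicator_def)
    also have "(\<integral>\<^sup>+y. ennreal (\<rho> (?u (?g y)) * e y) * indicator (?S \<inter> ?u -` B) y \<partial>lborel)
        = (\<integral>\<^sup>+x. ennreal (\<rho> (g x) * e (?c x)) * indicator (S \<inter> B) x \<partial>lborel)"
      by (subst distr) (auto simp: indicator_def)
    finally show "(\<integral>\<^sup>+x. ennreal (\<rho> (g x) * e (?c x)) * indicator (S \<inter> B) x \<partial>lborel)
        = (\<integral>\<^sup>+x. ennreal (\<rho> x) * indicator (g ` S \<inter> f -` B) x \<partial>lborel)" .
  qed (use e in auto)
qed

text \<open>Near \<open>y\<close> the points of \<open>Y\<close> are not bad, since on
  \<open>Y\<close> the map \<open>g\<close> agrees with the differentiable \<open>G\<close>. The bad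
  set is thus locally covered by the complement of \<open>Y\<close>, which has density 0 at
  \<open>y\<close>.\<close>

lemma has_approx_derivativeI:
  fixes g :: "'a::euclidean_space \<Rightarrow> 'a"
  assumes Y: "Y \<in> sets borel" "Y \<subseteq> \<Omega>" and G: "\<And>y. y \<in> Y \<Longrightarrow> G y = g y" and y: "y \<in> Y"
    and der: "(G has_derivative A) (at y)"
    and dens: "\<forall>e>0. \<exists>d>0. \<forall>r. 0 < r \<longrightarrow> r < d \<longrightarrow>
      emeasure lebesgue (ball y r - Y) \<le> ennreal e * emeasure lebesgue (ball y r)"
  shows "has_approx_derivative g A \<Omega> y"
  unfolding has_approx_derivative_def
proof (intro conjI allI impI)
  show "y \<in> \<Omega>" using y Y by blast
  show "linear A" using der by (simp add: bounded_linear.linear has_derivative_bounded_linear)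
  fix \<epsilon> :: real assume \<epsilon>: "0 < \<epsilon>"
  define Bad where "Bad = {z. \<not> (z \<in> \<Omega> \<and> norm (g z - g y - A (z - y)) / norm (z - y) < \<epsilon>)}"
  \<comment> \<open>Half of \<epsilon> makes the quotient strictly smaller than \<epsilon>; at
    \<open>z = y\<close> the quotient is 0 by the convention on division by zero.\<close>
  obtain d where d: "0 < d" "\<And>z. norm (z - y) < d \<Longrightarrow> norm (G z - G y - A (z - y)) \<le> \<epsilon> / 2 * norm (z - y)"
    using der \<epsilon> unfolding has_derivative_at_alt by (metis half_gt_zero)
  have sub: "Bad \<inter> ball y r \<subseteq> ball y r - Y" if "r < d" for r
  proof
    fix z assume z: "z \<in> Bad \<inter> ball y r"
    have "z \<notin> Y"
    proof
      assume zY: "z \<in> Y"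
      have "norm (z - y) < d" using z that by (simp add: dist_norm norm_minus_commute)
      then have le: "norm (g z - g y - A (z - y)) \<le> \<epsilon> / 2 * norm (z - y)"
        using d(2)[of z] G[OF zY] G[OF y] by simp
      have "norm (g z - g y - A (z - y)) / norm (z - y) < \<epsilon>"
      proof (cases "z = y")
        case False
        then have "norm (g z - g y - A (z - y)) / norm (z - y) \<le> \<epsilon> / 2"
          using le by (simp add: divide_le_eq)
        then show ?thesis using \<epsilon> by linarith
      qed (use \<epsilon> in simp)
      then show False using z zY Y(2) by (auto simp: Bad_def)
    qed
    then show "z \<in> ball y r - Y" using z by blast
  qed
  have "((\<lambda>r. outer_measure_of lborel (Bad \<inter> ball y r) / emeasure lborel (ball y r)) \<longlongrightarrow> 0) (at_right 0)"
  proof (rule order_tendstoI)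
    fix a :: ennreal assume a: "0 < a"
    obtain c where c: "0 < c" "c < a" using dense[OF a] by blast
    then have "c < top" using less_le_trans top_greatest by blast
    then obtain e where ce: "c = ennreal e" by (cases c rule: ennreal_cases) auto
    have e: "0 < e" "ennreal e < a" using c by (auto simp: ce)
    obtain d' where d': "0 < d'" "\<And>r. 0 < r \<Longrightarrow> r < d' \<Longrightarrow>
        emeasure lebesgue (ball y r - Y) \<le> ennreal e * emeasure lebesgue (ball y r)"
      using dens e(1) by blast
    have "outer_measure_of lborel (Bad \<inter> ball y r) / emeasure lborel (ball y r) < a"
      if r: "0 < r" "r < min d d'" for r
    proof -
      have "outer_measure_of lborel (Bad \<inter> ball y r) \<le> outer_measure_of lborel (ball y r - Y)"
        using sub[of r] r by (intro outer_measure_of_mono) auto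
      also have "\<dots> = emeasure lborel (ball y r - Y)" using Y by (intro outer_measure_of_eq) auto
      also have "\<dots> = emeasure lebesgue (ball y r - Y)" using Y by simp
      also have "\<dots> \<le> ennreal e * emeasure lborel (ball y r)" using d'(2)[of r] r by simp
      finally have "outer_measure_of lborel (Bad \<inter> ball y r) / emeasure lborel (ball y r) \<le> ennreal e"
        using r content_ball_pos[of r y]
        by (intro divide_le_posI_ennreal)
          (simp_all add: mult.commute emeasure_eq_ennreal_measure[OF less_imp_neq[OF emeasure_lborel_ball_finite, unfolded infinity_ennreal_def]])
      then show ?thesis using e(2) by (rule le_less_trans)
    qed
    then show "\<forall>\<^sub>F r in at_right 0. outer_measure_of lborel (Bad \<inter> ball y r) / emeasure lborel (ball y r) < a"
      unfolding eventually_at_right_field using d(1) d'(1) by (intro exI[of _ "min d d'"]) auto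
  qed auto
  then show "has_density_zero_at {z. \<not> (z \<in> \<Omega> \<and> norm (g z - g y - A (z - y)) / norm (z - y) < \<epsilon>)} y"
    unfolding has_density_zero_at_def Bad_def .
qed

lemma pushforward_lebesgue_density:
  fixes f g :: "real^'n \<Rightarrow> real^'n"
  assumes \<rho>: "lebesgue_density \<mu> \<rho>" and \<mu>: "prob_space \<mu>"
    and X: "X \<in> sets borel" "emeasure \<mu> (- X) = 0" and Y: "Y \<in> sets borel" "Y \<subseteq> \<Omega>"
    and f: "f \<in> borel_measurable borel" "\<And>x. x \<in> X \<Longrightarrow> f x \<in> Y" "\<And>x. x \<in> X \<Longrightarrow> g (f x) = x"
    and g: "g \<in> borel_measurable borel" "\<And>y. y \<in> Y \<Longrightarrow> g y \<in> X" "\<And>y. y \<in> Y \<Longrightarrow> f (g y) = y"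
    and lip: "L-lipschitz_on Y g"
  shows "\<exists>\<rho>'. lebesgue_density (distr \<mu> borel f) \<rho>' \<and>
    (AE x in \<mu>. \<exists>A. has_approx_derivative g A \<Omega> (f x) \<and> \<rho>' (f x) = \<rho> x * \<bar>det (matrix A)\<bar>)"
proof -
  have \<rho>': "\<rho> \<in> borel_measurable borel" "\<And>x. 0 \<le> \<rho> x" and \<mu>_def: "\<mu> = density lborel (\<lambda>x. ennreal (\<rho> x))"
    using \<rho> by (auto simp: lebesgue_density_def)
  note [measurable] = f(1) g(1) X(1) Y(1) \<rho>'(1)
  have sets_\<mu> [measurable_cong, simp]: "sets \<mu> = sets borel" and space_\<mu> [simp]: "space \<mu> = UNIV"
    by (simp_all add: \<mu>_def)
  have int\<rho>: "integrable lborel \<rho>"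
  proof (rule integrableI_nonneg)
    have "(\<integral>\<^sup>+x. ennreal (\<rho> x) \<partial>lborel) = emeasure \<mu> UNIV"
      by (simp add: \<mu>_def emeasure_density)
    also have "\<dots> < \<infinity>" using prob_space.emeasure_space_1[OF \<mu>] by simp
    finally show "(\<integral>\<^sup>+x. ennreal (\<rho> x) \<partial>lborel) < \<infinity>" .
  qed (use \<rho>' in auto)
  have AE_X: "AE x in \<mu>. x \<in> X"
    using X by (intro AE_I[of _ _ "- X"]) auto
  have null: "AE x in \<mu>. f x \<notin> M" if M: "M \<in> null_sets lborel" for M
  proof -
    have Mb[measurable]: "M \<in> sets borel" using M by auto
    have "negligible M" unfolding negligible_iff_null_sets_lborel[OF Mb] by (rule M)
    then have "negligible (M \<inter> Y)" by (rule negligible_subset) simp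
    then have "negligible (g ` (M \<inter> Y))"
    proof (rule negligible_locally_Lipschitz_image[OF order_refl])
      fix y assume "y \<in> M \<inter> Y"
      then show "\<exists>T B. open T \<and> y \<in> T \<and> (\<forall>z\<in>M \<inter> Y \<inter> T. norm (g z - g y) \<le> B * norm (z - y))"
        using lipschitz_on_normD[OF lip] by (intro exI[of _ UNIV] exI[of _ L]) auto
    qed
    moreover have "X \<inter> f -` M \<subseteq> g ` (M \<inter> Y)"
    proof
      fix x assume "x \<in> X \<inter> f -` M"
      then show "x \<in> g ` (M \<inter> Y)" using f(2,3) by (intro image_eqI[of _ _ "f x"]) auto
    qed
    ultimately have "negligible (X \<inter> f -` M)" by (rule negligible_subset)
    moreover have [measurable]: "f -` M \<in> sets borel" by (rule measurable_sets_borel[OF f(1)]) simp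
    ultimately have "X \<inter> f -` M \<in> null_sets lborel" by (simp add: negligible_iff_null_sets_lborel X)
    then have "AE x in lborel. x \<notin> X \<inter> f -` M" by (rule AE_not_in)
    then have "AE x in \<mu>. x \<notin> X \<inter> f -` M" unfolding \<mu>_def by (subst AE_density) auto
    with AE_X show ?thesis by eventually_elim auto
  qed
  obtain G where G: "\<And>y. y \<in> Y \<Longrightarrow> G y = g y" and Gd: "negligible {y. \<not> G differentiable (at y)}"
    by (rule lipschitz_on_differentiable_extension[OF lip]) (rule that)
  define good where "good y \<longleftrightarrow> (\<forall>e>0. \<exists>d>0. \<forall>r. 0 < r \<longrightarrow> r < d \<longrightarrow>
    emeasure lebesgue (ball y r - Y) \<le> ennreal e * emeasure lebesgue (ball y r))" for y
  have "negligible {y \<in> Y. \<not> good y}"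
    unfolding good_def by (rule lebesgue_density) (simp add: Y sets_completionI_sets)
  then have "negligible ({y. \<not> G differentiable (at y)} \<union> {y \<in> Y. \<not> good y})" using Gd by (rule negligible_Un[rotated])
  then obtain N where N: "N \<in> null_sets lborel" "{y. \<not> G differentiable (at y)} \<union> {y \<in> Y. \<not> good y} \<subseteq> N"
    by (auto simp: negligible_iff_null_sets null_sets_completion_iff2)
  define S where "S = Y - N"
  have [measurable]: "N \<in> sets borel" using N(1) by auto
  have S: "S \<in> sets borel" "S \<subseteq> Y" by (auto simp: S_def)
  define D where "D y = frechet_derivative G (at y)" for y
  have derG: "(G has_derivative D y) (at y)" and goodS: "good y" if "y \<in> S" for y
    using that N(2) by (auto simp: S_def D_def frechet_derivative_works[symmetric])
  have gS: "g ` S = X \<inter> f -` S"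
  proof (intro equalityI subsetI)
    fix x assume "x \<in> X \<inter> f -` S"
    then show "x \<in> g ` S" using f(3) by (intro image_eqI[of _ _ "f x"]) auto
  qed (use g(2,3) S(2) in auto)
  have fS: "f -` S \<in> sets borel" by (rule measurable_sets_borel[OF f(1) S(1)])
  then have gS_meas: "g ` S \<in> sets borel" unfolding gS using X(1) by blast
  have der: "(g has_derivative D y) (at y within S)" if "y \<in> S" for y
  proof (rule has_derivative_transform[OF that])
    show "(G has_derivative D y) (at y within S)" by (rule has_derivative_at_withinI[OF derG[OF that]])
  qed (use G S in auto)
  obtain d where d: "d \<in> borel_measurable borel" "\<And>y. 0 \<le> d y"
    "AE y in lborel. y \<in> S \<longrightarrow> d y = \<bar>det (matrix (D y))\<bar>"
    "\<And>\<rho> B. integrable lborel \<rho> \<Longrightarrow> (\<And>x. 0 \<le> \<rho> x) \<Longrightarrow> B \<in> sets borel \<Longrightarrow>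
      (\<integral>\<^sup>+y. ennreal (\<rho> (g y) * d y) * indicator (S \<inter> B) y \<partial>lborel)
        = (\<integral>\<^sup>+x. ennreal (\<rho> x) * indicator (g ` S \<inter> f -` B) x \<partial>lborel)"
    by (rule change_of_variables[OF S(1) gS_meas der f(1) g(1)]) (use g(3) S(2) that in blast)+
  note [measurable] = d(1) S(1) fS gS_meas
  \<comment> \<open>The image measure is carried by \<open>S\<close>; there the density is the
    source density at \<open>g y\<close> times the Jacobian factor.\<close>
  define r where "r y = indicator S y * (\<rho> (g y) * d y)" for y
  have r: "r \<in> borel_measurable borel" "\<And>y. 0 \<le> r y"
  proof -
    show "r \<in> borel_measurable borel" unfolding r_def by measurable
    show "0 \<le> r y" for y using \<rho>'(2) d(2) by (simp add: r_def)
  qed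
  have AE_N: "AE x in \<mu>. x \<in> X \<and> f x \<in> S"
    using AE_X null[OF N(1)] by eventually_elim (auto simp: S_def f(2))
  have "distr \<mu> borel f = density lborel (\<lambda>y. ennreal (r y))"
  proof (rule measure_eqI)
    fix B assume "B \<in> sets (distr \<mu> borel f)"
    then have [measurable]: "B \<in> sets borel" by simp
    have [measurable]: "f -` B \<in> sets borel" by (rule measurable_sets_borel[OF f(1)]) simp
    have "emeasure (distr \<mu> borel f) B = emeasure \<mu> (f -` B)" by (simp add: emeasure_distr)
    also have "\<dots> = emeasure \<mu> (g ` S \<inter> f -` B)"
      using AE_N by (intro emeasure_eq_AE) (auto simp: gS)
    also have "\<dots> = (\<integral>\<^sup>+x. ennreal (\<rho> x) * indicator (g ` S \<inter> f -` B) x \<partial>lborel)"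
      unfolding \<mu>_def by (subst emeasure_density) auto
    also have "\<dots> = (\<integral>\<^sup>+y. ennreal (\<rho> (g y) * d y) * indicator (S \<inter> B) y \<partial>lborel)"
      by (rule d(4)[symmetric, OF int\<rho> \<rho>'(2)]) simp
    also have "\<dots> = (\<integral>\<^sup>+y. ennreal (r y) * indicator B y \<partial>lborel)"
      by (intro nn_integral_cong) (auto simp: r_def indicator_def)
    also have "\<dots> = emeasure (density lborel (\<lambda>y. ennreal (r y))) B"
      using r(1) by (subst emeasure_density) auto
    finally show "emeasure (distr \<mu> borel f) B = emeasure (density lborel (\<lambda>y. ennreal (r y))) B" .
  qed simp
  then have "lebesgue_density (distr \<mu> borel f) r" using r by (simp add: lebesgue_density_def)
  moreover have "AE x in \<mu>. \<exists>A. has_approx_derivative g A \<Omega> (f x) \<and> r (f x) = \<rho> x * \<bar>det (matrix A)\<bar>"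
  proof -
    \<comment> \<open>The identity for \<open>d\<close> has a Lebesgue-null exceptional set in the
      target; \<open>null\<close> transfers it back to a \<open>\<mu>\<close>-null set of
      sources.\<close>
    obtain M where M: "M \<in> null_sets lborel"
      "{y \<in> space lborel. \<not> (y \<in> S \<longrightarrow> d y = \<bar>det (matrix (D y))\<bar>)} \<subseteq> M"
      using d(3) unfolding eventually_ae_filter by (elim bexE)
    show ?thesis
      using AE_N null[OF M(1)]
    proof eventually_elim
      case (elim x)
      then have y: "f x \<in> S" "f x \<in> Y" using S by auto
      have "has_approx_derivative g (D (f x)) \<Omega> (f x)"
        by (rule has_approx_derivativeI[OF Y G y(2) derG[OF y(1)]]) (assumption, rule goodS[OF y(1), unfolded good_def])
      moreover have "d (f x) = \<bar>det (matrix (D (f x)))\<bar>" using subsetD[OF M(2), of "f x"] elim y(1) by auto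
      then have "r (f x) = \<rho> x * \<bar>det (matrix (D (f x)))\<bar>"
        using y f(3)[of x] elim by (simp add: r_def)
      ultimately show ?case by blast
    qed
  qed
  ultimately show ?thesis by (intro exI[of _ r] conjI)
qed

section \<open>Transport rays\<close>

lemma gderiv_unique:
  assumes "GDERIV f x :> p" "GDERIV f x :> q"
  shows "p = q"
proof -
  have "(\<lambda>h. h \<bullet> p) = (\<lambda>h. h \<bullet> q)"
    using assms unfolding gderiv_def by (rule has_derivative_unique)
  then have "(p - q) \<bullet> p = (p - q) \<bullet> q" by metis
  then have "(p - q) \<bullet> (p - q) = 0" by (simp add: inner_diff_right)
  then show ?thesis by simp
qed

lemma gradient_eq: "GDERIV f x :> q \<Longrightarrow> gradient f x = q"
  unfolding gradient_def by (rule the_equality) (auto intro: gderiv_unique)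

lemma borel_vimage_continuous_on:
  assumes "continuous_on S f" "S \<in> sets borel" "E \<in> sets borel"
  shows "S \<inter> f -` E \<in> sets borel"
proof -
  have "f \<in> borel_measurable (restrict_space borel S)"
    using assms(1) by (rule borel_measurable_continuous_on_restrict)
  from measurable_sets[OF this assms(3)] show ?thesis
    using assms(2) by (auto simp: sets_restrict_space_iff space_restrict_space Int_commute)
qed

text \<open>The gradient is the limit of difference quotients with increments
  \<open>1 / Suc n\<close>; multiplying by the indicator of the differentiability points makes the
  limit exist everywhere.\<close>

lemma borel_measurable_gradient:
  fixes U :: "'a::euclidean_space \<Rightarrow> real"
  assumes U: "continuous_on UNIV U"
  shows "(\<lambda>x. if \<exists>q. GDERIV U x :> q then gradient U x else 0) \<in> borel_measurable borel"
proof -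
  let ?D = "{x. \<exists>q. GDERIV U x :> q}"
  define W where "W n x = indicator ?D x *\<^sub>R (\<Sum>b\<in>Basis. (real (Suc n) * (U (x + (1 / real (Suc n)) *\<^sub>R b) - U x)) *\<^sub>R b)" for n x
  have [measurable]: "U \<in> borel_measurable borel" using U by (rule borel_measurable_continuous_onI)
  have [measurable]: "?D \<in> sets borel" by (rule sets_gderiv_points[OF U])
  show ?thesis
  proof (rule borel_measurable_LIMSEQ_metric)
    show "W n \<in> borel_measurable borel" for n unfolding W_def by measurable
    fix x
    show "(\<lambda>n. W n x) \<longlonglongrightarrow> (if \<exists>q. GDERIV U x :> q then gradient U x else 0)"
    proof (cases "\<exists>q. GDERIV U x :> q")
      case True
      then obtain q where q: "GDERIV U x :> q" by blast
      have "(\<lambda>n. real (Suc n) * (U (x + (1 / real (Suc n)) *\<^sub>R b) - U x)) \<longlonglongrightarrow> q \<bullet> b" if b: "b \<in> Basis" for b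
      proof (rule LIMSEQ_I)
        fix e :: real assume e: "0 < e"
        obtain d where d: "0 < d" "\<And>h. norm h < d \<Longrightarrow> \<bar>U (x + h) - U x - q \<bullet> h\<bar> \<le> e / 2 * norm h"
          by (rule gderivD[OF q, of "e / 2"]) (use e in auto)
        obtain n0 where n0: "1 / real (Suc n0) < d" using d(1) by (rule nat_approx_posE)
        have "norm (real (Suc n) * (U (x + (1 / real (Suc n)) *\<^sub>R b) - U x) - q \<bullet> b) < e" if n: "n \<ge> n0" for n
        proof -
          let ?s = "1 / real (Suc n)"
          have "?s \<le> 1 / real (Suc n0)" using n by (intro divide_left_mono) auto
          then have "norm (?s *\<^sub>R b) < d" using n0 b by simp
          then have "\<bar>U (x + ?s *\<^sub>R b) - U x - q \<bullet> (?s *\<^sub>R b)\<bar> \<le> e / 2 * ?s"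
            using d(2)[of "?s *\<^sub>R b"] b by simp
          then have "real (Suc n) * \<bar>U (x + ?s *\<^sub>R b) - U x - q \<bullet> (?s *\<^sub>R b)\<bar> \<le> real (Suc n) * (e / 2 * ?s)"
            by (rule mult_left_mono) simp
          moreover have "real (Suc n) * (e / 2 * ?s) = e / 2" by (simp del: of_nat_Suc)
          moreover have "real (Suc n) * (U (x + ?s *\<^sub>R b) - U x) - q \<bullet> b
              = real (Suc n) * (U (x + ?s *\<^sub>R b) - U x - q \<bullet> (?s *\<^sub>R b))"
            by (simp add: right_diff_distrib del: of_nat_Suc)
          ultimately show ?thesis using e by (simp only: real_norm_def abs_mult abs_of_nat)
        qed
        then show "\<exists>no. \<forall>n\<ge>no. norm (real (Suc n) * (U (x + (1 / real (Suc n)) *\<^sub>R b) - U x) - q \<bullet> b) < e" by blast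
      qed
      then have "(\<lambda>n. W n x) \<longlonglongrightarrow> (\<Sum>b\<in>Basis. (q \<bullet> b) *\<^sub>R b)"
        using True unfolding W_def by (simp only: indicator_simps mem_Collect_eq scaleR_one) (intro tendsto_intros)
      then show ?thesis using True gradient_eq[OF q] by (simp add: euclidean_representation)
    qed (simp add: W_def)
  qed
qed

text \<open>
  \<open>ray_point U s t y e\<close>: the segment from \<open>y - s e\<close> to \<open>y + t e\<close> is part of a transport ray
  of \<open>U\<close>.
\<close>

definition ray_point :: "('a::euclidean_space \<Rightarrow> real) \<Rightarrow> real \<Rightarrow> real \<Rightarrow> 'a \<Rightarrow> 'a \<Rightarrow> bool" where
  "ray_point U s t y e \<longleftrightarrow> norm e = 1 \<and> U (y + t *\<^sub>R e) = U y + t \<and> U (y - s *\<^sub>R e) = U y - s"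

context
  fixes U :: "'a::euclidean_space \<Rightarrow> real"
  assumes U: "1-lipschitz_on UNIV U"
begin

lemma potential_le: "U y \<le> U z + norm (y - z)"
  using lipschitz_onD[OF U, of y z] by (simp add: dist_norm dist_real_def)

text \<open>The 1-Lipschitz bounds on the two pieces of the segment add up to the full increment, so
  neither has any slack.\<close>

lemma potential_segment:
  assumes "norm e = 1" "U (y + b *\<^sub>R e) = U y + b" "0 \<le> a" "a \<le> b"
  shows "U (y + a *\<^sub>R e) = U y + a"
proof -
  have "U (y + a *\<^sub>R e) \<le> U y + a" using potential_le[of "y + a *\<^sub>R e" y] assms by simp
  moreover have "U (y + b *\<^sub>R e) \<le> U (y + a *\<^sub>R e) + (b - a)"
    using potential_le[of "y + b *\<^sub>R e" "y + a *\<^sub>R e"] assms by (simp add: flip: scaleR_diff_left)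
  ultimately show ?thesis using assms by simp
qed

lemma potential_segment_down:
  assumes "norm e = 1" "U (y - b *\<^sub>R e) = U y - b" "0 \<le> a" "a \<le> b"
  shows "U (y - a *\<^sub>R e) = U y - a"
  using potential_segment[of e "y - b *\<^sub>R e" b "b - a"] assms by (simp add: scaleR_diff_left)

lemma ray_point_mono:
  assumes "ray_point U s t y e" "0 \<le> s'" "s' \<le> s" "0 \<le> t'" "t' \<le> t"
  shows "ray_point U s' t' y e"
  using assms potential_segment[of e y t t'] potential_segment_down[of e y s s'] by (simp add: ray_point_def)

text \<open>Rays do not branch at a point with a piece of ray below it: the path from
  \<open>x - s e\<close> through \<open>x\<close> to \<open>z\<close> has equality in the triangle
  inequality, so it is straight.\<close>

lemma ray_direction_unique:
  assumes e: "norm e = 1" "0 < s" "U (x - s *\<^sub>R e) = U x - s" and z: "U z = U x + norm (z - x)"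
  shows "z = x + norm (z - x) *\<^sub>R e"
proof -
  have "norm ((z - x) + s *\<^sub>R e) = norm (z - x) + norm (s *\<^sub>R e)"
  proof (rule antisym)
    show "norm (z - x) + norm (s *\<^sub>R e) \<le> norm ((z - x) + s *\<^sub>R e)"
      using potential_le[of z "x - s *\<^sub>R e"] e z by (simp add: algebra_simps)
  qed (rule norm_triangle_ineq)
  then have "norm (z - x) *\<^sub>R (s *\<^sub>R e) = norm (s *\<^sub>R e) *\<^sub>R (z - x)" by (rule norm_triangle_eq[THEN iffD1])
  then have "s *\<^sub>R (norm (z - x) *\<^sub>R e) = s *\<^sub>R (z - x)" using e by (simp add: mult.commute)
  then have "norm (z - x) *\<^sub>R e = z - x" using e(2) by (metis scaleR_cancel_left less_irrefl)
  then show ?thesis by simp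
qed

text \<open>The 1-Lipschitz condition at the two ends of the segment squeezes \<open>U\<close>
  between two cones, which touch \<open>U\<close> at \<open>y\<close> and have gradient
  \<open>e\<close> there.\<close>

lemma ray_point_gderiv:
  assumes r: "ray_point U s t y e" and s: "0 < s" and t: "0 < t"
  shows "GDERIV U y :> e"
proof -
  have e: "norm e = 1" "U (y + t *\<^sub>R e) = U y + t" "U (y - s *\<^sub>R e) = U y - s"
    using r by (auto simp: ray_point_def)
  \<comment> \<open>The tangent bound for a square root: the square of
    \<open>norm (c e + h) - c\<close> is nonnegative.\<close>
  have quad: "norm (c *\<^sub>R e + h) \<le> c + e \<bullet> h + (norm h)\<^sup>2 / (2 * c)" if "0 < c" for c h
  proof -
    have "(norm (c *\<^sub>R e + h))\<^sup>2 = c\<^sup>2 + 2 * c * (e \<bullet> h) + (norm h)\<^sup>2"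
    proof -
      have "e \<bullet> e = 1" using e(1) by (simp add: norm_eq_1)
      then show ?thesis
        unfolding power2_norm_eq_inner
        by (simp add: inner_add_left inner_add_right inner_commute[of h e] power2_eq_square distrib_left)
    qed
    moreover have "0 \<le> (norm (c *\<^sub>R e + h) - c)\<^sup>2" by simp
    ultimately have "2 * c * norm (c *\<^sub>R e + h) \<le> 2 * c * c + 2 * c * (e \<bullet> h) + (norm h)\<^sup>2"
      by (simp add: power2_diff power2_eq_square algebra_simps)
    also have "\<dots> = 2 * c * (c + e \<bullet> h + (norm h)\<^sup>2 / (2 * c))"
      using that by (simp add: field_simps)
    finally show ?thesis using that by (subst (asm) mult_le_cancel_left_pos) auto
  qed
  define m where "m = min s t"
  have m: "0 < m" "m \<le> s" "m \<le> t" using s t by (auto simp: m_def)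
  have bound: "\<bar>U (y + h) - U y - e \<bullet> h\<bar> \<le> (norm h)\<^sup>2 / (2 * m)" for h
  proof -
    have "U (y + t *\<^sub>R e) \<le> U (y + h) + norm (t *\<^sub>R e + - h)"
      using potential_le[of "y + t *\<^sub>R e" "y + h"] by simp
    moreover have "U (y + h) \<le> U (y - s *\<^sub>R e) + norm (s *\<^sub>R e + h)"
      using potential_le[of "y + h" "y - s *\<^sub>R e"] by (simp add: add.commute)
    moreover have "(norm h)\<^sup>2 / (2 * t) \<le> (norm h)\<^sup>2 / (2 * m)" "(norm h)\<^sup>2 / (2 * s) \<le> (norm h)\<^sup>2 / (2 * m)"
      using m by (auto intro!: divide_left_mono)
    ultimately show ?thesis using quad[OF t, of "- h"] quad[OF s, of h] e by simp
  qed
  have "(U has_derivative (\<lambda>h. h \<bullet> e)) (at y)"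
    unfolding has_derivative_at_alt
  proof (intro conjI allI impI)
    fix \<epsilon> :: real assume \<epsilon>: "0 < \<epsilon>"
    have "norm (U z - U y - (z - y) \<bullet> e) \<le> \<epsilon> * norm (z - y)" if z: "norm (z - y) < 2 * m * \<epsilon>" for z
    proof -
      have "norm (U z - U y - (z - y) \<bullet> e) \<le> norm (z - y) * norm (z - y) / (2 * m)"
        using bound[of "z - y"] by (simp add: inner_commute power2_eq_square)
      also have "\<dots> \<le> norm (z - y) * (2 * m * \<epsilon>) / (2 * m)"
        using z m by (intro divide_right_mono mult_left_mono) auto
      also have "\<dots> = \<epsilon> * norm (z - y)" using m by simp
      finally show ?thesis .
    qed
    then show "\<exists>d>0. \<forall>z. norm (z - y) < d \<longrightarrow> norm (U z - U y - (z - y) \<bullet> e) \<le> \<epsilon> * norm (z - y)"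
      using m \<epsilon> by (intro exI[of _ "2 * m * \<epsilon>"]) auto
  qed (rule bounded_linear_inner_left)
  then show ?thesis by (simp only: gderiv_def)
qed

text \<open>
  The directions of transport rays are Lipschitz away from the ends of the rays: add up the
  1-Lipschitz bounds between the top of each segment and the bottom of the other one, and use the
  parallelogram law.
\<close>

lemma ray_direction_lipschitz:
  assumes r: "ray_point U \<delta> \<delta> y e" and r': "ray_point U \<delta> \<delta> y' e'" and \<delta>: "0 < \<delta>"
  shows "norm (e - e') \<le> norm (y - y') / \<delta>"
\<comment> \<open>For points further apart than \<open>2 * \<delta>\<close> the bound is trivial,
  unit vectors having distance at most 2. Otherwise \<open>2 * \<delta>\<close> plus or minus the
  difference of the potentials is nonnegative, which allows the two Lipschitz bounds to be
  squared.\<close>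
proof (cases "norm (y - y') \<le> 2 * \<delta>")
  case True
  have e: "norm e = 1" "U (y + \<delta> *\<^sub>R e) = U y + \<delta>" "U (y - \<delta> *\<^sub>R e) = U y - \<delta>"
   and e': "norm e' = 1" "U (y' + \<delta> *\<^sub>R e') = U y' + \<delta>" "U (y' - \<delta> *\<^sub>R e') = U y' - \<delta>"
    using r r' by (auto simp: ray_point_def)
  let ?h = "y - y'" and ?v = "\<delta> *\<^sub>R (e + e')" and ?w = "\<delta> *\<^sub>R (e - e')" and ?s = "U y - U y'"
  have s: "\<bar>?s\<bar> \<le> norm ?h" using lipschitz_onD[OF U, of y y'] by (simp add: dist_norm dist_real_def)
  have 1: "2 * \<delta> + ?s \<le> norm (?h + ?v)"
    using potential_le[of "y + \<delta> *\<^sub>R e" "y' - \<delta> *\<^sub>R e'"] e e' by (simp add: algebra_simps)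
  have 2: "2 * \<delta> - ?s \<le> norm (?h - ?v)"
    using potential_le[of "y' + \<delta> *\<^sub>R e'" "y - \<delta> *\<^sub>R e"] e e'
    by (subst norm_minus_commute) (simp add: algebra_simps)
  have "(2 * \<delta> + ?s)\<^sup>2 \<le> (norm (?h + ?v))\<^sup>2" using 1 s True by (intro power_mono) auto
  moreover have "(2 * \<delta> - ?s)\<^sup>2 \<le> (norm (?h - ?v))\<^sup>2" using 2 s True by (intro power_mono) auto
  moreover have "(norm (?h + ?v))\<^sup>2 + (norm (?h - ?v))\<^sup>2 = 2 * (norm ?h)\<^sup>2 + 2 * (norm ?v)\<^sup>2"
    unfolding power2_norm_eq_inner by (simp add: inner_add_left inner_add_right inner_diff_left inner_diff_right inner_commute)
  moreover have "(norm ?v)\<^sup>2 + (norm ?w)\<^sup>2 = 4 * \<delta>\<^sup>2"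
  proof -
    have "(norm (e + e'))\<^sup>2 + (norm (e - e'))\<^sup>2 = 2 * (norm e)\<^sup>2 + 2 * (norm e')\<^sup>2"
      unfolding power2_norm_eq_inner by (simp add: inner_add_left inner_add_right inner_diff_left inner_diff_right inner_commute)
    then have "(norm (e + e'))\<^sup>2 + (norm (e - e'))\<^sup>2 = 4" using e e' by simp
    then have "\<delta>\<^sup>2 * ((norm (e + e'))\<^sup>2 + (norm (e - e'))\<^sup>2) = \<delta>\<^sup>2 * 4" by simp
    then show ?thesis by (simp add: power_mult_distrib distrib_left)
  qed
  moreover have "(2 * \<delta> + ?s)\<^sup>2 + (2 * \<delta> - ?s)\<^sup>2 = 8 * \<delta>\<^sup>2 + 2 * ?s\<^sup>2"
    by (simp add: power2_eq_square algebra_simps)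
  moreover have "0 \<le> ?s\<^sup>2" by simp
  ultimately have "(norm ?w)\<^sup>2 \<le> (norm ?h)\<^sup>2" by linarith
  then have "norm ?w \<le> norm ?h" by (rule power2_le_imp_le) simp
  then have "\<delta> * norm (e - e') \<le> norm ?h" using \<delta> by (simp only: norm_scaleR abs_of_pos)
  then show ?thesis using \<delta> by (simp add: field_simps)
next
  case False
  have "norm (e - e') \<le> norm e + norm e'" by (rule norm_triangle_ineq4)
  also have "\<dots> = 2" using r r' by (simp add: ray_point_def)
  also have "2 \<le> norm (y - y') / \<delta>" using False \<delta> by (simp add: field_simps)
  finally show ?thesis .
qed

end

text \<open>In a set of finite measure only finitely many disjoint pieces can have measure at least
  \<open>1 / Suc n\<close>, so only countably many have positive measure.\<close>

lemma uncountable_disjoint_null: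
  fixes F :: "real \<Rightarrow> 'a set"
  assumes I: "uncountable I" and dj: "disjoint_family_on F I"
    and F: "\<And>t. t \<in> I \<Longrightarrow> F t \<in> sets M" "\<And>t. t \<in> I \<Longrightarrow> F t \<subseteq> B" and B: "B \<in> fmeasurable M"
  shows "\<exists>t\<in>I. F t \<in> null_sets M"
proof -
  have fm: "F t \<in> fmeasurable M" if "t \<in> I" for t
    using F that B by (intro fmeasurableI2[OF B]) auto
  have fin: "finite {t \<in> I. 1 / real (Suc n) \<le> measure M (F t)}" (is "finite ?J") for n
  proof (rule ccontr)
    assume "infinite ?J"
    obtain k :: nat where k: "real (Suc n) * (measure M B + 1) \<le> real k" using real_arch_simple by blast
    obtain T where T: "finite T" "card T = k" "T \<subseteq> ?J"
      using infinite_arbitrarily_large[OF \<open>infinite ?J\<close>] by blast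
    have "measure M B + 1 \<le> real k * (1 / real (Suc n))"
      using k by (simp add: field_simps)
    also have "\<dots> = (\<Sum>t\<in>T. 1 / real (Suc n))" using T by simp
    also have "\<dots> \<le> (\<Sum>t\<in>T. measure M (F t))" using T by (intro sum_mono) auto
    also have "\<dots> = measure M (\<Union>t\<in>T. F t)"
    proof (rule measure_finite_Union[symmetric])
      show "disjoint_family_on F T" by (rule disjoint_family_on_mono[OF _ dj]) (use T in auto)
      show "F ` T \<subseteq> sets M" using T F by auto
      show "emeasure M (F t) \<noteq> \<infinity>" if "t \<in> T" for t
        using fm[of t] that T(3) by (auto simp: fmeasurable_def)
    qed (use T in auto)
    also have "\<dots> \<le> measure M B"
      using T F B by (intro measure_mono_fmeasurable) auto
    finally show False by simp
  qed
  have "countable (\<Union>n. {t \<in> I. 1 / real (Suc n) \<le> measure M (F t)})"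
    by (intro countable_UN countableI_type countable_finite fin)
  then obtain t where t: "t \<in> I" "t \<notin> (\<Union>n. {t \<in> I. 1 / real (Suc n) \<le> measure M (F t)})"
    using I by (meson countable_subset subsetI)
  have "measure M (F t) = 0"
  proof (rule ccontr)
    assume "measure M (F t) \<noteq> 0"
    then have "0 < measure M (F t)" by (simp add: zero_less_measure_iff)
    then obtain n where "1 / real (Suc n) < measure M (F t)" by (rule nat_approx_posE)
    then have "t \<in> {t \<in> I. 1 / real (Suc n) \<le> measure M (F t)}" using t(1) by (simp only: mem_Collect_eq less_imp_le)
    then show False using t(2) by blast
  qed
  then have "F t \<in> null_sets M" using emeasure_eq_measure2[OF fm[OF t(1)]] F(1)[OF t(1)] by (intro null_setsI) auto
  then show ?thesis using t(1) by blast
qed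

context
  fixes U :: "'a::euclidean_space \<Rightarrow> real"
  assumes U: "1-lipschitz_on UNIV U"
begin

lemma potential_continuous: "continuous_on UNIV U"
  by (rule lipschitz_on_continuous_on[OF U])

text \<open>The direction \<open>e\<close> ranges over the compact unit sphere, along which closed
  sets project to closed sets.\<close>

lemma closed_ray_points: "closed {y. \<exists>e. ray_point U s t y e}"
proof -
  have cont: "continuous_on UNIV (\<lambda>p. U (f p))" if "continuous_on UNIV f" for f :: "'a \<times> 'a \<Rightarrow> 'a"
    by (rule continuous_on_compose2[OF potential_continuous that]) simp
  have "closed {p. U (snd p + t *\<^sub>R fst p) = U (snd p) + t \<and> U (snd p - s *\<^sub>R fst p) = U (snd p) - s}"
    by (intro closed_Collect_conj closed_Collect_eq continuous_intros cont)
  then have "closed {y. \<exists>e. e \<in> sphere 0 1 \<and>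
      (e, y) \<in> {p. U (snd p + t *\<^sub>R fst p) = U (snd p) + t \<and> U (snd p - s *\<^sub>R fst p) = U (snd p) - s}}"
    by (intro closed_compact_projection) auto
  moreover have "{y. \<exists>e. e \<in> sphere 0 1 \<and>
      (e, y) \<in> {p. U (snd p + t *\<^sub>R fst p) = U (snd p) + t \<and> U (snd p - s *\<^sub>R fst p) = U (snd p) - s}}
      = {y. \<exists>e. ray_point U s t y e}"
    by (auto simp: ray_point_def dist_norm)
  ultimately show ?thesis by simp
qed

lemma ray_point_gradient:
  assumes "ray_point U s t y e" "0 < s" "0 < t"
  shows "gradient U y = e"
  using ray_point_gderiv[OF U assms] by (rule gradient_eq)

lemma gradient_lipschitz_on_ray_points:
  assumes s: "0 < s" and t: "0 < t"
  shows "(1 / min s t)-lipschitz_on {y. \<exists>e. ray_point U s t y e} (gradient U)"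
proof (rule lipschitz_onI)
  fix y y' assume "y \<in> {y. \<exists>e. ray_point U s t y e}" "y' \<in> {y. \<exists>e. ray_point U s t y e}"
  then obtain e e' where r: "ray_point U s t y e" "ray_point U s t y' e'" by blast
  let ?\<delta> = "min s t"
  have "ray_point U ?\<delta> ?\<delta> y e" "ray_point U ?\<delta> ?\<delta> y' e'"
    using r s t by (auto intro: ray_point_mono[OF U])
  then have "norm (e - e') \<le> norm (y - y') / ?\<delta>" by (rule ray_direction_lipschitz[OF U]) (use s t in simp)
  then show "dist (gradient U y) (gradient U y') \<le> 1 / ?\<delta> * dist y y'"
    using ray_point_gradient[OF r(1) s t] ray_point_gradient[OF r(2) s t] by (simp add: dist_norm)
qed (use s t in simp)

lemma ascent_lipschitz_on_ray_points:
  assumes s: "0 < s" and t: "0 < t" and r: "0 \<le> r"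
  shows "(1 + r * (1 / min s t))-lipschitz_on {y. \<exists>e. ray_point U s t y e} (\<lambda>y. y + r *\<^sub>R gradient U y)"
  by (intro lipschitz_on_add lipschitz_on_id lipschitz_on_cmult_nonneg gradient_lipschitz_on_ray_points s t r)

text \<open>
  The sets \<open>F t\<close> obtained by sliding all upper end points a distance \<open>t\<close> down their rays are
  pairwise disjoint, so one of them is null; sliding back up is Lipschitz.
\<close>

lemma upper_end_points_negligible:
  assumes E: "E \<in> sets borel" "bounded E" and l: "0 < l"
    and down: "\<And>x. x \<in> E \<Longrightarrow> \<exists>e. norm e = 1 \<and> U (x - l *\<^sub>R e) = U x - l"
    and up: "\<And>x z. x \<in> E \<Longrightarrow> z \<noteq> x \<Longrightarrow> U z \<noteq> U x + norm (z - x)"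
  shows "negligible E"
proof -
  \<comment> \<open>Sliding by at most \<open>l / 2\<close> leaves a piece of ray of length
    \<open>l / 2\<close> below the new point.\<close>
  define I where "I = {0<..l / 2}"
  define R where "R t = {y. \<exists>e. ray_point U (l / 2) t y e}" for t
  define g where "g t y = y + t *\<^sub>R gradient U y" for t y
  \<comment> \<open>As a preimage under the continuous \<open>g t\<close> on the closed set
    \<open>R t\<close>, the slid set is visibly Borel.\<close>
  define F where "F t = R t \<inter> g t -` E" for t
  have lip: "(1 + t * (1 / min (l / 2) t))-lipschitz_on (R t) (g t)" if "t \<in> I" for t
    unfolding R_def g_def using that l by (intro ascent_lipschitz_on_ray_points) (auto simp: I_def)
  have F_meas: "F t \<in> sets lborel" if t: "t \<in> I" for t
  proof -
    have "continuous_on (R t) (g t)" by (rule lipschitz_on_continuous_on[OF lip[OF t]])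
    moreover have "R t \<in> sets borel" unfolding R_def by (intro borel_closed closed_ray_points)
    ultimately show ?thesis unfolding F_def using borel_vimage_continuous_on[OF _ _ E(1)] by simp
  qed
  have FD: "\<exists>e. ray_point U (l / 2) t y e \<and> gradient U y = e \<and> y + t *\<^sub>R e \<in> E"
    if tI: "t \<in> I" and yF: "y \<in> F t" for t y
  proof -
    obtain e where e: "ray_point U (l / 2) t y e" using yF by (auto simp: F_def R_def)
    moreover have "gradient U y = e" by (rule ray_point_gradient[OF e]) (use l tI in \<open>auto simp: I_def\<close>)
    ultimately show ?thesis using yF by (auto simp: F_def g_def)
  qed
  \<comment> \<open>If \<open>y\<close> came from end points at two heights \<open>t < t'\<close>,
    the ray through \<open>y\<close> would continue beyond the lower of them, which then would not
    be an upper end point.\<close>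
  have no: "False" if t: "t \<in> I" "t' \<in> I" "t < t'" and y: "y \<in> F t" "y \<in> F t'" for t t' y
  proof -
    obtain e where e: "ray_point U (l / 2) t y e" "gradient U y = e" "y + t *\<^sub>R e \<in> E" using FD[OF t(1) y(1)] by blast
    then have e': "ray_point U (l / 2) t' y e" using FD[OF t(2) y(2)] by auto
    have ne: "norm e = 1" and Ut: "U (y + t *\<^sub>R e) = U y + t" "U (y + t' *\<^sub>R e) = U y + t'"
      using e(1) e' by (auto simp: ray_point_def)
    have "(y + t' *\<^sub>R e) - (y + t *\<^sub>R e) = (t' - t) *\<^sub>R e" by (simp add: scaleR_diff_left)
    then have nd: "norm ((y + t' *\<^sub>R e) - (y + t *\<^sub>R e)) = t' - t" using ne t(3) by simp
    then have "y + t' *\<^sub>R e \<noteq> y + t *\<^sub>R e" using t(3) by auto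
    then have "U (y + t' *\<^sub>R e) \<noteq> U (y + t *\<^sub>R e) + norm ((y + t' *\<^sub>R e) - (y + t *\<^sub>R e))" by (rule up[OF e(3)])
    then show False using Ut nd by simp
  qed
  have dj: "disjoint_family_on F I"
    unfolding disjoint_family_on_def
  proof (intro ballI impI)
    fix t t' assume t: "t \<in> I" "t' \<in> I" "t \<noteq> t'"
    then consider "t < t'" | "t' < t" by linarith
    then show "F t \<inter> F t' = {}" using no t by cases blast+
  qed
  obtain b where b: "\<And>x. x \<in> E \<Longrightarrow> norm x \<le> b" using E(2) by (auto simp: bounded_iff)
  have sub: "F t \<subseteq> cball 0 (b + l)" if t: "t \<in> I" for t
  proof
    fix y assume "y \<in> F t"
    then obtain e where e: "ray_point U (l / 2) t y e" "y + t *\<^sub>R e \<in> E" using FD[OF t] by blast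
    have "norm y \<le> norm (y + t *\<^sub>R e) + norm (t *\<^sub>R e)" using norm_triangle_ineq4[of "y + t *\<^sub>R e" "t *\<^sub>R e"] by simp
    then show "y \<in> cball 0 (b + l)"
      using b[OF e(2)] e(1) t l by (auto simp: ray_point_def I_def)
  qed
  have unc: "uncountable I" using l by (simp add: I_def uncountable_half_open_interval_2)
  have "cball (0::'a) (b + l) \<in> fmeasurable lborel"
    using emeasure_lborel_cball_finite[of "0::'a" "b + l"] by (intro fmeasurableI) auto
  then have "\<exists>t\<in>I. F t \<in> null_sets lborel"
    by (intro uncountable_disjoint_null[OF unc dj F_meas sub])
  then obtain t where t: "t \<in> I" "F t \<in> null_sets lborel" by blast
  have "F t \<in> sets borel" using F_meas[OF t(1)] by simp
  then have "negligible (F t)" using t(2) by (simp only: negligible_iff_null_sets_lborel)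
  then have "negligible (g t ` F t)"
  proof (rule negligible_locally_Lipschitz_image[OF order_refl])
    fix y assume "y \<in> F t"
    then show "\<exists>T B. open T \<and> y \<in> T \<and> (\<forall>z\<in>F t \<inter> T. norm (g t z - g t y) \<le> B * norm (z - y))"
      using lipschitz_on_normD[OF lip[OF t(1)]]
      by (intro exI[of _ UNIV] exI[of _ "1 + t * (1 / min (l / 2) t)"]) (auto simp: F_def)
  qed
  moreover have "E \<subseteq> g t ` F t"
  proof
    fix x assume x: "x \<in> E"
    then obtain e where e: "norm e = 1" "U (x - l *\<^sub>R e) = U x - l" using down by blast
    have t0: "0 < t" "t \<le> l / 2" using t(1) by (auto simp: I_def)
    let ?y = "x - t *\<^sub>R e"
    have 1: "U ?y = U x - t" by (rule potential_segment_down[OF U e]) (use t0 in linarith)+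
    have 2: "U (x - (t + l / 2) *\<^sub>R e) = U x - (t + l / 2)" by (rule potential_segment_down[OF U e]) (use t0 in linarith)+
    have "ray_point U (l / 2) t ?y e" using e(1) 1 2 by (simp add: ray_point_def scaleR_add_left diff_diff_eq)
    moreover from this have "gradient U ?y = e" by (rule ray_point_gradient) (use t0 l in auto)
    ultimately have "?y \<in> F t" "g t ?y = x" using x by (auto simp: F_def R_def g_def)
    then show "x \<in> g t ` F t" by (metis imageI)
  qed
  ultimately show ?thesis by (rule negligible_subset)
qed

end

section \<open>Duality for finite transport problems\<close>

text \<open>
  The quadratic penalisation of the dual of the finite transport problem. At a maximum, the
  penalty slopes \<open>max 0 (p i + q j - c i j) / \<epsilon>\<close> form a transport plan by the first-order
  conditions.
\<close>

definition penalised_dual ::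
    "real \<Rightarrow> 'i set \<Rightarrow> 'j set \<Rightarrow> ('i \<Rightarrow> real) \<Rightarrow> ('j \<Rightarrow> real) \<Rightarrow> ('i \<Rightarrow> 'j \<Rightarrow> real) \<Rightarrow> ('i \<Rightarrow> real) \<Rightarrow> ('j \<Rightarrow> real) \<Rightarrow> real" where
  "penalised_dual \<epsilon> I J a b c p q =
    (\<Sum>i\<in>I. p i * a i) + (\<Sum>j\<in>J. q j * b j) - (\<Sum>i\<in>I. \<Sum>j\<in>J. (max 0 (p i + q j - c i j))\<^sup>2) / (2 * \<epsilon>)"

lemma penalised_dual_swap:
  "penalised_dual \<epsilon> I J a b c p q = penalised_dual \<epsilon> J I b a (\<lambda>j i. c i j) q p"
  unfolding penalised_dual_def by (subst sum.swap) (simp add: add.commute)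

text \<open>The first-order condition in the coordinate \<open>p i\<close>, obtained without
  differentiation: a shift by \<open>t\<close> changes the value by at least
  \<open>t * A - t^2 * C\<close>, and a maximum allows this for all \<open>t\<close> only if
  \<open>A = 0\<close>.\<close>

lemma penalised_dual_row:
  assumes I: "finite I" and J: "finite J" and \<epsilon>: "0 < \<epsilon>" and i: "i \<in> I"
    and max: "\<And>t. penalised_dual \<epsilon> I J a b c (p(i := p i + t)) q \<le> penalised_dual \<epsilon> I J a b c p q"
  shows "(\<Sum>j\<in>J. max 0 (p i + q j - c i j) / \<epsilon>) = a i"
proof -
  define A where "A = a i - (\<Sum>j\<in>J. max 0 (p i + q j - c i j) / \<epsilon>)"
  \<comment> \<open>The quadratic remainder has coefficient
    \<open>card J / (2 * \<epsilon>)\<close>; the added 1 keeps \<open>C\<close> positive even for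
    an empty \<open>J\<close>.\<close>
  define C where "C = (real (card J) + 1) / (2 * \<epsilon>)"
  have C: "0 < C" using \<epsilon> by (simp add: C_def)
  have sq: "(max 0 (x + t))\<^sup>2 \<le> (max 0 x)\<^sup>2 + 2 * t * max 0 x + t\<^sup>2" for x t :: real
  proof -
    have "\<bar>max 0 (x + t)\<bar> \<le> \<bar>max 0 x + t\<bar>" by linarith
    then have "(max 0 (x + t))\<^sup>2 \<le> (max 0 x + t)\<^sup>2" by (simp only: abs_le_square_iff)
    then show ?thesis by (simp add: power2_sum mult.commute mult.left_commute)
  qed
  have "t * A \<le> t\<^sup>2 * C" for t
  proof -
    let ?p = "p(i := p i + t)"
    have s1: "(\<Sum>k\<in>I. ?p k * a k) = (\<Sum>k\<in>I. p k * a k) + t * a i"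
    proof -
      have "(\<Sum>k\<in>I. ?p k * a k) = (\<Sum>k\<in>I. p k * a k + (if k = i then t * a i else 0))"
        by (intro sum.cong) (auto simp: algebra_simps)
      then show ?thesis using I i by (simp add: sum.distrib)
    qed
    have s2: "(\<Sum>k\<in>I. \<Sum>j\<in>J. (max 0 (?p k + q j - c k j))\<^sup>2)
        \<le> (\<Sum>k\<in>I. \<Sum>j\<in>J. (max 0 (p k + q j - c k j))\<^sup>2) + (\<Sum>j\<in>J. 2 * t * max 0 (p i + q j - c i j) + t\<^sup>2)"
    proof -
      have "(\<Sum>k\<in>I. \<Sum>j\<in>J. (max 0 (?p k + q j - c k j))\<^sup>2)
        \<le> (\<Sum>k\<in>I. (\<Sum>j\<in>J. (max 0 (p k + q j - c k j))\<^sup>2) + (if k = i then \<Sum>j\<in>J. 2 * t * max 0 (p i + q j - c i j) + t\<^sup>2 else 0))"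
      proof (rule sum_mono)
        fix k assume "k \<in> I"
        show "(\<Sum>j\<in>J. (max 0 (?p k + q j - c k j))\<^sup>2)
          \<le> (\<Sum>j\<in>J. (max 0 (p k + q j - c k j))\<^sup>2) + (if k = i then \<Sum>j\<in>J. 2 * t * max 0 (p i + q j - c i j) + t\<^sup>2 else 0)"
        proof (cases "k = i")
          case True
          have "(max 0 (p i + t + q j - c i j))\<^sup>2 \<le> (max 0 (p i + q j - c i j))\<^sup>2 + (2 * t * max 0 (p i + q j - c i j) + t\<^sup>2)" for j
            using sq[of "p i + q j - c i j" t] by (simp add: algebra_simps)
          then have "(\<Sum>j\<in>J. (max 0 (p i + t + q j - c i j))\<^sup>2)
              \<le> (\<Sum>j\<in>J. (max 0 (p i + q j - c i j))\<^sup>2 + (2 * t * max 0 (p i + q j - c i j) + t\<^sup>2))"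
            by (rule sum_mono)
          then show ?thesis using True by (simp only: fun_upd_same simp_thms if_True sum.distrib)
        qed simp
      qed
      also have "\<dots> = (\<Sum>k\<in>I. \<Sum>j\<in>J. (max 0 (p k + q j - c k j))\<^sup>2) + (\<Sum>j\<in>J. 2 * t * max 0 (p i + q j - c i j) + t\<^sup>2)"
        using I i by (subst sum.distrib) simp
      finally show ?thesis .
    qed
    have s3: "(\<Sum>j\<in>J. 2 * t * max 0 (p i + q j - c i j) + t\<^sup>2) = 2 * t * (\<Sum>j\<in>J. max 0 (p i + q j - c i j)) + real (card J) * t\<^sup>2"
      by (simp add: sum.distrib sum_distrib_left)
    let ?S = "\<Sum>k\<in>I. \<Sum>j\<in>J. (max 0 (p k + q j - c k j))\<^sup>2" and ?M = "\<Sum>j\<in>J. max 0 (p i + q j - c i j)"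
    have "(\<Sum>k\<in>I. \<Sum>j\<in>J. (max 0 (?p k + q j - c k j))\<^sup>2) / (2 * \<epsilon>) \<le> (?S + (2 * t * ?M + real (card J) * t\<^sup>2)) / (2 * \<epsilon>)"
      using s2 \<epsilon> unfolding s3 by (intro divide_right_mono) auto
    also have "\<dots> = ?S / (2 * \<epsilon>) + t * (?M / \<epsilon>) + real (card J) * t\<^sup>2 / (2 * \<epsilon>)"
      using \<epsilon> by (simp add: add_divide_distrib)
    finally have "t * a i \<le> t * (?M / \<epsilon>) + real (card J) * t\<^sup>2 / (2 * \<epsilon>)"
      using max[of t] unfolding penalised_dual_def s1 by linarith
    moreover have "real (card J) * t\<^sup>2 / (2 * \<epsilon>) \<le> t\<^sup>2 * C"
      using \<epsilon> unfolding C_def by (simp add: field_simps)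
    moreover have "t * A = t * a i - t * (?M / \<epsilon>)"
      by (simp add: A_def sum_divide_distrib right_diff_distrib)
    ultimately show ?thesis by linarith
  qed
  \<comment> \<open>This is the maximiser of \<open>t * A - t^2 * C\<close>.\<close>
  from this[of "A / (2 * C)"] have "A\<^sup>2 / (2 * C) \<le> A\<^sup>2 / (4 * C)"
    using C by (simp add: power2_eq_square field_simps)
  then have "A\<^sup>2 \<le> 0" using C by (simp add: field_simps)
  then show ?thesis by (simp add: A_def)
qed

lemma compact_box_fun: "compact (PiE (UNIV :: 'k set) (\<lambda>_. {a..b::real}))"
proof -
  have "compactin (product_topology (\<lambda>_. euclidean) (UNIV :: 'k set)) (PiE UNIV (\<lambda>_. {a..b::real}))"
    unfolding compactin_PiE by (simp add: compactin_euclidean_iff)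
  then show ?thesis by (simp add: euclidean_product_topology compactin_euclidean_iff)
qed

text \<open>Moving a constant from \<open>p\<close> to \<open>q\<close> does not change the
  functional, so it is not coercive as it stands. It is a sum of functions \<open>\<phi> i j\<close>
  of \<open>p i + q j\<close>, each tending to minus infinity at both ends. Nonnegative values
  therefore bound all these sums, and normalising \<open>p\<close> at one index confines
  \<open>p\<close> and \<open>q\<close> to a compact box.\<close>

lemma penalised_dual_maximum:
  fixes a :: "'i \<Rightarrow> real" and b :: "'j \<Rightarrow> real"
  assumes I: "finite I" and J: "finite J" and \<epsilon>: "0 < \<epsilon>"
    and a: "\<And>i. i \<in> I \<Longrightarrow> 0 < a i" and b: "\<And>j. j \<in> J \<Longrightarrow> 0 < b j"
    and sa: "(\<Sum>i\<in>I. a i) = 1" and sb: "(\<Sum>j\<in>J. b j) = 1"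
    and c: "\<And>i j. 0 \<le> c i j"
  obtains p q where "\<And>p' q'. penalised_dual \<epsilon> I J a b c p' q' \<le> penalised_dual \<epsilon> I J a b c p q"
proof -
  let ?G = "penalised_dual \<epsilon> I J a b c"
  \<comment> \<open>The product weights spread both linear sums over all pairs, because each
    marginal has total mass 1.\<close>
  define \<phi> where "\<phi> i j s = a i * b j * s - (max 0 (s - c i j))\<^sup>2 / (2 * \<epsilon>)" for i j s
  have G_eq: "?G p q = (\<Sum>i\<in>I. \<Sum>j\<in>J. \<phi> i j (p i + q j))" for p q
  proof -
    have "(\<Sum>i\<in>I. p i * a i) = (\<Sum>i\<in>I. \<Sum>j\<in>J. a i * b j * p i)"
    proof (rule sum.cong[OF refl])
      fix i
      have "(\<Sum>j\<in>J. a i * b j * p i) = a i * p i * (\<Sum>j\<in>J. b j)" by (simp add: sum_distrib_left mult_ac)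
      then show "p i * a i = (\<Sum>j\<in>J. a i * b j * p i)" by (simp add: sb)
    qed
    moreover have "(\<Sum>j\<in>J. q j * b j) = (\<Sum>i\<in>I. \<Sum>j\<in>J. a i * b j * q j)"
    proof -
      have "(\<Sum>i\<in>I. \<Sum>j\<in>J. a i * b j * q j) = (\<Sum>i\<in>I. a i) * (\<Sum>j\<in>J. q j * b j)"
        unfolding sum_product by (intro sum.cong) (auto simp: mult_ac)
      then show ?thesis by (simp add: sa)
    qed
    ultimately show ?thesis
      unfolding penalised_dual_def \<phi>_def by (simp add: sum.distrib sum_subtractf distrib_left sum_divide_distrib)
  qed
  \<comment> \<open>The second summand is the maximum over \<open>u\<close> of
    \<open>a i * b j * u - u^2 / (2 * \<epsilon>)\<close>.\<close>
  define m where "m i j = a i * b j * c i j + \<epsilon> * (a i * b j)\<^sup>2 / 2" for i j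
  have \<phi>_le: "\<phi> i j s \<le> m i j" if "i \<in> I" "j \<in> J" for i j s
  proof (cases "s \<le> c i j")
    case True
    have "0 < a i * b j" using a b that by simp
    then have "a i * b j * s \<le> a i * b j * c i j" using True by (simp add: mult_left_mono)
    moreover have "0 \<le> \<epsilon> * (a i * b j)\<^sup>2 / 2" using \<epsilon> by simp
    ultimately show ?thesis using True by (simp add: \<phi>_def m_def max_def)
  next
    case False
    define u where "u = s - c i j"
    have "0 \<le> (u - \<epsilon> * (a i * b j))\<^sup>2 / (2 * \<epsilon>)" using \<epsilon> by simp
    also have "\<dots> = u\<^sup>2 / (2 * \<epsilon>) - a i * b j * u + \<epsilon> * (a i * b j)\<^sup>2 / 2"
      using \<epsilon> by (simp add: power2_diff field_simps power2_eq_square)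
    finally have "a i * b j * u - u\<^sup>2 / (2 * \<epsilon>) \<le> \<epsilon> * (a i * b j)\<^sup>2 / 2" by simp
    moreover have "\<phi> i j s = a i * b j * c i j + (a i * b j * u - u\<^sup>2 / (2 * \<epsilon>))"
      using False by (simp add: \<phi>_def u_def right_diff_distrib)
    ultimately show ?thesis by (simp add: m_def)
  qed
  have m0: "0 \<le> m i j" if "i \<in> I" "j \<in> J" for i j
    using a[OF that(1)] b[OF that(2)] c[of i j] \<epsilon> by (simp add: m_def)
  define M where "M = (\<Sum>i\<in>I. \<Sum>j\<in>J. m i j)"
  have \<phi>_ge: "- M \<le> \<phi> i j (p i + q j)" if "0 \<le> ?G p q" and ij: "i \<in> I" "j \<in> J" for p q i j
  proof -
    have "0 \<le> (\<Sum>z\<in>I \<times> J. \<phi> (fst z) (snd z) (p (fst z) + q (snd z)))"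
      using that(1) by (simp add: G_eq sum.cartesian_product split_beta)
    also have "\<dots> = \<phi> i j (p i + q j) + (\<Sum>z\<in>I \<times> J - {(i, j)}. \<phi> (fst z) (snd z) (p (fst z) + q (snd z)))"
      using I J ij by (subst sum.remove[of _ "(i, j)"]) auto
    also have "\<dots> \<le> \<phi> i j (p i + q j) + (\<Sum>z\<in>I \<times> J - {(i, j)}. m (fst z) (snd z))"
      by (intro add_left_mono sum_mono \<phi>_le) auto
    also have "(\<Sum>z\<in>I \<times> J - {(i, j)}. m (fst z) (snd z)) \<le> (\<Sum>z\<in>I \<times> J. m (fst z) (snd z))"
      using I J m0 by (intro sum_mono2) auto
    also have "(\<Sum>z\<in>I \<times> J. m (fst z) (snd z)) = M" by (simp add: M_def sum.cartesian_product split_beta)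
    finally show ?thesis by simp
  qed
  have "\<exists>S\<ge>0. \<forall>s. - M \<le> \<phi> i j s \<longrightarrow> \<bar>s\<bar> \<le> S" if ij: "i \<in> I" "j \<in> J" for i j
  proof -
    define k where "k = a i * b j"
    have k: "0 < k" using a b ij by (simp add: k_def)
    have M0: "0 \<le> M" unfolding M_def by (intro sum_nonneg m0)
    \<comment> \<open>Beyond \<open>u0\<close> the penalty outweighs the linear gain: once
      \<open>u \<ge> 1\<close> absorbs the constants into the linear term, the resulting coefficient
      \<open>2 * \<epsilon> * (M + k * c i j + k)\<close> is \<open>u0 - 1\<close>.\<close>
    define u0 where "u0 = 1 + 2 * \<epsilon> * (M + k * c i j + k)"
    have u0: "1 \<le> u0" using \<epsilon> k M0 c[of i j] by (simp add: u0_def)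
    show ?thesis
    proof (intro exI[of _ "max (M / k) (c i j + u0)"] conjI allI impI)
      show "0 \<le> max (M / k) (c i j + u0)" using M0 k by (simp add: le_max_iff_disj)
      fix s assume s: "- M \<le> \<phi> i j s"
      have "\<phi> i j s \<le> k * s" using \<epsilon> by (simp add: \<phi>_def k_def)
      then have "- s * k \<le> M" using s by (simp add: mult.commute)
      then have "- s \<le> M / k" using k by (simp add: pos_le_divide_eq)
      moreover have "s \<le> c i j + u0"
      proof (rule ccontr)
        assume *: "\<not> s \<le> c i j + u0"
        define u where "u = s - c i j"
        have u: "u0 < u" using * by (simp add: u_def)
        have "\<phi> i j s = k * (c i j + u) - u\<^sup>2 / (2 * \<epsilon>)"
          using u u0 by (simp add: \<phi>_def u_def k_def)
        then have "u\<^sup>2 / (2 * \<epsilon>) \<le> M + k * (c i j + u)" using s by linarith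
        then have "u\<^sup>2 \<le> 2 * \<epsilon> * (M + k * (c i j + u))" using \<epsilon> by (simp add: field_simps)
        also have "\<dots> \<le> 2 * \<epsilon> * ((M + k * c i j + k) * u)"
        proof (intro mult_left_mono)
          have "0 \<le> M + k * c i j" using M0 k c[of i j] by simp
          then have "(M + k * c i j) * 1 \<le> (M + k * c i j) * u" using u u0 by (intro mult_left_mono) auto
          then show "M + k * (c i j + u) \<le> (M + k * c i j + k) * u" by (simp add: algebra_simps)
        qed (use \<epsilon> in simp)
        also have "\<dots> = (u0 - 1) * u" by (simp add: u0_def)
        also have "\<dots> < u * u" using u u0 by (intro mult_strict_right_mono) auto
        finally show False by (simp add: power2_eq_square)
      qed
      ultimately show "\<bar>s\<bar> \<le> max (M / k) (c i j + u0)" by linarith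
    qed
  qed
  then obtain S where S0: "\<And>i j. i \<in> I \<Longrightarrow> j \<in> J \<Longrightarrow> 0 \<le> S i j"
    and S: "\<And>i j s. i \<in> I \<Longrightarrow> j \<in> J \<Longrightarrow> - M \<le> \<phi> i j s \<Longrightarrow> \<bar>s\<bar> \<le> S i j"
    by metis
  \<comment> \<open>Each sum \<open>p i + q j\<close> is bounded by \<open>R / 2\<close>; the factor
    2 covers \<open>p i - p i0\<close>, a difference of two such sums.\<close>
  define R where "R = 2 * (\<Sum>i\<in>I. \<Sum>j\<in>J. S i j)"
  have SR: "S i j \<le> R / 2" if "i \<in> I" "j \<in> J" for i j
  proof -
    have "S i j \<le> (\<Sum>j\<in>J. S i j)" using J S0 that by (intro member_le_sum) auto
    also have "\<dots> \<le> (\<Sum>i\<in>I. \<Sum>j\<in>J. S i j)" using I S0 that by (intro member_le_sum[of i I]) (auto intro: sum_nonneg)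
    finally show ?thesis by (simp add: R_def)
  qed
  have R0: "0 \<le> R" unfolding R_def using S0 by (simp add: sum_nonneg)
  define K where "K = PiE (UNIV :: 'i set) (\<lambda>_. {-R..R}) \<times> PiE (UNIV :: 'j set) (\<lambda>_. {-R..R})"
  have "compact K"
    unfolding K_def by (intro compact_Times compact_box_fun)
  note cpt = this
  have zero: "(\<lambda>_. 0, \<lambda>_. 0) \<in> K" using R0 by (auto simp: K_def)
  then have ne: "K \<noteq> {}" by blast
  have cont: "continuous_on K (\<lambda>z. ?G (fst z) (snd z))"
  proof -
    have "continuous_on K (\<lambda>z. fst z i)" for i
      by (rule continuous_on_compose2[OF continuous_on_product_coordinates[of i] continuous_on_fst[OF continuous_on_id]]) simp
    moreover have "continuous_on K (\<lambda>z. snd z j)" for j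
      by (rule continuous_on_compose2[OF continuous_on_product_coordinates[of j] continuous_on_snd[OF continuous_on_id]]) simp
    ultimately show ?thesis unfolding penalised_dual_def by (intro continuous_intros) (use \<epsilon> in auto)
  qed
  obtain z where z: "z \<in> K" "\<And>w. w \<in> K \<Longrightarrow> ?G (fst w) (snd w) \<le> ?G (fst z) (snd z)"
    using continuous_attains_sup[OF cpt ne cont] by (elim bexE) simp
  have "?G p q \<le> ?G (fst z) (snd z)" for p q
  proof (cases "0 \<le> ?G p q")
    case False
    have "(max 0 (- c i j))\<^sup>2 = 0" for i j using c[of i j] by simp
    then have "?G (\<lambda>_. 0) (\<lambda>_. 0) = 0" by (simp add: penalised_dual_def)
    then show ?thesis using z(2)[OF zero] False by simp
  next
    case True
    obtain i0 where i0: "i0 \<in> I" using sa by fastforce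
    obtain j0 where j0: "j0 \<in> J" using sb by fastforce
    \<comment> \<open>The shift by \<open>p i0\<close> fixes the free constant; the value 0 off
      \<open>I\<close> and \<open>J\<close> puts both functions into the box.\<close>
    define p' where "p' i = (if i \<in> I then p i - p i0 else 0)" for i
    define q' where "q' j = (if j \<in> J then q j + p i0 else 0)" for j
    have s: "\<bar>p i + q j\<bar> \<le> R / 2" if "i \<in> I" "j \<in> J" for i j
      using S[OF that \<phi>_ge[OF True that]] SR[OF that] by simp
    have "\<bar>q' j\<bar> \<le> R" for j using s[OF i0, of j] R0 by (auto simp: q'_def add.commute)
    moreover have "\<bar>p' i\<bar> \<le> R" for i
    proof (cases "i \<in> I")
      case True
      have "\<bar>p i - p i0\<bar> \<le> R" using s[OF True j0] s[OF i0 j0] by linarith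
      then show ?thesis using True by (simp add: p'_def)
    qed (use R0 in \<open>simp add: p'_def\<close>)
    ultimately have "(p', q') \<in> K" by (auto simp: K_def abs_le_iff minus_le_iff)
    moreover have "?G p' q' = ?G p q"
      unfolding G_eq by (intro sum.cong refl) (simp add: p'_def q'_def)
    ultimately show ?thesis using z(2)[of "(p', q')"] by simp
  qed
  then show thesis by (rule that)
qed

text \<open>The plan is the penalty slope at a maximum. Its entries are at most 1, being bounded by
  the masses, so the dual constraint is violated by at most \<epsilon>. It charges only pairs with
  \<open>c i j \<le> p i + q j\<close>, which gives the cost bound without an error term.\<close>

lemma finite_transport_duality:
  fixes a :: "'i \<Rightarrow> real" and b :: "'j \<Rightarrow> real"
  assumes I: "finite I" and J: "finite J" and \<epsilon>: "0 < \<epsilon>"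
    and a: "\<And>i. i \<in> I \<Longrightarrow> 0 < a i" and b: "\<And>j. j \<in> J \<Longrightarrow> 0 < b j"
    and sa: "(\<Sum>i\<in>I. a i) = 1" and sb: "(\<Sum>j\<in>J. b j) = 1"
    and c: "\<And>i j. 0 \<le> c i j"
  obtains \<gamma> p q where "\<And>i j. 0 \<le> \<gamma> i j"
    "\<And>i. i \<in> I \<Longrightarrow> (\<Sum>j\<in>J. \<gamma> i j) = a i" "\<And>j. j \<in> J \<Longrightarrow> (\<Sum>i\<in>I. \<gamma> i j) = b j"
    "\<And>i j. i \<in> I \<Longrightarrow> j \<in> J \<Longrightarrow> p i + q j \<le> c i j + \<epsilon>"
    "(\<Sum>i\<in>I. \<Sum>j\<in>J. \<gamma> i j * c i j) \<le> (\<Sum>i\<in>I. p i * a i) + (\<Sum>j\<in>J. q j * b j)"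
proof -
  obtain p q where max: "\<And>p' q'. penalised_dual \<epsilon> I J a b c p' q' \<le> penalised_dual \<epsilon> I J a b c p q"
    by (rule penalised_dual_maximum[OF I J \<epsilon> a b sa sb c]) (assumption+, rule that)
  define \<gamma> where "\<gamma> i j = max 0 (p i + q j - c i j) / \<epsilon>" for i j
  have \<gamma>0: "0 \<le> \<gamma> i j" for i j using \<epsilon> by (simp add: \<gamma>_def)
  have row: "(\<Sum>j\<in>J. \<gamma> i j) = a i" if "i \<in> I" for i
    unfolding \<gamma>_def by (rule penalised_dual_row[OF I J \<epsilon> that max])
  have "(\<Sum>i\<in>I. max 0 (q j + p i - c i j) / \<epsilon>) = b j" if "j \<in> J" for j
    by (rule penalised_dual_row[OF J I \<epsilon> that, where c = "\<lambda>j i. c i j" and a = b and b = a])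
      (use max in \<open>simp only: penalised_dual_swap[of \<epsilon> I J]\<close>)
  then have col: "(\<Sum>i\<in>I. \<gamma> i j) = b j" if "j \<in> J" for j
    using that by (simp add: \<gamma>_def add.commute)
  have feas: "p i + q j \<le> c i j + \<epsilon>" if ij: "i \<in> I" "j \<in> J" for i j
  proof -
    have "\<gamma> i j \<le> (\<Sum>j\<in>J. \<gamma> i j)" using J ij \<gamma>0 by (intro member_le_sum) auto
    also have "\<dots> = a i" by (rule row[OF ij(1)])
    also have "\<dots> \<le> (\<Sum>i\<in>I. a i)" using I ij a by (intro member_le_sum) (auto intro: less_imp_le)
    finally have "max 0 (p i + q j - c i j) \<le> \<epsilon>" using sa \<epsilon> by (simp add: \<gamma>_def)
    then show ?thesis by linarith
  qed
  have "(\<Sum>i\<in>I. \<Sum>j\<in>J. \<gamma> i j * c i j) \<le> (\<Sum>i\<in>I. \<Sum>j\<in>J. \<gamma> i j * (p i + q j))"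
  proof (intro sum_mono)
    fix i j
    show "\<gamma> i j * c i j \<le> \<gamma> i j * (p i + q j)"
    proof (cases "c i j \<le> p i + q j")
      case True then show ?thesis using \<gamma>0 by (rule mult_left_mono)
    next
      case False then have "\<gamma> i j = 0" by (simp add: \<gamma>_def)
      then show ?thesis by simp
    qed
  qed
  also have "\<dots> = (\<Sum>i\<in>I. p i * (\<Sum>j\<in>J. \<gamma> i j)) + (\<Sum>i\<in>I. \<Sum>j\<in>J. q j * \<gamma> i j)"
    by (simp add: distrib_left sum.distrib sum_distrib_left mult.commute)
  also have "(\<Sum>i\<in>I. \<Sum>j\<in>J. q j * \<gamma> i j) = (\<Sum>j\<in>J. q j * (\<Sum>i\<in>I. \<gamma> i j))"
    by (subst sum.swap) (simp add: sum_distrib_left)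
  finally have "(\<Sum>i\<in>I. \<Sum>j\<in>J. \<gamma> i j * c i j) \<le> (\<Sum>i\<in>I. p i * a i) + (\<Sum>j\<in>J. q j * b j)"
    by (simp add: row col)
  then show thesis using that[OF \<gamma>0 row col feas] by blast
qed

section \<open>Transport maps between atomless measures\<close>

text \<open>The distribution function is continuous, so it takes the value \<open>t\<close>, and its
  sublevel set is the half-line ending at the last point where it does.\<close>

lemma measure_cdf_le:
  assumes M: "real_distribution M" and atomless: "\<And>x. measure M {x} = 0" and t: "0 < t" "t < 1"
  shows "measure M {x. cdf M x \<le> t} = t"
proof -
  interpret M: real_distribution M by (rule M)
  have cont: "continuous_on UNIV (cdf M)"
    using atomless by (intro continuous_at_imp_continuous_on ballI) (simp add: M.isCont_cdf)
  obtain x1 where x1: "t < cdf M x1"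
    using order_tendstoD(1)[OF M.cdf_lim_at_top_prob t(2)] by (meson eventually_at_top_linorder order_refl)
  obtain x0 where x0: "cdf M x0 < t"
    using order_tendstoD(2)[OF M.cdf_lim_at_bot t(1)] by (meson eventually_at_bot_linorder order_refl)
  have "x0 \<le> x1" using M.cdf_nondecreasing[of x1 x0] x0 x1 by linarith
  then obtain z where z: "x0 \<le> z" "z \<le> x1" "cdf M z = t"
    using IVT'[of "cdf M" x0 t x1] x0 x1 cont by (auto intro: continuous_on_subset)
  let ?K = "{x \<in> {x0..x1}. cdf M x = t}"
  have "closed {x. cdf M x = t}" by (intro closed_Collect_eq cont continuous_on_const)
  then have "compact ({x0..x1} \<inter> {x. cdf M x = t})" by (intro compact_Int_closed compact_Icc)
  then have "compact ?K" by (simp add: Int_def)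
  then obtain s where s: "s \<in> ?K" "\<And>x. x \<in> ?K \<Longrightarrow> x \<le> s"
    using compact_attains_sup[of ?K] z by auto
  have "{x. cdf M x \<le> t} = {..s}"
  proof (intro equalityI subsetI)
    fix x assume x: "x \<in> {x. cdf M x \<le> t}"
    show "x \<in> {..s}"
    proof (rule ccontr)
      assume "x \<notin> {..s}"
      then have "s < x" by simp
      then have "cdf M x = t" using M.cdf_nondecreasing[of s x] s(1) x by auto
      moreover have "x \<le> x1"
        using M.cdf_nondecreasing[of x1 x] x1 \<open>cdf M x = t\<close> by linarith
      ultimately have "x \<in> ?K" using \<open>s < x\<close> s(1) by auto
      then show False using s(2)[of x] \<open>s < x\<close> by simp
    qed
  next
    fix x assume "x \<in> {..s}"
    then show "x \<in> {x. cdf M x \<le> t}" using M.cdf_nondecreasing[of x s] s(1) by auto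
  qed
  then show ?thesis using s(1) by (simp add: cdf_def)
qed

text \<open>This is the probability integral transform, verified on distribution functions.\<close>

lemma distr_cdf:
  assumes M: "real_distribution M" and atomless: "\<And>x. measure M {x} = 0"
  shows "distr M borel (cdf M) = distr (restrict_space lborel {0<..<1}) borel (\<lambda>x. x)"
proof -
  interpret M: real_distribution M by (rule M)
  let ?L = "restrict_space lborel {0<..<1::real}"
  interpret L: prob_space ?L
    by (auto simp add: emeasure_restrict_space space_restrict_space intro!: prob_spaceI)
  have [measurable]: "cdf M \<in> borel_measurable borel"
    using M.cdf_nondecreasing by (intro borel_measurable_mono monoI)
  then have meas: "cdf M \<in> borel_measurable M" by simp
  have id: "(\<lambda>x. x) \<in> borel_measurable ?L" by (rule measurable_restrict_space1) simp
  show ?thesis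
  proof (rule cdf_unique)
    show "real_distribution (distr M borel (cdf M))"
      using M.prob_space_distr[OF meas] by (simp add: real_distribution_def real_distribution_axioms_def)
    show "real_distribution (distr ?L borel (\<lambda>x. x))"
      using L.prob_space_distr[OF id] by (simp add: real_distribution_def real_distribution_axioms_def)
    show "cdf (distr M borel (cdf M)) = cdf (distr ?L borel (\<lambda>x. x))"
    proof
      fix t :: real
      have l: "cdf (distr M borel (cdf M)) t = measure M {x. cdf M x \<le> t}"
        using meas by (simp add: cdf_def measure_distr vimage_def)
      have r: "cdf (distr ?L borel (\<lambda>x. x)) t = measure lborel ({0<..<1} \<inter> {..t})"
        using id by (simp add: cdf_def measure_distr space_restrict_space measure_restrict_space Int_commute)
      \<comment> \<open>\<open>measure_cdf_le\<close> covers levels strictly between 0 and 1; a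
        positive mass at a level \<open>t \<le> 0\<close> contradicts it at the level of half that
        mass.\<close>
      have small: "measure M {x. cdf M x \<le> t} = 0" if "t \<le> 0"
      proof (rule ccontr)
        assume ne: "measure M {x. cdf M x \<le> t} \<noteq> 0"
        define s where "s = measure M {x. cdf M x \<le> t} / 2"
        have "0 < measure M {x. cdf M x \<le> t}" using ne by (simp add: zero_less_measure_iff)
        then have s: "0 < s" "s < 1" "s < measure M {x. cdf M x \<le> t}"
          using M.prob_le_1[of "{x. cdf M x \<le> t}"] unfolding s_def by linarith+
        have "measure M {x. cdf M x \<le> t} \<le> measure M {x. cdf M x \<le> s}"
          using s that by (intro M.finite_measure_mono) auto
        then show False using measure_cdf_le[OF M atomless s(1,2)] s by simp
      qed
      consider "t \<le> 0" | "0 < t" "t < 1" | "1 \<le> t" by linarith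
      then show "cdf (distr M borel (cdf M)) t = cdf (distr ?L borel (\<lambda>x. x)) t"
      proof cases
        case 1
        then have "{0<..<1} \<inter> {..t} = {}" by auto
        then show ?thesis using small[OF 1] by (simp add: l r)
      next
        case 2
        then have "{0<..<1} \<inter> {..t} = {0<..t}" by auto
        then show ?thesis using measure_cdf_le[OF M atomless 2] 2 by (simp add: l r)
      next
        case 3
        have "cdf M x \<le> t" for x using M.cdf_bounded_prob[of x] 3 by linarith
        then have "{x. cdf M x \<le> t} = UNIV" by blast
        moreover have "{0<..<1} \<inter> {..t} = {0<..<1}" using 3 by auto
        ultimately show ?thesis using M.prob_space by (simp add: l r)
      qed
    qed
  qed
qed

text \<open>The distribution function makes the source uniform, and the generalised inverse
  \<open>N.I\<close> turns the uniform law into \<open>N\<close>; \<open>J\<close> extends it by 0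
  to the whole line.\<close>

lemma exists_real_transport:
  assumes M: "real_distribution M" and atomless: "\<And>x. measure M {x} = 0" and N: "real_distribution N"
  obtains h where "h \<in> borel_measurable borel" "distr M borel h = N"
proof -
  interpret M: real_distribution M by (rule M)
  interpret N: cdf_distribution N unfolding cdf_distribution_def by (rule N)
  let ?L = "restrict_space lborel {0<..<1::real}"
  define J where "J x = (if x \<in> {0<..<1} then N.I x else 0)" for x
  have J[measurable]: "J \<in> borel_measurable borel"
    unfolding J_def using N.measurable_CI by (subst measurable_restrict_space_iff[symmetric]) auto
  have V[measurable]: "cdf M \<in> borel_measurable borel"
    using M.cdf_nondecreasing by (intro borel_measurable_mono monoI)
  have "N = distr ?L borel N.I" by (rule N.distr_I_eq_M[symmetric])
  also have "\<dots> = distr ?L borel (\<lambda>x. J x)"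
    by (rule distr_cong) (auto simp: J_def space_restrict_space)
  also have "\<dots> = distr (distr ?L borel (\<lambda>x. x)) borel J"
    by (subst distr_distr) (auto simp: comp_def intro!: measurable_restrict_space1)
  also have "\<dots> = distr (distr M borel (cdf M)) borel J"
    by (simp only: distr_cdf[OF M atomless])
  also have "\<dots> = distr M borel (J \<circ> cdf M)" by (subst distr_distr) auto
  finally have "distr M borel (J \<circ> cdf M) = N" ..
  moreover have "J \<circ> cdf M \<in> borel_measurable borel" by (rule measurable_comp[OF V J])
  ultimately show thesis using that by blast
qed

text \<open>With base 3 and digits 0 and 1 every tail is at most half a unit, so the floor reads off
  the digits exactly; in base 2 a number could have two expansions.\<close>

lemma ternary_digits:
  fixes a :: "nat \<Rightarrow> nat"
  assumes a: "\<And>k. a k \<le> 1"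
  defines "r \<equiv> (\<Sum>k. real (a k) * (1 / 3) ^ Suc k)"
  shows "\<lfloor>3 ^ Suc m * r\<rfloor> - 3 * \<lfloor>3 ^ m * r\<rfloor> = int (a m)"
proof -
  define T where "T m = (\<Sum>k. real (a (k + m)) * (1 / 3) ^ Suc k)" for m
  have geo: "(\<lambda>k. (1 / 3 :: real) ^ Suc k) sums (1 / 2)"
    using geometric_sums[of "1 / 3 :: real"] sums_mult[of "\<lambda>k. (1 / 3 :: real) ^ k" "3 / 2" "1 / 3"] by simp
  have le: "real (a k) * (1 / 3) ^ Suc j \<le> (1 / 3) ^ Suc j" for k j
    using a[of k] by (intro mult_left_le_one_le) auto
  have summ: "summable (\<lambda>k. real (a (k + m)) * (1 / 3) ^ Suc k)" for m
  proof (rule summable_comparison_test'[OF sums_summable[OF geo], of 0])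
    fix k
    have "0 \<le> real (a (k + m)) * (1 / 3) ^ Suc k" by simp
    then show "norm (real (a (k + m)) * (1 / 3) ^ Suc k) \<le> (1 / 3) ^ Suc k"
      unfolding real_norm_def by (subst abs_of_nonneg) (assumption, rule le)
  qed
  have T0: "0 \<le> T m" for m unfolding T_def by (intro suminf_nonneg summ) simp
  have T1: "T m < 1" for m
  proof -
    have "T m \<le> (\<Sum>k. (1 / 3 :: real) ^ Suc k)"
      unfolding T_def by (intro suminf_le le summ sums_summable[OF geo])
    then show ?thesis using sums_unique[OF geo] by simp
  qed
  have rec: "3 * T m = real (a m) + T (Suc m)" for m
  proof -
    have "T m = real (a m) * (1 / 3) + (\<Sum>k. real (a (Suc k + m)) * (1 / 3) ^ Suc (Suc k))"
      unfolding T_def using suminf_split_head[OF summ[of m]] by simp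
    also have "(\<Sum>k. real (a (Suc k + m)) * (1 / 3) ^ Suc (Suc k)) = T (Suc m) * (1 / 3)"
      unfolding T_def using suminf_mult2[OF summ[of "Suc m"], of "1 / 3"] by (simp add: mult_ac)
    finally show ?thesis by simp
  qed
  define N where "N = rec_nat (0 :: int) (\<lambda>m n. 3 * n + int (a m))"
  have "3 ^ m * r = of_int (N m) + T m" for m
  proof (induction m)
    case 0 then show ?case by (simp add: N_def r_def T_def)
  next
    case (Suc m)
    have "3 ^ Suc m * r = 3 * of_int (N m) + 3 * T m" using Suc by simp
    then show ?case using rec[of m] by (simp add: N_def)
  qed
  then have "\<lfloor>3 ^ m * r\<rfloor> = N m" for m using T0[of m] T1[of m] by (simp add: floor_eq_iff)
  then have "\<lfloor>3 ^ Suc m * r\<rfloor> - 3 * \<lfloor>3 ^ m * r\<rfloor> = N (Suc m) - 3 * N m" by (simp only:)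
  then show ?thesis by (simp add: N_def)
qed

lemma SUP_rat_below: "(SUP q\<in>\<rat>. if q < t then ereal q else - \<infinity>) = ereal t" for t :: real
proof (rule antisym)
  show "(SUP q\<in>\<rat>. if q < t then ereal q else - \<infinity>) \<le> ereal t"
    by (intro SUP_least) auto
  show "ereal t \<le> (SUP q\<in>\<rat>. if q < t then ereal q else - \<infinity>)"
  proof (rule ereal_le_epsilon2)
    fix e :: real assume "0 < e"
    then obtain q where q: "q \<in> \<rat>" "t - e < q" "q < t" using Rats_dense_in_real[of "t - e" t] by auto
    have "ereal q \<le> (SUP q\<in>\<rat>. if q < t then ereal q else - \<infinity>)"
      by (rule SUP_upper2[OF q(1)]) (use q(3) in simp)
    then have "ereal q + ereal e \<le> (SUP q\<in>\<rat>. if q < t then ereal q else - \<infinity>) + ereal e"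
      by (rule add_right_mono)
    moreover have "ereal t \<le> ereal q + ereal e" using q(2) by simp
    ultimately show "ereal t \<le> (SUP q\<in>\<rat>. if q < t then ereal q else - \<infinity>) + ereal e" by (rule order_trans[rotated])
  qed
qed

text \<open>
  Points are coded by a real number whose ternary digits say which of countably many half spaces
  contain the point.
\<close>

lemma borel_coding:
  obtains \<phi> :: "'a::euclidean_space \<Rightarrow> real" and \<psi> where
    "\<phi> \<in> borel_measurable borel" "\<psi> \<in> borel_measurable borel" "\<And>x. \<psi> (\<phi> x) = x"
proof -
  define K where "K = (Basis :: 'a set) \<times> (\<rat> :: real set)"
  have K: "countable K" unfolding K_def by (intro countable_SIGMA countable_rat) (simp add: countable_finite)
  define e where "e = from_nat_into K"
  define dig where "dig k x = (if snd (e k) < x \<bullet> fst (e k) then 1 else 0 :: nat)" for k and x :: 'a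
  define \<phi> where "\<phi> x = (\<Sum>k. real (dig k x) * (1 / 3) ^ Suc k)" for x :: 'a
  define D where "D k r = \<lfloor>3 ^ Suc k * r\<rfloor> - 3 * \<lfloor>3 ^ k * r\<rfloor>" for k and r :: real
  \<comment> \<open>A coordinate is the supremum of the rationals whose half space contains the
    point; the value minus infinity discards the others.\<close>
  define s where "s b r = (SUP q\<in>\<rat>. if D (to_nat_on K (b, q)) r = 1 then ereal q else - \<infinity>)" for b r
  define \<psi> where "\<psi> r = (\<Sum>b\<in>Basis. real_of_ereal (s b r) *\<^sub>R b)" for r
  have [measurable]: "dig k \<in> measurable borel (count_space UNIV)" for k unfolding dig_def by measurable
  have \<phi>: "\<phi> \<in> borel_measurable borel" unfolding \<phi>_def by measurable
  have [measurable]: "D k \<in> measurable borel (count_space UNIV)" for k unfolding D_def by measurable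
  have "s b \<in> borel_measurable borel" for b
    unfolding s_def by (intro borel_measurable_SUP countable_rat) measurable
  then have \<psi>: "\<psi> \<in> borel_measurable borel" unfolding \<psi>_def by measurable
  have "\<psi> (\<phi> x) = x" for x
  proof -
    have "s b (\<phi> x) = ereal (x \<bullet> b)" if b: "b \<in> Basis" for b
    proof -
      have "D (to_nat_on K (b, q)) (\<phi> x) = 1 \<longleftrightarrow> q < x \<bullet> b" if q: "q \<in> \<rat>" for q
      proof -
        have "e (to_nat_on K (b, q)) = (b, q)"
          unfolding e_def using b q by (intro from_nat_into_to_nat_on K) (simp add: K_def)
        moreover have "D (to_nat_on K (b, q)) (\<phi> x) = int (dig (to_nat_on K (b, q)) x)"
          unfolding D_def \<phi>_def by (rule ternary_digits) (simp add: dig_def)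
        ultimately show ?thesis by (simp add: dig_def)
      qed
      then have "s b (\<phi> x) = (SUP q\<in>\<rat>. if q < x \<bullet> b then ereal q else - \<infinity>)"
        unfolding s_def by (intro SUP_cong) auto
      then show ?thesis by (simp only: SUP_rat_below)
    qed
    then show ?thesis by (simp add: \<psi>_def euclidean_representation)
  qed
  then show thesis using that[OF \<phi> \<psi>] by blast
qed

text \<open>A single coordinate of the source already has an atomless law, because hyperplanes are
  Lebesgue-null, and the target is coded injectively in the line; this reduces the problem to
  dimension one.\<close>

lemma exists_transport:
  fixes M N :: "'a::euclidean_space measure"
  assumes M: "prob_space M" "sets M = sets borel" and N: "prob_space N" "sets N = sets borel"
    and ac: "\<And>A. A \<in> null_sets lborel \<Longrightarrow> emeasure M A = 0"
  obtains S where "S \<in> borel_measurable borel" "distr M borel S = N"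
proof -
  interpret M: prob_space M by (rule M)
  interpret N: prob_space N by (rule N)
  note [measurable_cong] = M(2) N(2)
  obtain b :: 'a where b: "b \<in> Basis" using nonempty_Basis by blast
  have [measurable]: "(\<lambda>x. x \<bullet> b) \<in> borel_measurable M" by measurable
  have rM: "real_distribution (distr M borel (\<lambda>x. x \<bullet> b))"
    using M.prob_space_distr[of "\<lambda>x. x \<bullet> b" borel] by (simp add: real_distribution_def real_distribution_axioms_def)
  have atomless: "measure (distr M borel (\<lambda>x. x \<bullet> b)) {t} = 0" for t
  proof -
    have "negligible {x. b \<bullet> x = t}" using b by (intro negligible_hyperplane) auto
    moreover have "{x. b \<bullet> x = t} \<in> sets borel" by measurable
    ultimately have "{x. b \<bullet> x = t} \<in> null_sets lborel" by (simp add: negligible_iff_null_sets_lborel)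
    then have "emeasure M {x. b \<bullet> x = t} = 0" by (rule ac)
    moreover have "(\<lambda>x. x \<bullet> b) -` {t} \<inter> space M = {x. b \<bullet> x = t}"
      using sets_eq_imp_space_eq[OF M(2)] by (auto simp: inner_commute)
    ultimately have "emeasure (distr M borel (\<lambda>x. x \<bullet> b)) {t} = 0" by (subst emeasure_distr) auto
    then show ?thesis by (simp only: measure_def enn2real_0)
  qed
  obtain \<phi> :: "'a \<Rightarrow> real" and \<psi> where \<phi>[measurable]: "\<phi> \<in> borel_measurable borel"
    and \<psi>[measurable]: "\<psi> \<in> borel_measurable borel" and \<psi>\<phi>: "\<And>x. \<psi> (\<phi> x) = x"
    by (rule borel_coding) (rule that)
  have rN: "real_distribution (distr N borel \<phi>)"
    using N.prob_space_distr[of \<phi> borel] by (simp add: real_distribution_def real_distribution_axioms_def)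
  obtain h where h[measurable]: "h \<in> borel_measurable borel"
    and hN: "distr (distr M borel (\<lambda>x. x \<bullet> b)) borel h = distr N borel \<phi>"
    by (rule exists_real_transport[OF rM atomless rN])
  have "distr M borel (\<lambda>x. \<psi> (h (x \<bullet> b))) = distr (distr (distr M borel (\<lambda>x. x \<bullet> b)) borel h) borel \<psi>"
    by (simp add: distr_distr comp_def)
  also have "\<dots> = distr N borel (\<lambda>x. x)" unfolding hN by (simp add: distr_distr comp_def \<psi>\<phi>)
  also have "\<dots> = N" by (rule distr_id2) (simp add: N(2))
  finally have "distr M borel (\<lambda>x. \<psi> (h (x \<bullet> b))) = N" .
  moreover have "(\<lambda>x. \<psi> (h (x \<bullet> b))) \<in> borel_measurable borel" by measurable
  ultimately show thesis using that by blast
qed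

section \<open>Discretisation of a domain and maps realising finite plans\<close>

lemma compact_borel_partition:
  fixes \<Omega> :: "'a::euclidean_space set"
  assumes "compact \<Omega>" "0 < \<delta>"
  obtains n :: nat and c Q where "\<And>k. k < n \<Longrightarrow> c k \<in> \<Omega>" "\<And>k. Q k \<in> sets borel"
    "\<And>k x. x \<in> Q k \<Longrightarrow> dist (c k) x < \<delta>" "disjoint_family Q" "(\<Union>k<n. Q k) = \<Omega>"
proof -
  obtain F where F: "finite F" "F \<subseteq> \<Omega>" "\<Omega> \<subseteq> (\<Union>x\<in>F. ball x \<delta>)"
    by (rule compactE_image[OF assms(1), of \<Omega> "\<lambda>x. ball x \<delta>"]) (use assms(2) in auto)
  obtain n :: nat and c where c: "F = c ` {i. i < n}" using finite_imp_nat_seg_image_inj_on[OF F(1)] by blast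
  define A where "A k = (if k < n then \<Omega> \<inter> ball (c k) \<delta> else {})" for k
  have A: "A k \<in> sets borel" for k
    using compact_imp_closed[OF assms(1)] by (auto simp: A_def)
  have "disjoint_family (disjointed A)" by (rule disjoint_family_disjointed)
  moreover have sub: "disjointed A k \<subseteq> A k" for k by (rule disjointed_subset)
  moreover have "(\<Union>k<n. disjointed A k) = \<Omega>"
  proof -
    have "disjointed A k = {}" if "\<not> k < n" for k using sub[of k] that by (simp add: A_def)
    then have "(\<Union>k<n. disjointed A k) = (\<Union>k. disjointed A k)" by blast
    also have "\<dots> = (\<Union>k. A k)" by (rule UN_disjointed_eq)
    also have "\<dots> = \<Omega>" using F(3) c by (fastforce simp: A_def split: if_splits)
    finally show ?thesis .
  qed
  moreover have "disjointed A k \<in> sets borel" for k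
    using sets.range_disjointed_sets[of A borel] A by blast
  moreover have "c k \<in> \<Omega>" if "k < n" for k using F(2) c that by blast
  moreover have "dist (c k) x < \<delta>" if "x \<in> disjointed A k" for k x
    using subsetD[OF sub that] by (auto simp: A_def split: if_splits)
  ultimately show thesis using that[of n c "disjointed A"] by blast
qed

lemma measure_step_bound:
  assumes M: "finite_measure M" and f: "integrable M f" and K: "finite K" "\<And>k. k \<in> K \<Longrightarrow> Q k \<in> sets M"
    and le: "AE x in M. f x \<le> (\<Sum>k\<in>K. t k * indicator (Q k) x)"
  shows "(\<integral>x. f x \<partial>M) \<le> (\<Sum>k\<in>K. t k * measure M (Q k))"
proof -
  interpret finite_measure M by (rule M)
  have i: "integrable M (\<lambda>x. t k * indicator (Q k) x)" if "k \<in> K" for k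
    using K(2)[OF that] by (intro integrable_mult_right integrable_real_indicator) (auto simp: emeasure_finite less_top[symmetric])
  have "(\<integral>x. f x \<partial>M) \<le> (\<integral>x. (\<Sum>k\<in>K. t k * indicator (Q k) x) \<partial>M)"
    using i by (intro integral_mono_AE f le Bochner_Integration.integrable_sum)
  also have "\<dots> = (\<Sum>k\<in>K. (\<integral>x. t k * indicator (Q k) x \<partial>M))"
    using i by (rule Bochner_Integration.integral_sum)
  also have "\<dots> = (\<Sum>k\<in>K. t k * measure M (Q k))"
    using K(2) by (intro sum.cong refl) simp
  finally show ?thesis .
qed

lemma prob_measures_onD:
  assumes "\<mu> \<in> prob_measures_on \<Omega>"
  shows "prob_space \<mu>" "sets \<mu> = sets borel" "space \<mu> = UNIV" "emeasure \<mu> (- \<Omega>) = 0"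
  using assms sets_eq_imp_space_eq[of \<mu> borel] by (auto simp: prob_measures_on_def)

lemma AE_in_domain:
  assumes "\<mu> \<in> prob_measures_on \<Omega>" "\<Omega> \<in> sets borel"
  shows "AE x in \<mu>. x \<in> \<Omega>"
  using prob_measures_onD[OF assms(1)] assms(2) by (intro AE_I[of _ _ "- \<Omega>"]) auto

lemma pushforward_eq_distr:
  assumes \<mu>: "\<mu> \<in> prob_measures_on \<Omega>" and \<Omega>: "\<Omega> \<in> sets borel" and S: "S \<in> borel_measurable borel"
  shows "pushforward \<Omega> \<mu> S = distr \<mu> borel S"
  unfolding pushforward_def
proof (rule measure_eqI)
  note p = prob_measures_onD[OF \<mu>]
  fix A assume "A \<in> sets (distr (restrict_space \<mu> \<Omega>) borel S)"
  then have A: "A \<in> sets borel" by simp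
  have SA: "S -` A \<in> sets borel" by (rule measurable_sets_borel[OF S A])
  have S\<mu>: "S \<in> borel_measurable \<mu>" using S p(2) by (simp cong: measurable_cong_sets)
  then have "emeasure (distr (restrict_space \<mu> \<Omega>) borel S) A = emeasure (restrict_space \<mu> \<Omega>) (S -` A \<inter> \<Omega>)"
    using A p(3) by (subst emeasure_distr) (auto simp: space_restrict_space intro: measurable_restrict_space1)
  also have "\<dots> = emeasure \<mu> (S -` A \<inter> \<Omega>)"
    using \<Omega> p by (intro emeasure_restrict_space) auto
  also have "\<dots> = emeasure \<mu> (S -` A)"
    using AE_in_domain[OF \<mu> \<Omega>] SA \<Omega> p(2) by (intro emeasure_eq_AE) auto
  also have "\<dots> = emeasure (distr \<mu> borel S) A"
    using S\<mu> A p(3) by (simp add: emeasure_distr)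
  finally show "emeasure (distr (restrict_space \<mu> \<Omega>) borel S) A = emeasure (distr \<mu> borel S) A" .
qed simp

lemma transport_mapI:
  assumes \<mu>: "\<mu> \<in> prob_measures_on \<Omega>" and \<Omega>: "\<Omega> \<in> sets borel"
    and S: "S \<in> borel_measurable borel" "\<And>x. x \<in> \<Omega> \<Longrightarrow> S x \<in> \<Omega>" and d: "distr \<mu> borel S = \<nu>"
  shows "transport_map \<Omega> \<mu> \<nu> S"
proof -
  have "S \<in> restrict_space borel \<Omega> \<rightarrow>\<^sub>M restrict_space borel \<Omega>"
    using S by (intro measurable_restrict_space2 measurable_restrict_space1) (auto simp: space_restrict_space)
  then show ?thesis using d pushforward_eq_distr[OF \<mu> \<Omega> S(1)] by (simp add: transport_map_def)
qed

text \<open>Provides a total Borel version with values in \<open>\<Omega>\<close>; \<open>x0\<close>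
  is the default value off \<open>\<Omega>\<close>.\<close>

lemma transport_mapE:
  assumes T: "transport_map \<Omega> \<mu> \<nu> T" and \<mu>: "\<mu> \<in> prob_measures_on \<Omega>" and \<Omega>: "\<Omega> \<in> sets borel" and x0: "x0 \<in> \<Omega>"
  obtains T' where "T' \<in> borel_measurable borel" "\<And>x. x \<in> \<Omega> \<Longrightarrow> T' x = T x" "\<And>x. T' x \<in> \<Omega>" "distr \<mu> borel T' = \<nu>"
proof -
  define T' where "T' x = (if x \<in> \<Omega> then T x else x0)" for x
  have TM: "T \<in> restrict_space borel \<Omega> \<rightarrow>\<^sub>M restrict_space borel \<Omega>" and push: "pushforward \<Omega> \<mu> T = \<nu>"
    using T by (auto simp: transport_map_def)
  have T\<Omega>: "T x \<in> \<Omega>" if "x \<in> \<Omega>" for x using measurable_space[OF TM] that by (simp add: space_restrict_space)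
  have "T \<in> restrict_space borel \<Omega> \<rightarrow>\<^sub>M borel" using TM by (simp add: measurable_restrict_space2_iff)
  then have T': "T' \<in> borel_measurable borel"
    unfolding T'_def using \<Omega> by (subst measurable_restrict_space_iff[symmetric]) auto
  have "distr \<mu> borel T' = pushforward \<Omega> \<mu> T'" by (rule pushforward_eq_distr[OF \<mu> \<Omega> T', symmetric])
  also have "\<dots> = pushforward \<Omega> \<mu> T"
    unfolding pushforward_def by (rule distr_cong) (auto simp: T'_def space_restrict_space)
  finally have "distr \<mu> borel T' = \<nu>" using push by simp
  then show thesis using that[OF T'] T\<Omega> x0 by (simp add: T'_def)
qed

text \<open>By \<open>exists_transport\<close>, each source cell is mapped onto the share of
  \<open>\<nu>\<close> that the finite plan assigns to it. The potential \<open>v\<close> is a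
  Lipschitz envelope of the discrete dual solution, so only the discretisation and the relaxed dual
  constraint cause errors.\<close>

lemma approximately_optimal_transport_map:
  assumes \<Omega>: "compact \<Omega>" and \<mu>: "\<mu> \<in> prob_measures_on \<Omega>" and \<nu>: "\<nu> \<in> prob_measures_on \<Omega>"
    and ac: "\<And>A. A \<in> null_sets lborel \<Longrightarrow> emeasure \<mu> A = 0" and \<delta>: "0 < \<delta>"
  shows "\<exists>S v. transport_map \<Omega> \<mu> \<nu> S \<and> 1-lipschitz_on UNIV v \<and>
    (LINT x:\<Omega>|\<mu>. norm (x - S x)) \<le> (LINT x|\<mu>. v x) - (LINT x|\<nu>. v x) + \<delta>"
proof -
  note m = prob_measures_onD[OF \<mu>] and n = prob_measures_onD[OF \<nu>]
  interpret \<mu>: prob_space \<mu> by (rule m(1))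
  interpret \<nu>: prob_space \<nu> by (rule n(1))
  have \<Omega>b[measurable]: "\<Omega> \<in> sets borel" using compact_imp_closed[OF \<Omega>] by simp
  note [measurable_cong] = m(2) n(2)
  have AE\<mu>: "AE x in \<mu>. x \<in> \<Omega>" and AE\<nu>: "AE x in \<nu>. x \<in> \<Omega>"
    by (rule AE_in_domain[OF \<mu> \<Omega>b], rule AE_in_domain[OF \<nu> \<Omega>b])
  obtain x0 where x0: "x0 \<in> \<Omega>"
  proof -
    have "\<Omega> \<noteq> {}" using m(4) \<mu>.emeasure_space_1 m(3) by auto
    then show ?thesis using that by blast
  qed
  \<comment> \<open>Two of the five parts are lost in the lower bound of \<open>v\<close> on the
    source, one in its upper bound on the target, and two in replacing points by cell centres in the
    cost.\<close>
  define \<epsilon> where "\<epsilon> = \<delta> / 5"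
  have \<epsilon>: "0 < \<epsilon>" using \<delta> by (simp add: \<epsilon>_def)
  obtain K :: nat and c Q where c: "\<And>k. k < K \<Longrightarrow> c k \<in> \<Omega>" and Q[measurable]: "\<And>k. Q k \<in> sets borel"
    and cQ: "\<And>k x. x \<in> Q k \<Longrightarrow> dist (c k) x < \<epsilon>" and dj: "disjoint_family Q" and UQ: "(\<Union>k<K. Q k) = \<Omega>"
    by (rule compact_borel_partition[OF \<Omega> \<epsilon>]) (rule that)
  have Q_disj: "i = j" if "x \<in> Q i" "x \<in> Q j" for x i j
    using dj that by (auto simp: disjoint_family_on_def)
  define a where "a k = measure \<mu> (Q k)" for k
  define b where "b k = measure \<nu> (Q k)" for k
  \<comment> \<open>Cells of mass 0 are discarded, because the finite duality is stated for positive
    masses; the others still carry all the mass.\<close>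
  define I where "I = {k. k < K \<and> 0 < a k}"
  define J where "J = {k. k < K \<and> 0 < b k}"
  have fin: "finite I" "finite J" by (auto simp: I_def J_def)
  have apos: "0 < a i" if "i \<in> I" for i using that by (simp add: I_def)
  have bpos: "0 < b j" if "j \<in> J" for j using that by (simp add: J_def)
  have AEI: "AE x in \<mu>. \<exists>i\<in>I. x \<in> Q i"
  proof -
    have "AE x in \<mu>. \<forall>k\<in>{..<K} - I. x \<notin> Q k"
    proof (rule AE_finite_allI)
      fix k assume "k \<in> {..<K} - I"
      then have "measure \<mu> (Q k) = 0" using measure_nonneg[of \<mu> "Q k"] by (auto simp: I_def a_def)
      then show "AE x in \<mu>. x \<notin> Q k" by (simp add: \<mu>.prob_eq_0[symmetric] m(2) m(3))
    qed simp
    with AE\<mu> show ?thesis by eventually_elim (use UQ in blast)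
  qed
  have AEJ: "AE x in \<nu>. \<exists>j\<in>J. x \<in> Q j"
  proof -
    have "AE x in \<nu>. \<forall>k\<in>{..<K} - J. x \<notin> Q k"
    proof (rule AE_finite_allI)
      fix k assume "k \<in> {..<K} - J"
      then have "measure \<nu> (Q k) = 0" using measure_nonneg[of \<nu> "Q k"] by (auto simp: J_def b_def)
      then show "AE x in \<nu>. x \<notin> Q k" by (simp add: \<nu>.prob_eq_0[symmetric] n(2) n(3))
    qed simp
    with AE\<nu> show ?thesis by eventually_elim (use UQ in blast)
  qed
  have ind_sum: "(\<Sum>k\<in>L. t k * indicator (Q k) x) = t k" if "finite L" "k \<in> L" "x \<in> Q k" for L k x and t :: "nat \<Rightarrow> real"
  proof -
    have "(\<Sum>k\<in>L. t k * indicator (Q k) x) = (\<Sum>l\<in>L. if l = k then t k else 0)"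
      using that(3) Q_disj by (intro sum.cong) (auto simp: indicator_def)
    then show ?thesis using that by simp
  qed
  have sa: "(\<Sum>i\<in>I. a i) = 1"
  proof -
    have "(\<Sum>i\<in>I. a i) = measure \<mu> (\<Union>i\<in>I. Q i)"
      unfolding a_def using fin dj m(2)
      by (intro \<mu>.finite_measure_finite_Union[symmetric]) (auto simp: disjoint_family_on_def)
    also have "\<dots> = 1" using AEI by (subst \<mu>.prob_eq_1) (auto simp: m(2) fin intro!: sets.finite_UN)
    finally show ?thesis .
  qed
  have sb: "(\<Sum>j\<in>J. b j) = 1"
  proof -
    have "(\<Sum>j\<in>J. b j) = measure \<nu> (\<Union>j\<in>J. Q j)"
      unfolding b_def using fin dj n(2)
      by (intro \<nu>.finite_measure_finite_Union[symmetric]) (auto simp: disjoint_family_on_def)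
    also have "\<dots> = 1" using AEJ by (subst \<nu>.prob_eq_1) (auto simp: n(2) fin intro!: sets.finite_UN)
    finally show ?thesis .
  qed
  obtain \<gamma> p q where \<gamma>0: "\<And>i j. 0 \<le> \<gamma> i j"
    and row: "\<And>i. i \<in> I \<Longrightarrow> (\<Sum>j\<in>J. \<gamma> i j) = a i" and col: "\<And>j. j \<in> J \<Longrightarrow> (\<Sum>i\<in>I. \<gamma> i j) = b j"
    and feas: "\<And>i j. i \<in> I \<Longrightarrow> j \<in> J \<Longrightarrow> p i + q j \<le> dist (c i) (c j) + \<epsilon>"
    and cost: "(\<Sum>i\<in>I. \<Sum>j\<in>J. \<gamma> i j * dist (c i) (c j)) \<le> (\<Sum>i\<in>I. p i * a i) + (\<Sum>j\<in>J. q j * b j)"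
    by (rule finite_transport_duality[OF fin \<epsilon> apos bpos sa sb, of "\<lambda>i j. dist (c i) (c j)"])
      (assumption | rule zero_le_dist that)+
  have J_ne: "J \<noteq> {}" using sb by auto
  \<comment> \<open>A minimum of cones is 1-Lipschitz on the whole space. Up to multiples of
    \<epsilon> it is at least \<open>p i\<close> on \<open>Q i\<close> and at most
    \<open>- q j\<close> on \<open>Q j\<close>.\<close>
  define v where "v x = Min ((\<lambda>j. dist x (c j) - q j) ` J)" for x
  have v_le: "v x \<le> dist x (c j) - q j" if "j \<in> J" for x j
    unfolding v_def using fin that by (intro Min_le) auto
  have v_ge: "r \<le> v x" if "\<And>j. j \<in> J \<Longrightarrow> r \<le> dist x (c j) - q j" for r x
    unfolding v_def using fin J_ne that by (subst Min_ge_iff) auto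
  have v_lip: "1-lipschitz_on UNIV v"
  proof (rule lipschitz_onI)
    have "v x - dist x y \<le> v y" for x y
    proof (rule v_ge)
      fix j assume "j \<in> J"
      then show "v x - dist x y \<le> dist y (c j) - q j"
        using v_le[of j x] dist_triangle[of x "c j" y] by linarith
    qed
    from this this have "\<bar>v x - v y\<bar> \<le> dist x y" for x y
      by (smt (verit) dist_commute)
    then show "dist (v x) (v y) \<le> 1 * dist x y" for x y by (simp add: dist_real_def)
  qed simp
  have v_cont: "continuous_on UNIV v" by (rule lipschitz_on_continuous_on[OF v_lip])
  have v_meas[measurable]: "v \<in> borel_measurable borel" by (rule borel_measurable_continuous_onI[OF v_cont])
  obtain B where B: "\<And>x. x \<in> \<Omega> \<Longrightarrow> norm (v x) \<le> B"
    using compact_imp_bounded[OF compact_continuous_image[OF continuous_on_subset[OF v_cont subset_UNIV] \<Omega>]]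
    by (auto simp: bounded_iff)
  have v_int: "integrable \<mu> v" "integrable \<nu> v"
    using AE\<mu> AE\<nu> B by (auto intro!: \<mu>.integrable_const_bound[of _ B] \<nu>.integrable_const_bound[of _ B])
  have "(\<integral>x. - v x \<partial>\<mu>) \<le> (\<Sum>i\<in>I. (2 * \<epsilon> - p i) * measure \<mu> (Q i))"
  proof (rule measure_step_bound)
    show "AE x in \<mu>. - v x \<le> (\<Sum>i\<in>I. (2 * \<epsilon> - p i) * indicator (Q i) x)"
      using AEI
    proof eventually_elim
      case (elim x)
      then obtain i where i: "i \<in> I" "x \<in> Q i" by blast
      have "p i - 2 * \<epsilon> \<le> v x"
      proof (rule v_ge)
        fix j assume "j \<in> J"
        then show "p i - 2 * \<epsilon> \<le> dist x (c j) - q j"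
          using feas[OF i(1)] cQ[OF i(2)] dist_triangle[of "c i" "c j" x] by fastforce
      qed
      then show ?case using ind_sum[OF fin(1) i, of "\<lambda>i. 2 * \<epsilon> - p i"] by simp
    qed
  qed (use v_int fin m(2) \<mu>.finite_measure_axioms in auto)
  moreover have "(\<integral>x. v x \<partial>\<nu>) \<le> (\<Sum>j\<in>J. (\<epsilon> - q j) * measure \<nu> (Q j))"
  proof (rule measure_step_bound)
    show "AE x in \<nu>. v x \<le> (\<Sum>j\<in>J. (\<epsilon> - q j) * indicator (Q j) x)"
      using AEJ
    proof eventually_elim
      case (elim x)
      then obtain j where j: "j \<in> J" "x \<in> Q j" by blast
      have "v x \<le> \<epsilon> - q j" using v_le[OF j(1), of x] cQ[OF j(2)] by (simp add: dist_commute)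
      then show ?case using ind_sum[OF fin(2) j, of "\<lambda>j. \<epsilon> - q j"] by simp
    qed
  qed (use v_int fin n(2) \<nu>.finite_measure_axioms in auto)
  moreover have "(\<Sum>i\<in>I. (2 * \<epsilon> - p i) * measure \<mu> (Q i)) = 2 * \<epsilon> - (\<Sum>i\<in>I. p i * a i)"
    using sa by (simp add: a_def left_diff_distrib sum_subtractf flip: sum_distrib_left)
  moreover have "(\<Sum>j\<in>J. (\<epsilon> - q j) * measure \<nu> (Q j)) = \<epsilon> - (\<Sum>j\<in>J. q j * b j)"
    using sb by (simp add: b_def left_diff_distrib sum_subtractf flip: sum_distrib_left)
  ultimately have dual: "(\<Sum>i\<in>I. \<Sum>j\<in>J. \<gamma> i j * dist (c i) (c j)) \<le> (\<integral>x. v x \<partial>\<mu>) - (\<integral>x. v x \<partial>\<nu>) + 3 * \<epsilon>"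
    using cost by simp
  have \<nu>_split: "measure \<nu> A = (\<Sum>j\<in>J. measure \<nu> (Q j \<inter> A))" if A: "A \<in> sets borel" for A
  proof -
    have "measure \<nu> A = measure \<nu> (\<Union>j\<in>J. Q j \<inter> A)"
      using AEJ A fin by (intro measure_eq_AE) (auto simp: n(2) intro!: sets.finite_UN)
    also have "\<dots> = (\<Sum>j\<in>J. measure \<nu> (Q j \<inter> A))"
      using fin dj n(2) A by (intro \<nu>.finite_measure_finite_Union) (auto simp: disjoint_family_on_def)
    finally show ?thesis .
  qed
  have ex_s: "\<exists>s. s \<in> borel_measurable borel \<and> (\<forall>A\<in>sets borel.
      measure \<mu> (Q i \<inter> s -` A) = (\<Sum>j\<in>J. \<gamma> i j / b j * measure \<nu> (Q j \<inter> A)))" if i: "i \<in> I" for i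
  proof -
    have ai: "0 < a i" by (rule apos[OF i])
    define Mi where "Mi = uniform_measure \<mu> (Q i)"
    \<comment> \<open>With this density, \<open>Ni\<close> distributes row \<open>i\<close> of the
      plan in proportion to \<open>\<nu>\<close>: cell \<open>Q j\<close> receives the mass
      \<open>\<gamma> i j / a i\<close>.\<close>
    define d where "d y = (\<Sum>j\<in>J. \<gamma> i j / (a i * b j) * indicator (Q j) y)" for y
    define Ni where "Ni = density \<nu> (\<lambda>y. ennreal (d y))"
    have d0: "0 \<le> d y" for y unfolding d_def using \<gamma>0 ai bpos by (intro sum_nonneg) (simp add: less_imp_le)
    have [measurable]: "d \<in> borel_measurable borel" unfolding d_def by measurable
    have eQ: "emeasure \<mu> (Q i) = ennreal (a i)" by (simp add: a_def \<mu>.emeasure_eq_measure)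
    have pM: "prob_space Mi" unfolding Mi_def using ai by (intro prob_space_uniform_measure) (simp_all add: eQ)
    have sM: "sets Mi = sets borel" by (simp add: Mi_def m(2))
    have sN: "sets Ni = sets borel" by (simp add: Ni_def n(2))
    have eN: "emeasure Ni A = ennreal (\<Sum>j\<in>J. \<gamma> i j / (a i * b j) * measure \<nu> (Q j \<inter> A))" if A[measurable]: "A \<in> sets borel" for A
    proof -
      have i1: "integrable \<nu> (\<lambda>y. \<gamma> i j / (a i * b j) * indicator (Q j \<inter> A) y)" for j
        by (intro integrable_mult_right integrable_real_indicator) (simp_all add: \<nu>.emeasure_eq_measure)
      have i2: "integrable \<nu> (\<lambda>y. d y * indicator A y)"
      proof -
        have "(\<lambda>y. d y * indicator A y) = (\<lambda>y. \<Sum>j\<in>J. \<gamma> i j / (a i * b j) * indicator (Q j \<inter> A) y)"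
          by (simp add: d_def sum_distrib_right indicator_inter_arith mult.assoc)
        then show ?thesis using i1 by simp
      qed
      have "emeasure Ni A = (\<integral>\<^sup>+y. ennreal (d y * indicator A y) \<partial>\<nu>)"
        unfolding Ni_def by (subst emeasure_density) (auto simp: indicator_def intro!: nn_integral_cong)
      also have "\<dots> = ennreal (\<integral>y. d y * indicator A y \<partial>\<nu>)"
        using d0 by (intro nn_integral_eq_integral i2) auto
      also have "(\<integral>y. d y * indicator A y \<partial>\<nu>) = (\<integral>y. (\<Sum>j\<in>J. \<gamma> i j / (a i * b j) * indicator (Q j \<inter> A) y) \<partial>\<nu>)"
        by (simp add: d_def sum_distrib_right indicator_inter_arith mult.assoc)
      also have "\<dots> = (\<Sum>j\<in>J. \<integral>y. \<gamma> i j / (a i * b j) * indicator (Q j \<inter> A) y \<partial>\<nu>)"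
        by (rule Bochner_Integration.integral_sum) (rule i1)
      also have "\<dots> = (\<Sum>j\<in>J. \<gamma> i j / (a i * b j) * measure \<nu> (Q j \<inter> A))"
        by (intro sum.cong refl) (simp add: n(3))
      finally show ?thesis .
    qed
    have pN: "prob_space Ni"
    proof (rule prob_spaceI)
      have "(\<Sum>j\<in>J. \<gamma> i j / (a i * b j) * measure \<nu> (Q j \<inter> UNIV)) = (\<Sum>j\<in>J. \<gamma> i j / a i)"
      proof (rule sum.cong[OF refl])
        fix j assume "j \<in> J"
        from bpos[OF this] show "\<gamma> i j / (a i * b j) * measure \<nu> (Q j \<inter> UNIV) = \<gamma> i j / a i"
          by (simp flip: b_def)
      qed
      also have "\<dots> = 1" using row[OF i] ai by (simp flip: sum_divide_distrib)
      finally have "emeasure Ni UNIV = 1" using eN[of UNIV] by simp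
      moreover have "space Ni = UNIV" by (simp add: Ni_def n(3))
      ultimately show "emeasure Ni (space Ni) = 1" by simp
    qed
    have "emeasure Mi A = 0" if A: "A \<in> null_sets lborel" for A
    proof -
      have Ab: "A \<in> sets borel" using A by auto
      have "emeasure \<mu> (Q i \<inter> A) \<le> emeasure \<mu> A" using Ab by (intro emeasure_mono) (auto simp: m(2))
      then have "emeasure \<mu> (Q i \<inter> A) = 0" using ac[OF A] by simp
      then show ?thesis using Ab m(2) unfolding Mi_def by (subst emeasure_uniform_measure) auto
    qed
    then obtain s where s: "s \<in> borel_measurable borel" and sd: "distr Mi borel s = Ni"
      using exists_transport[OF pM sM pN sN] by metis
    have "measure \<mu> (Q i \<inter> s -` A) = (\<Sum>j\<in>J. \<gamma> i j / b j * measure \<nu> (Q j \<inter> A))" if A: "A \<in> sets borel" for A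
    proof -
      have sA: "s -` A \<in> sets borel" by (rule measurable_sets_borel[OF s A])
      have "s \<in> borel_measurable Mi" using s sM by (simp cong: measurable_cong_sets)
      moreover have "space Mi = UNIV" by (simp add: Mi_def m(3))
      ultimately have "emeasure Ni A = emeasure Mi (s -` A)"
        unfolding sd[symmetric] using A by (simp add: emeasure_distr)
      also have "\<dots> = emeasure \<mu> (Q i \<inter> s -` A) / ennreal (a i)"
        unfolding Mi_def eQ[symmetric] using sA m(2) by (intro emeasure_uniform_measure) auto
      also have "\<dots> = ennreal (measure \<mu> (Q i \<inter> s -` A) / a i)"
        using ai by (simp add: \<mu>.emeasure_eq_measure divide_ennreal)
      finally have "measure \<mu> (Q i \<inter> s -` A) / a i = (\<Sum>j\<in>J. \<gamma> i j / (a i * b j) * measure \<nu> (Q j \<inter> A))"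
        unfolding eN[OF A] using ai \<gamma>0 bpos
        by (subst (asm) ennreal_inj) (auto intro!: sum_nonneg mult_nonneg_nonneg divide_nonneg_nonneg simp: less_imp_le)
      then have "measure \<mu> (Q i \<inter> s -` A) = a i * (\<Sum>j\<in>J. \<gamma> i j / (a i * b j) * measure \<nu> (Q j \<inter> A))"
        using ai by (simp add: field_simps)
      then show ?thesis using ai by (simp add: sum_distrib_left)
    qed
    then show ?thesis using s by blast
  qed
  have "\<exists>s. \<forall>i\<in>I. s i \<in> borel_measurable borel \<and> (\<forall>A\<in>sets borel.
      measure \<mu> (Q i \<inter> s i -` A) = (\<Sum>j\<in>J. \<gamma> i j / b j * measure \<nu> (Q j \<inter> A)))"
    by (intro bchoice ballI ex_s)
  then obtain s where s': "\<forall>i\<in>I. s i \<in> borel_measurable borel \<and> (\<forall>A\<in>sets borel.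
      measure \<mu> (Q i \<inter> s i -` A) = (\<Sum>j\<in>J. \<gamma> i j / b j * measure \<nu> (Q j \<inter> A)))"
    by (elim exE)
  have s: "s i \<in> borel_measurable borel" if "i \<in> I" for i using s' that by simp
  have sm: "measure \<mu> (Q i \<inter> s i -` A) = (\<Sum>j\<in>J. \<gamma> i j / b j * measure \<nu> (Q j \<inter> A))"
    if "i \<in> I" "A \<in> sets borel" for i A using s' that by simp
  \<comment> \<open>Points of the cell that \<open>s i\<close> sends outside \<open>\<Omega>\<close>
    form a null set; they are dropped here and sent to \<open>x0\<close>, so that \<open>S\<close>
    takes values in \<open>\<Omega>\<close> everywhere.\<close>
  define R where "R i = Q i \<inter> s i -` \<Omega>" for i
  have sA: "s i -` A \<in> sets borel" if "i \<in> I" "A \<in> sets borel" for i A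
    by (rule measurable_sets_borel[OF s[OF that(1)] that(2)])
  have R: "R i \<in> sets borel" if "i \<in> I" for i using sA[OF that \<Omega>b] by (simp add: R_def)
  have R_disj: "i = j" if "x \<in> R i" "x \<in> R j" for x i j using Q_disj that by (auto simp: R_def)
  define S where "S x = (\<Sum>i\<in>I. indicator (R i) x *\<^sub>R s i x) + (1 - indicator (\<Union>i\<in>I. R i) x) *\<^sub>R x0" for x
  have UR: "(\<Union>i\<in>I. R i) \<in> sets borel" using R fin by (intro sets.finite_UN) auto
  have S_meas: "S \<in> borel_measurable borel"
    unfolding S_def
    by (intro borel_measurable_add borel_measurable_sum borel_measurable_scaleR borel_measurable_diff
        borel_measurable_indicator R UR s borel_measurable_const)
  have S_R: "S x = s i x" if i: "i \<in> I" "x \<in> R i" for i x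
  proof -
    have "(\<Sum>k\<in>I. indicator (R k) x *\<^sub>R s k x) = (\<Sum>k\<in>I. if k = i then s i x else 0)"
      using i(2) R_disj by (intro sum.cong) (auto simp: indicator_def)
    then show ?thesis using i fin by (auto simp: S_def indicator_def)
  qed
  have S_\<Omega>: "S x \<in> \<Omega>" for x
  proof (cases "\<exists>i\<in>I. x \<in> R i")
    case True
    then obtain i where i: "i \<in> I" "x \<in> R i" by blast
    then show ?thesis using S_R[OF i] by (simp add: R_def)
  next
    case False
    then have "S x = x0" by (simp add: S_def)
    then show ?thesis using x0 by simp
  qed
  have QJ\<Omega>: "Q j \<inter> \<Omega> \<inter> A = Q j \<inter> A" if "j \<in> J" for j A using that UQ by (auto simp: J_def)
  have sR: "measure \<mu> (R i \<inter> s i -` A) = (\<Sum>j\<in>J. \<gamma> i j / b j * measure \<nu> (Q j \<inter> A))"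
    if i: "i \<in> I" and A: "A \<in> sets borel" for i A
  proof -
    have "R i \<inter> s i -` A = Q i \<inter> s i -` (\<Omega> \<inter> A)" by (auto simp: R_def)
    then show ?thesis using sm[OF i, of "\<Omega> \<inter> A"] A QJ\<Omega> by (simp add: Int_assoc)
  qed
  have sum_sR: "(\<Sum>i\<in>I. measure \<mu> (R i \<inter> s i -` A)) = measure \<nu> A" if A: "A \<in> sets borel" for A
  proof -
    have "(\<Sum>i\<in>I. measure \<mu> (R i \<inter> s i -` A)) = (\<Sum>i\<in>I. \<Sum>j\<in>J. \<gamma> i j / b j * measure \<nu> (Q j \<inter> A))"
      by (intro sum.cong refl sR A)
    also have "\<dots> = (\<Sum>j\<in>J. (\<Sum>i\<in>I. \<gamma> i j) / b j * measure \<nu> (Q j \<inter> A))"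
      by (subst sum.swap) (simp add: sum_distrib_right sum_divide_distrib)
    also have "\<dots> = (\<Sum>j\<in>J. measure \<nu> (Q j \<inter> A))"
      using col bpos by (intro sum.cong) (auto simp: less_imp_neq[symmetric])
    finally show ?thesis using \<nu>_split[OF A] by simp
  qed
  have AER: "AE x in \<mu>. \<exists>i\<in>I. x \<in> R i"
  proof -
    have "measure \<mu> (\<Union>i\<in>I. R i) = (\<Sum>i\<in>I. measure \<mu> (R i))"
      using fin R R_disj m(2) by (intro \<mu>.finite_measure_finite_Union) (auto simp: disjoint_family_on_def)
    also have "\<dots> = 1" using sum_sR[of UNIV] \<nu>.prob_space n(3) by simp
    finally have "AE x in \<mu>. x \<in> (\<Union>i\<in>I. R i)" using UR m(2) by (subst (asm) \<mu>.prob_eq_1) auto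
    then show ?thesis by eventually_elim blast
  qed
  have S\<mu>: "S \<in> borel_measurable \<mu>" using S_meas m(2) by (simp cong: measurable_cong_sets)
  have push: "distr \<mu> borel S = \<nu>"
  proof (rule measure_eqI)
    fix A assume "A \<in> sets (distr \<mu> borel S)"
    then have A: "A \<in> sets borel" by simp
    have SA: "S -` A \<in> sets borel" by (rule measurable_sets_borel[OF S_meas A])
    have "measure \<mu> (S -` A) = measure \<mu> (\<Union>i\<in>I. R i \<inter> s i -` A)"
    proof (rule measure_eq_AE)
      show "AE x in \<mu>. (x \<in> S -` A) = (x \<in> (\<Union>i\<in>I. R i \<inter> s i -` A))"
        using AER
      proof eventually_elim
        case (elim x)
        then obtain i where i: "i \<in> I" "x \<in> R i" by blast
        have "x \<in> (\<Union>i\<in>I. R i \<inter> s i -` A) \<longleftrightarrow> s i x \<in> A" using i R_disj by blast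
        then show ?case using S_R[OF i] by simp
      qed
    qed (use SA m(2) R sA[OF _ A] fin in \<open>auto intro!: sets.finite_UN\<close>)
    also have "\<dots> = (\<Sum>i\<in>I. measure \<mu> (R i \<inter> s i -` A))"
      using fin R R_disj sA[OF _ A] m(2)
      by (intro \<mu>.finite_measure_finite_Union) (auto simp: disjoint_family_on_def)
    also have "\<dots> = measure \<nu> A" by (rule sum_sR[OF A])
    finally have "emeasure \<mu> (S -` A) = emeasure \<nu> A"
      by (simp add: \<mu>.emeasure_eq_measure \<nu>.emeasure_eq_measure)
    then show "emeasure (distr \<mu> borel S) A = emeasure \<nu> A"
      using S\<mu> A m(3) by (simp add: emeasure_distr)
  qed (simp add: n(2))
  have AESJ: "AE x in \<mu>. \<exists>j\<in>J. S x \<in> Q j"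
    by (rule AE_distrD[OF S\<mu>]) (unfold push, rule AEJ)
  \<comment> \<open>This makes the cost of \<open>S\<close> that of the finite plan, up to the size
    of the cells.\<close>
  have mQ: "measure \<mu> (Q i \<inter> S -` Q j) = \<gamma> i j" if i: "i \<in> I" and j: "j \<in> J" for i j
  proof -
    have "measure \<mu> (Q i \<inter> S -` Q j) = measure \<mu> (R i \<inter> s i -` Q j)"
    proof (rule measure_eq_AE)
      show "AE x in \<mu>. (x \<in> Q i \<inter> S -` Q j) = (x \<in> R i \<inter> s i -` Q j)"
        using AER
      proof eventually_elim
        case (elim x)
        then obtain k where k: "k \<in> I" "x \<in> R k" by blast
        have "x \<in> Q i \<longleftrightarrow> k = i" using k(2) Q_disj[of x i k] by (auto simp: R_def)
        moreover have "x \<in> R i \<longleftrightarrow> k = i" using k(2) R_disj by blast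
        ultimately show ?case using S_R[OF k] by auto
      qed
    qed (use measurable_sets_borel[OF S_meas Q] R[OF i] sA[OF i Q] m(2) in auto)
    also have "\<dots> = (\<Sum>k\<in>J. \<gamma> i k / b k * measure \<nu> (Q k \<inter> Q j))" by (rule sR[OF i Q])
    also have "\<dots> = (\<Sum>k\<in>J. if k = j then \<gamma> i j else 0)"
    proof (rule sum.cong[OF refl])
      fix k assume "k \<in> J"
      show "\<gamma> i k / b k * measure \<nu> (Q k \<inter> Q j) = (if k = j then \<gamma> i j else 0)"
      proof (cases "k = j")
        case True
        then show ?thesis using bpos[OF j] by (simp add: b_def)
      next
        case False
        then have "Q k \<inter> Q j = {}" using Q_disj by blast
        then show ?thesis using False by simp
      qed
    qed
    also have "\<dots> = \<gamma> i j" using fin j by simp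
    finally show ?thesis .
  qed
  obtain D where D: "\<And>x. x \<in> \<Omega> \<Longrightarrow> norm x \<le> D"
    using compact_imp_bounded[OF \<Omega>] by (auto simp: bounded_iff)
  have f_int: "integrable \<mu> (\<lambda>x. indicator \<Omega> x *\<^sub>R norm (x - S x))"
  proof (rule \<mu>.integrable_const_bound)
    show "AE x in \<mu>. norm (indicator \<Omega> x *\<^sub>R norm (x - S x)) \<le> 2 * D"
      using AE\<mu>
    proof eventually_elim
      case (elim x)
      then show ?case
        using norm_triangle_ineq4[of x "S x"] D[OF elim] D[OF S_\<Omega>, of x] by simp
    qed
    show "(\<lambda>x. indicator \<Omega> x *\<^sub>R norm (x - S x)) \<in> borel_measurable \<mu>"
      using S\<mu> by measurable
  qed
  have "(\<integral>x. indicator \<Omega> x *\<^sub>R norm (x - S x) \<partial>\<mu>)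
      \<le> (\<Sum>z\<in>I \<times> J. (dist (c (fst z)) (c (snd z)) + 2 * \<epsilon>) * measure \<mu> (Q (fst z) \<inter> S -` Q (snd z)))"
  proof (rule measure_step_bound[OF \<mu>.finite_measure_axioms f_int])
    show "Q (fst z) \<inter> S -` Q (snd z) \<in> sets \<mu>" for z
      using measurable_sets_borel[OF S_meas Q] m(2) by auto
    show "AE x in \<mu>. indicator \<Omega> x *\<^sub>R norm (x - S x)
      \<le> (\<Sum>z\<in>I \<times> J. (dist (c (fst z)) (c (snd z)) + 2 * \<epsilon>) * indicator (Q (fst z) \<inter> S -` Q (snd z)) x)"
      using AEI AESJ
    proof eventually_elim
      case (elim x)
      then obtain i j where ij: "i \<in> I" "x \<in> Q i" "j \<in> J" "S x \<in> Q j" by blast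
      have "indicator \<Omega> x *\<^sub>R norm (x - S x) \<le> dist x (S x)" by (simp add: indicator_def dist_norm)
      also have "\<dots> \<le> dist (c i) (c j) + 2 * \<epsilon>"
        using cQ[OF ij(2)] cQ[OF ij(4)] dist_triangle[of x "S x" "c i"] dist_triangle[of "c i" "S x" "c j"]
        by (simp add: dist_commute)
      also have "\<dots> = (\<lambda>z. (dist (c (fst z)) (c (snd z)) + 2 * \<epsilon>) * indicator (Q (fst z) \<inter> S -` Q (snd z)) x) (i, j)"
        using ij by simp
      also have "\<dots> \<le> (\<Sum>z\<in>I \<times> J. (dist (c (fst z)) (c (snd z)) + 2 * \<epsilon>) * indicator (Q (fst z) \<inter> S -` Q (snd z)) x)"
        using ij fin \<epsilon> by (intro member_le_sum) auto
      finally show ?case .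
    qed
  qed (use fin in auto)
  also have "\<dots> = (\<Sum>i\<in>I. \<Sum>j\<in>J. (dist (c i) (c j) + 2 * \<epsilon>) * \<gamma> i j)"
    unfolding sum.cartesian_product by (intro sum.cong) (auto simp: mQ)
  also have "\<dots> = (\<Sum>i\<in>I. \<Sum>j\<in>J. \<gamma> i j * dist (c i) (c j)) + 2 * \<epsilon> * (\<Sum>i\<in>I. \<Sum>j\<in>J. \<gamma> i j)"
    unfolding sum_distrib_left sum.distrib[symmetric] by (intro sum.cong refl) (simp add: algebra_simps)
  also have "(\<Sum>i\<in>I. \<Sum>j\<in>J. \<gamma> i j) = 1" using row sa by simp
  finally have "(LINT x:\<Omega>|\<mu>. norm (x - S x)) \<le> (\<integral>x. v x \<partial>\<mu>) - (\<integral>x. v x \<partial>\<nu>) + \<delta>"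
    using dual unfolding set_lebesgue_integral_def \<epsilon>_def by simp
  moreover have "transport_map \<Omega> \<mu> \<nu> S" by (rule transport_mapI[OF \<mu> \<Omega>b S_meas S_\<Omega> push])
  ultimately show ?thesis using v_lip by blast
qed

section \<open>Duality for the Wasserstein distance\<close>

lemma integrable_bounded_on_domain:
  fixes F :: "'a::euclidean_space \<Rightarrow> real"
  assumes \<mu>: "\<mu> \<in> prob_measures_on \<Omega>" and \<Omega>: "\<Omega> \<in> sets borel" and F: "F \<in> borel_measurable borel"
    and B: "\<And>x. x \<in> \<Omega> \<Longrightarrow> \<bar>F x\<bar> \<le> B"
  shows "integrable \<mu> F"
proof -
  note p = prob_measures_onD[OF \<mu>]
  interpret prob_space \<mu> by (rule p(1))
  show ?thesis
  proof (rule integrable_const_bound)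
    show "AE x in \<mu>. norm (F x) \<le> B" using AE_in_domain[OF \<mu> \<Omega>] by eventually_elim (use B in simp)
    show "F \<in> borel_measurable \<mu>" using F p(2) by (simp cong: measurable_cong_sets)
  qed
qed

lemma set_integral_eq_integral:
  fixes F G :: "'a::euclidean_space \<Rightarrow> real"
  assumes \<mu>: "\<mu> \<in> prob_measures_on \<Omega>" and \<Omega>: "\<Omega> \<in> sets borel" and F: "F \<in> borel_measurable borel"
    and eq: "\<And>x. x \<in> \<Omega> \<Longrightarrow> G x = F x"
  shows "(LINT x:\<Omega>|\<mu>. G x) = (LINT x|\<mu>. F x)"
proof -
  note p = prob_measures_onD[OF \<mu>]
  have F\<mu>: "F \<in> borel_measurable \<mu>" using F p(2) by (simp cong: measurable_cong_sets)
  have "(\<lambda>x. indicator \<Omega> x *\<^sub>R G x) = (\<lambda>x. indicator \<Omega> x *\<^sub>R F x)"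
    using eq by (auto simp: indicator_def)
  moreover have "(\<integral>x. indicator \<Omega> x *\<^sub>R F x \<partial>\<mu>) = (\<integral>x. F x \<partial>\<mu>)"
  proof (rule integral_cong_AE)
    show "AE x in \<mu>. indicator \<Omega> x *\<^sub>R F x = F x" using AE_in_domain[OF \<mu> \<Omega>] by eventually_elim simp
    show "(\<lambda>x. indicator \<Omega> x *\<^sub>R F x) \<in> borel_measurable \<mu>" using F\<mu> \<Omega> p(2) by auto
  qed (rule F\<mu>)
  ultimately show ?thesis by (simp add: set_lebesgue_integral_def)
qed

lemma lipschitz_bounded_on_compact:
  fixes V :: "'a::euclidean_space \<Rightarrow> real"
  assumes "1-lipschitz_on UNIV V" "compact \<Omega>"
  obtains B where "\<And>x. x \<in> \<Omega> \<Longrightarrow> \<bar>V x\<bar> \<le> B"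
proof -
  have "compact (V ` \<Omega>)"
    using lipschitz_on_continuous_on[OF assms(1)] assms(2) by (intro compact_continuous_image) (auto intro: continuous_on_subset)
  then show thesis using that by (force dest: compact_imp_bounded simp: bounded_iff)
qed

lemma lipschitz_integrable:
  fixes V :: "'a::euclidean_space \<Rightarrow> real"
  assumes V: "1-lipschitz_on UNIV V" and \<Omega>: "compact \<Omega>" and \<mu>: "\<mu> \<in> prob_measures_on \<Omega>"
  shows "integrable \<mu> V"
proof -
  obtain B where B: "\<And>x. x \<in> \<Omega> \<Longrightarrow> \<bar>V x\<bar> \<le> B" by (rule lipschitz_bounded_on_compact[OF V \<Omega>]) (rule that)
  show ?thesis
    by (rule integrable_bounded_on_domain[OF \<mu> _ _ B])
      (use compact_imp_closed[OF \<Omega>] borel_measurable_continuous_onI[OF lipschitz_on_continuous_on[OF V]] in auto)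
qed

text \<open>
  Weak duality for a pair of maps \<open>h\<close>, \<open>k\<close> on a common probability space, i.e. for the coupling
  that is the law of \<open>(h, k)\<close>.
\<close>

context
  fixes \<Omega> :: "'a::euclidean_space set" and M \<alpha> \<beta> :: "'a measure" and h k :: "'a \<Rightarrow> 'a"
  assumes \<Omega>: "compact \<Omega>" and M: "prob_space M" "sets M = sets borel"
    and \<alpha>: "\<alpha> \<in> prob_measures_on \<Omega>" and \<beta>: "\<beta> \<in> prob_measures_on \<Omega>"
    and h: "h \<in> borel_measurable borel" "distr M borel h = \<alpha>"
    and k: "k \<in> borel_measurable borel" "distr M borel k = \<beta>"
begin

lemma domain_borel: "\<Omega> \<in> sets borel"
  using compact_imp_closed[OF \<Omega>] by simp

lemma pair_measurable: "h \<in> borel_measurable M" "k \<in> borel_measurable M"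
  using h(1) k(1) M(2) by (simp_all cong: measurable_cong_sets)

lemma pair_AE: "AE x in M. h x \<in> \<Omega> \<and> k x \<in> \<Omega>"
proof -
  have "AE x in M. h x \<in> \<Omega>"
    by (rule AE_distrD[OF pair_measurable(1)]) (unfold h(2), rule AE_in_domain[OF \<alpha> domain_borel])
  moreover have "AE x in M. k x \<in> \<Omega>"
    by (rule AE_distrD[OF pair_measurable(2)]) (unfold k(2), rule AE_in_domain[OF \<beta> domain_borel])
  ultimately show ?thesis by eventually_elim simp
qed

lemma pair_cost_integrable: "integrable M (\<lambda>x. norm (h x - k x))"
proof -
  interpret prob_space M by (rule M)
  obtain D where D: "\<And>x. x \<in> \<Omega> \<Longrightarrow> norm x \<le> D"
    using compact_imp_bounded[OF \<Omega>] by (auto simp: bounded_iff)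
  show ?thesis
  proof (rule integrable_const_bound)
    show "AE x in M. norm (norm (h x - k x)) \<le> 2 * D"
      using pair_AE
    proof eventually_elim
      case (elim x)
      then show ?case using norm_triangle_ineq4[of "h x" "k x"] D[of "h x"] D[of "k x"] by simp
    qed
  qed (use pair_measurable in measurable)
qed

lemma pair_dual:
  assumes V: "1-lipschitz_on UNIV V"
  shows "integrable M (\<lambda>x. V (h x) - V (k x))"
    and "(LINT x|\<alpha>. V x) - (LINT x|\<beta>. V x) = (LINT x|M. V (h x) - V (k x))"
    and "(LINT x|\<alpha>. V x) - (LINT x|\<beta>. V x) \<le> (LINT x|M. norm (h x - k x))"
proof -
  have Vb: "V \<in> borel_measurable borel"
    by (rule borel_measurable_continuous_onI[OF lipschitz_on_continuous_on[OF V]])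
  have "integrable \<alpha> V" "integrable \<beta> V" by (rule lipschitz_integrable[OF V \<Omega>], fact \<alpha>, rule lipschitz_integrable[OF V \<Omega>], fact \<beta>)
  then have i: "integrable M (\<lambda>x. V (h x))" "integrable M (\<lambda>x. V (k x))"
    unfolding h(2)[symmetric] k(2)[symmetric] using Vb pair_measurable by (simp_all add: integrable_distr_eq)
  then show 1: "integrable M (\<lambda>x. V (h x) - V (k x))" by (rule Bochner_Integration.integrable_diff)
  have "(LINT x|\<alpha>. V x) = (LINT x|M. V (h x))" "(LINT x|\<beta>. V x) = (LINT x|M. V (k x))"
    unfolding h(2)[symmetric] k(2)[symmetric] using Vb pair_measurable by (simp_all add: integral_distr)
  then show 2: "(LINT x|\<alpha>. V x) - (LINT x|\<beta>. V x) = (LINT x|M. V (h x) - V (k x))"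
    using i by simp
  have "V (h x) - V (k x) \<le> norm (h x - k x)" for x
    using lipschitz_onD[OF V, of "h x" "k x"] by (simp add: dist_norm dist_real_def)
  then show "(LINT x|\<alpha>. V x) - (LINT x|\<beta>. V x) \<le> (LINT x|M. norm (h x - k x))"
    unfolding 2 by (intro integral_mono 1 pair_cost_integrable)
qed

end

lemma coupling_cost_ge:
  assumes \<Omega>: "compact \<Omega>" and \<alpha>: "\<alpha> \<in> prob_measures_on \<Omega>" and \<beta>: "\<beta> \<in> prob_measures_on \<Omega>"
    and \<gamma>: "\<gamma> \<in> couplings \<Omega> \<alpha> \<beta>" and V: "1-lipschitz_on UNIV V"
  shows "(LINT x|\<alpha>. V x) - (LINT x|\<beta>. V x) \<le> (LINT z:\<Omega> \<times> \<Omega>|\<gamma>. norm (fst z - snd z))"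
proof -
  have \<gamma>p: "\<gamma> \<in> prob_measures_on (\<Omega> \<times> \<Omega>)" and marg: "distr \<gamma> borel fst = \<alpha>" "distr \<gamma> borel snd = \<beta>"
    using \<gamma> by (auto simp: couplings_def)
  note p = prob_measures_onD[OF \<gamma>p]
  have \<Omega>2: "\<Omega> \<times> \<Omega> \<in> sets borel" using compact_imp_closed[OF \<Omega>] by (intro borel_closed closed_Times)
  have ms: "fst \<in> borel_measurable \<gamma>" "snd \<in> borel_measurable \<gamma>"
    using p(2) by (simp_all cong: measurable_cong_sets) (auto intro!: borel_measurable_continuous_onI continuous_intros)
  have Vb: "V \<in> borel_measurable borel"
    by (rule borel_measurable_continuous_onI[OF lipschitz_on_continuous_on[OF V]])
  have "integrable \<alpha> V" "integrable \<beta> V" by (rule lipschitz_integrable[OF V \<Omega> \<alpha>], rule lipschitz_integrable[OF V \<Omega> \<beta>])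
  then have i: "integrable \<gamma> (\<lambda>z. V (fst z))" "integrable \<gamma> (\<lambda>z. V (snd z))"
    unfolding marg[symmetric] using Vb ms by (simp_all add: integrable_distr_eq)
  have e: "(LINT x|\<alpha>. V x) = (LINT z|\<gamma>. V (fst z))" "(LINT x|\<beta>. V x) = (LINT z|\<gamma>. V (snd z))"
    unfolding marg[symmetric] using Vb ms by (simp_all add: integral_distr)
  have nb: "(\<lambda>z::'a \<times> 'a. norm (fst z - snd z)) \<in> borel_measurable borel"
    by (intro borel_measurable_continuous_onI continuous_intros)
  obtain D where D: "\<And>x. x \<in> \<Omega> \<Longrightarrow> norm x \<le> D"
    using compact_imp_bounded[OF \<Omega>] by (auto simp: bounded_iff)
  have ni: "integrable \<gamma> (\<lambda>z. norm (fst z - snd z))"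
  proof (rule integrable_bounded_on_domain[OF \<gamma>p \<Omega>2 nb])
    fix z assume "z \<in> \<Omega> \<times> \<Omega>"
    then show "\<bar>norm (fst z - snd z)\<bar> \<le> 2 * D"
      using norm_triangle_ineq4[of "fst z" "snd z"] D[of "fst z"] D[of "snd z"] by auto
  qed
  have "(LINT x|\<alpha>. V x) - (LINT x|\<beta>. V x) = (LINT z|\<gamma>. V (fst z) - V (snd z))"
    using i by (simp add: e)
  also have "\<dots> \<le> (LINT z|\<gamma>. norm (fst z - snd z))"
  proof (rule integral_mono)
    show "V (fst z) - V (snd z) \<le> norm (fst z - snd z)" for z
      using lipschitz_onD[OF V, of "fst z" "snd z"] by (simp add: dist_norm dist_real_def)
  qed (use i ni in auto)
  also have "\<dots> = (LINT z:\<Omega> \<times> \<Omega>|\<gamma>. norm (fst z - snd z))"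
    by (rule set_integral_eq_integral[OF \<gamma>p \<Omega>2 nb, symmetric]) simp
  finally show ?thesis .
qed

text \<open>The law of \<open>(h, k)\<close> is a coupling attaining the lower bound given by
  \<open>V\<close>. A common source space lets the same \<open>T\<close> serve both distances:
  paired with the identity for \<open>\<mu>\<close>, and with \<open>f0\<close> for the image
  measure.\<close>

lemma W1_eq_dual:
  fixes M \<alpha> \<beta> :: "'a::euclidean_space measure"
  assumes \<Omega>: "compact \<Omega>" and M: "prob_space M" "sets M = sets borel"
    and \<alpha>: "\<alpha> \<in> prob_measures_on \<Omega>" and \<beta>: "\<beta> \<in> prob_measures_on \<Omega>"
    and h: "h \<in> borel_measurable borel" "distr M borel h = \<alpha>"
    and k: "k \<in> borel_measurable borel" "distr M borel k = \<beta>"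
    and V: "1-lipschitz_on UNIV V"
    and opt: "(LINT x|M. norm (h x - k x)) = (LINT x|\<alpha>. V x) - (LINT x|\<beta>. V x)"
  shows "W1 \<Omega> \<alpha> \<beta> = (LINT x|\<alpha>. V x) - (LINT x|\<beta>. V x)"
proof -
  let ?D = "(LINT x|\<alpha>. V x) - (LINT x|\<beta>. V x)" and ?c = "\<lambda>\<gamma>. (LINT z:\<Omega> \<times> \<Omega>|\<gamma>. norm (fst z - snd z))"
  interpret prob_space M by (rule M)
  define \<gamma> where "\<gamma> = distr M borel (\<lambda>x. (h x, k x))"
  note hk = pair_measurable[OF \<Omega> M \<alpha> \<beta> h k]
  have hkp: "(\<lambda>x. (h x, k x)) \<in> borel_measurable M" using hk by (rule borel_measurable_Pair)
  have \<Omega>2: "\<Omega> \<times> \<Omega> \<in> sets borel" using compact_imp_closed[OF \<Omega>] by (intro borel_closed closed_Times)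
  have fs: "(fst :: 'a \<times> 'a \<Rightarrow> 'a) \<in> borel_measurable borel" "(snd :: 'a \<times> 'a \<Rightarrow> 'a) \<in> borel_measurable borel"
    by (auto intro!: borel_measurable_continuous_onI continuous_intros)
  have \<gamma>p: "\<gamma> \<in> prob_measures_on (\<Omega> \<times> \<Omega>)"
  proof -
    have "emeasure \<gamma> (- (\<Omega> \<times> \<Omega>)) = emeasure M {x \<in> space M. (h x, k x) \<notin> \<Omega> \<times> \<Omega>}"
      unfolding \<gamma>_def using \<Omega>2 hkp by (subst emeasure_distr) (auto intro!: arg_cong[where f = "emeasure M"])
    also have "\<dots> = 0"
    proof (rule emeasure_eq_0_AE)
      show "AE x in M. \<not> (h x, k x) \<notin> \<Omega> \<times> \<Omega>"
        using pair_AE[OF \<Omega> M \<alpha> \<beta> h k] by eventually_elim simp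
    qed
    finally show ?thesis unfolding \<gamma>_def prob_measures_on_def using prob_space_distr[OF hkp] by simp
  qed
  have \<gamma>: "\<gamma> \<in> couplings \<Omega> \<alpha> \<beta>"
  proof -
    have "distr \<gamma> borel fst = \<alpha>" "distr \<gamma> borel snd = \<beta>"
      unfolding \<gamma>_def using distr_distr[OF fs(1) hkp] distr_distr[OF fs(2) hkp] h(2) k(2)
      by (simp_all add: comp_def)
    then show ?thesis using \<gamma>p by (simp add: couplings_def)
  qed
  have nb: "(\<lambda>z::'a \<times> 'a. norm (fst z - snd z)) \<in> borel_measurable borel"
    by (intro borel_measurable_continuous_onI continuous_intros)
  have "?c \<gamma> = (LINT z|\<gamma>. norm (fst z - snd z))"
    by (rule set_integral_eq_integral[OF \<gamma>p \<Omega>2 nb]) simp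
  also have "\<dots> = (LINT x|M. norm (h x - k x))"
    unfolding \<gamma>_def using hkp nb by (subst integral_distr) auto
  finally have c\<gamma>: "?c \<gamma> = ?D" using opt by simp
  have ge: "?D \<le> ?c g" if "g \<in> couplings \<Omega> \<alpha> \<beta>" for g
    by (rule coupling_cost_ge[OF \<Omega> \<alpha> \<beta> that V])
  show ?thesis
    unfolding W1_def
  proof (rule antisym)
    have "(INF \<gamma>\<in>couplings \<Omega> \<alpha> \<beta>. ?c \<gamma>) \<le> ?c \<gamma>"
      by (rule cINF_lower[OF _ \<gamma>]) (use ge in \<open>auto intro!: bdd_belowI2\<close>)
    then show "(INF \<gamma>\<in>couplings \<Omega> \<alpha> \<beta>. ?c \<gamma>) \<le> ?D" by (simp only: c\<gamma>)
    show "?D \<le> (INF \<gamma>\<in>couplings \<Omega> \<alpha> \<beta>. ?c \<gamma>)" using \<gamma> ge by (intro cINF_greatest) auto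
  qed
qed

section \<open>The descent step\<close>

lemma gderiv_cong_open:
  assumes "GDERIV f x :> q" "open S" "x \<in> S" "\<And>y. y \<in> S \<Longrightarrow> f y = g y"
  shows "GDERIV g x :> q"
  unfolding gderiv_def by (rule has_derivative_transform_within_open[OF assms(1)[unfolded gderiv_def] assms(2-4)])

lemma gderiv_interior_iff:
  assumes "x \<in> interior \<Omega>" "\<And>y. y \<in> \<Omega> \<Longrightarrow> f y = g y"
  shows "GDERIV f x :> q \<longleftrightarrow> GDERIV g x :> q"
proof -
  have eq: "f y = g y" if "y \<in> interior \<Omega>" for y using assms(2)[OF subsetD[OF interior_subset that]] .
  show ?thesis
    using gderiv_cong_open[OF _ open_interior assms(1), of f q g] gderiv_cong_open[OF _ open_interior assms(1), of g q f] eq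
    by auto
qed

text \<open>
  The geometric setting: \<open>T\<close> moves mass along transport rays of the potential \<open>U\<close>, and only points
  that it moves by at least \<open>l > \<eta>\<close> matter. Upper end points of rays, where \<open>U\<close> need not be
  differentiable, are excluded from the sources.
\<close>

context
  fixes \<Omega> :: "'a::euclidean_space set" and U :: "'a \<Rightarrow> real" and T :: "'a \<Rightarrow> 'a" and \<eta> l :: real
  assumes \<Omega>: "compact \<Omega>" "convex \<Omega>" and U: "1-lipschitz_on UNIV U"
    and T: "T \<in> borel_measurable borel" "\<And>x. T x \<in> \<Omega>" and \<eta>: "0 < \<eta>" "\<eta> < l"
begin

text \<open>The value 0 where no gradient is available merges the two cases of
  \<open>descent_map\<close> and \<open>ascent_map\<close> into \<open>x - \<eta> w\<close> and
  \<open>x + \<eta> w\<close>.\<close>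

definition step_gradient :: "'a \<Rightarrow> 'a" where
  "step_gradient x = (if x \<in> interior \<Omega> \<and> (\<exists>q. GDERIV U x :> q) then gradient U x else 0)"

definition down_points :: "'a set" where
  "down_points = {x \<in> interior \<Omega>. U x - U (T x) = norm (x - T x) \<and> l \<le> norm (x - T x)}"

definition up_points :: "'a set" where
  "up_points = {x. \<exists>z. z \<noteq> x \<and> U z = U x + norm (z - x)}"

definition good_source :: "'a set" where
  "good_source = down_points \<inter> up_points"

text \<open>The image of \<open>good_source\<close> under the descent step, described by conditions
  at the target point so that it is visibly Borel.\<close>

definition good_target :: "'a set" where
  "good_target = {y \<in> interior \<Omega>. (\<exists>e. ray_point U (l - \<eta>) \<eta> y e) \<and> y + \<eta> *\<^sub>R step_gradient y \<in> good_source}"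

lemma U_borel: "U \<in> borel_measurable borel"
  by (rule borel_measurable_continuous_onI[OF lipschitz_on_continuous_on[OF U]])

lemma step_gradient_borel: "step_gradient \<in> borel_measurable borel"
proof -
  note [measurable] = borel_measurable_gradient[OF potential_continuous[OF U]]
  have [measurable]: "interior \<Omega> \<in> sets borel" by simp
  have "step_gradient = (\<lambda>x. indicator (interior \<Omega>) x *\<^sub>R (if \<exists>q. GDERIV U x :> q then gradient U x else 0))"
    by (intro ext) (auto simp: step_gradient_def indicator_def)
  then show ?thesis by simp
qed

lemma down_points_borel: "down_points \<in> sets borel"
proof -
  note [measurable] = U_borel T(1)
  have [measurable]: "interior \<Omega> \<in> sets borel" by simp
  show ?thesis unfolding down_points_def by measurable
qed

lemma up_points_eq: "up_points = (\<Union>n. {x. \<exists>e. ray_point U 0 (1 / real (Suc n)) x e})"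
proof (intro equalityI subsetI)
  fix x assume "x \<in> up_points"
  then obtain z where z: "z \<noteq> x" "U z = U x + norm (z - x)" by (auto simp: up_points_def)
  define e where "e = (1 / norm (z - x)) *\<^sub>R (z - x)"
  have e: "norm e = 1" "x + norm (z - x) *\<^sub>R e = z" using z(1) by (simp_all add: e_def)
  obtain n where n: "1 / real (Suc n) < norm (z - x)" using z(1) by (rule_tac nat_approx_posE[of "norm (z - x)"]) auto
  have "U (x + (1 / real (Suc n)) *\<^sub>R e) = U x + 1 / real (Suc n)"
    by (rule potential_segment[OF U e(1), of _ "norm (z - x)"]) (use z(2) e(2) n in auto)
  then have "ray_point U 0 (1 / real (Suc n)) x e" using e(1) by (simp add: ray_point_def)
  then show "x \<in> (\<Union>n. {x. \<exists>e. ray_point U 0 (1 / real (Suc n)) x e})" by blast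
next
  fix x assume "x \<in> (\<Union>n. {x. \<exists>e. ray_point U 0 (1 / real (Suc n)) x e})"
  then obtain n e where r: "ray_point U 0 (1 / real (Suc n)) x e" by blast
  let ?z = "x + (1 / real (Suc n)) *\<^sub>R e"
  have n: "norm (?z - x) = 1 / real (Suc n)" using r by (simp add: ray_point_def)
  then have "?z \<noteq> x" by auto
  moreover have "U ?z = U x + norm (?z - x)" unfolding n using r by (simp add: ray_point_def)
  ultimately show "x \<in> up_points" unfolding up_points_def by blast
qed

lemma up_points_borel: "up_points \<in> sets borel"
  unfolding up_points_eq by (intro sets.countable_UN image_subsetI borel_closed closed_ray_points[OF U])

lemma good_source_borel: "good_source \<in> sets borel"
  unfolding good_source_def using down_points_borel up_points_borel by blast

lemma down_direction:
  assumes x: "x \<in> down_points"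
  obtains e where "norm e = 1" "T x = x - norm (x - T x) *\<^sub>R e" "l \<le> norm (x - T x)"
    "U (x - norm (x - T x) *\<^sub>R e) = U x - norm (x - T x)"
proof
  let ?L = "norm (x - T x)"
  have L: "l \<le> ?L" "U x - U (T x) = ?L" using x by (auto simp: down_points_def)
  then have "0 < ?L" using \<eta> by linarith
  then show "norm ((1 / ?L) *\<^sub>R (x - T x)) = 1" by simp
  show Tx: "T x = x - ?L *\<^sub>R ((1 / ?L) *\<^sub>R (x - T x))" using \<open>0 < ?L\<close> by simp
  show "l \<le> ?L" by (rule L)
  show "U (x - ?L *\<^sub>R ((1 / ?L) *\<^sub>R (x - T x))) = U x - ?L" unfolding Tx[symmetric] using L(2) by simp
qed

lemma end_points_negligible: "negligible (down_points - up_points)"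
proof (rule upper_end_points_negligible[OF U])
  show "down_points - up_points \<in> sets borel" using down_points_borel up_points_borel by blast
  have "down_points \<subseteq> \<Omega>" using interior_subset by (auto simp: down_points_def)
  then show "bounded (down_points - up_points)" by (intro bounded_subset[OF compact_imp_bounded[OF \<Omega>(1)]]) blast
  show "0 < l" using \<eta> by simp
next
  fix x assume x: "x \<in> down_points - up_points"
  then obtain e where e: "norm e = 1" "l \<le> norm (x - T x)" "U (x - norm (x - T x) *\<^sub>R e) = U x - norm (x - T x)"
    using down_direction[of x] by blast
  have "U (x - l *\<^sub>R e) = U x - l" by (rule potential_segment_down[OF U e(1,3)]) (use e(2) \<eta> in auto)
  then show "\<exists>e. norm e = 1 \<and> U (x - l *\<^sub>R e) = U x - l" using e(1) by blast
  fix z assume "z \<noteq> x"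
  then show "U z \<noteq> U x + norm (z - x)" using x by (auto simp: up_points_def)
qed

text \<open>The ray down to \<open>T x\<close> and the ray up from \<open>x\<close> have the same
  direction because rays do not branch, so \<open>x\<close> is an inner point of a ray and
  \<open>U\<close> has a gradient there.\<close>

lemma good_sourceE:
  assumes x: "x \<in> good_source"
  obtains e t where "0 < t" "ray_point U l t x e" "T x = x - norm (x - T x) *\<^sub>R e" "l \<le> norm (x - T x)"
    "U (T x) = U x - norm (x - T x)" "step_gradient x = e"
proof -
  have xd: "x \<in> down_points" and xu: "x \<in> up_points" using x by (auto simp: good_source_def)
  obtain e where e: "norm e = 1" "T x = x - norm (x - T x) *\<^sub>R e" "l \<le> norm (x - T x)"
    "U (x - norm (x - T x) *\<^sub>R e) = U x - norm (x - T x)" by (rule down_direction[OF xd])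
  have d: "U (x - l *\<^sub>R e) = U x - l" by (rule potential_segment_down[OF U e(1,4)]) (use e(3) \<eta> in auto)
  obtain z where z: "z \<noteq> x" "U z = U x + norm (z - x)" using xu by (auto simp: up_points_def)
  have "z = x + norm (z - x) *\<^sub>R e" by (rule ray_direction_unique[OF U e(1) _ d z(2)]) (use \<eta> in simp)
  then have r: "ray_point U l (norm (z - x)) x e" using e(1) d z(2) by (simp add: ray_point_def)
  have t: "0 < norm (z - x)" using z(1) by simp
  have l: "0 < l" using \<eta> by simp
  have "x \<in> interior \<Omega>" using xd by (simp add: down_points_def)
  then have "step_gradient x = e"
    using ray_point_gderiv[OF U r l t] ray_point_gradient[OF U r l t] by (auto simp: step_gradient_def)
  then show thesis using that[OF t r e(2,3)] xd by (simp add: down_points_def)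
qed

text \<open>Moving down by \<eta> leaves a piece of ray of length \<open>l - \<eta>\<close> below
  and creates one of length \<eta> above. Hence \<open>y\<close> has the same gradient as
  \<open>x\<close>, and the ascent step returns to \<open>x\<close>.\<close>

lemma step_target:
  assumes x: "x \<in> good_source"
  defines "y \<equiv> x - \<eta> *\<^sub>R step_gradient x"
  shows "y \<in> good_target" "y + \<eta> *\<^sub>R step_gradient y = x" "U y = U x - \<eta>" "norm (y - T x) = norm (x - T x) - \<eta>"
proof -
  obtain e t where t: "0 < t" and r: "ray_point U l t x e" and Tx: "T x = x - norm (x - T x) *\<^sub>R e"
    and L: "l \<le> norm (x - T x)" and sx: "step_gradient x = e" by (rule good_sourceE[OF x])
  have e: "norm e = 1" "U (x - l *\<^sub>R e) = U x - l" using r by (auto simp: ray_point_def)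
  have y: "y = x - \<eta> *\<^sub>R e" by (simp add: y_def sx)
  show Uy: "U y = U x - \<eta>" unfolding y by (rule potential_segment_down[OF U e]) (use \<eta> in auto)
  have "y - (l - \<eta>) *\<^sub>R e = x - l *\<^sub>R e" by (simp add: y scaleR_diff_left)
  then have "U (y - (l - \<eta>) *\<^sub>R e) = U y - (l - \<eta>)" using e(2) Uy by simp
  moreover have "y + \<eta> *\<^sub>R e = x" by (simp add: y)
  then have "U (y + \<eta> *\<^sub>R e) = U y + \<eta>" using Uy by simp
  ultimately have ry: "ray_point U (l - \<eta>) \<eta> y e" using e(1) by (simp add: ray_point_def)
  have pos: "0 < l - \<eta>" using \<eta> by simp
  let ?L = "norm (x - T x)"
  have Lpos: "0 < ?L" using L \<eta> by linarith
  then have frac: "0 < \<eta> / ?L" "\<eta> / ?L < 1" using L \<eta> by (simp_all add: pos_divide_less_eq)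
  have x_int: "x \<in> interior \<Omega>" using x by (simp add: good_source_def down_points_def)
  \<comment> \<open>Gradients are considered at interior points only; \<open>y\<close> is a proper
    convex combination of the interior point \<open>x\<close> and the point \<open>T x\<close> of
    \<open>\<Omega>\<close>, hence interior.\<close>
  have "T x - (1 - \<eta> / ?L) *\<^sub>R (T x - x) \<in> interior \<Omega>"
    by (rule mem_interior_convex_shrink[OF \<Omega>(2) x_int T(2)]) (use frac in simp_all)
  moreover have "T x - (1 - \<eta> / ?L) *\<^sub>R (T x - x) = y"
  proof -
    have "T x - (1 - \<eta> / ?L) *\<^sub>R (T x - x) = x + (\<eta> / ?L) *\<^sub>R (T x - x)" by (simp add: scaleR_diff_left)
    also have "(\<eta> / ?L) *\<^sub>R (T x - x) = - (\<eta> *\<^sub>R e)"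
    proof -
      have "T x - x = - (?L *\<^sub>R e)" by (subst Tx) simp
      then have "(\<eta> / ?L) *\<^sub>R (T x - x) = (\<eta> / ?L) *\<^sub>R (- (?L *\<^sub>R e))" by (rule arg_cong)
      then show ?thesis using Lpos by simp
    qed
    finally show ?thesis by (simp add: y)
  qed
  ultimately have y_int: "y \<in> interior \<Omega>" by simp
  then have sy: "step_gradient y = e"
    using ray_point_gderiv[OF U ry pos \<eta>(1)] ray_point_gradient[OF U ry pos \<eta>(1)] by (auto simp: step_gradient_def)
  then have src: "y + \<eta> *\<^sub>R step_gradient y = x" by (simp add: y)
  then show "y + \<eta> *\<^sub>R step_gradient y = x" .
  show "y \<in> good_target" using src x ry y_int by (auto simp: good_target_def)
  have "y - T x = (?L - \<eta>) *\<^sub>R e" unfolding y by (subst Tx) (simp add: scaleR_diff_left)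
  then show "norm (y - T x) = ?L - \<eta>" using e(1) L \<eta> by simp
qed

lemma good_targetD:
  assumes y: "y \<in> good_target"
  shows "\<exists>e. ray_point U (l - \<eta>) \<eta> y e \<and> step_gradient y = e" "y + \<eta> *\<^sub>R step_gradient y \<in> good_source"
    "(y + \<eta> *\<^sub>R step_gradient y) - \<eta> *\<^sub>R step_gradient (y + \<eta> *\<^sub>R step_gradient y) = y"
proof -
  obtain e where r: "ray_point U (l - \<eta>) \<eta> y e" and y_int: "y \<in> interior \<Omega>" and
    x: "y + \<eta> *\<^sub>R step_gradient y \<in> good_source" using y by (auto simp: good_target_def)
  have pos: "0 < l - \<eta>" using \<eta> by simp
  have sy: "step_gradient y = e"
    using y_int ray_point_gderiv[OF U r pos \<eta>(1)] ray_point_gradient[OF U r pos \<eta>(1)] by (auto simp: step_gradient_def)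
  then show "\<exists>e. ray_point U (l - \<eta>) \<eta> y e \<and> step_gradient y = e" using r by blast
  show "y + \<eta> *\<^sub>R step_gradient y \<in> good_source" by (rule x)
  let ?x = "y + \<eta> *\<^sub>R e"
  have xg: "?x \<in> good_source" using x by (simp only: sy)
  obtain e' t where t: "0 < t" and r': "ray_point U l t ?x e'" and sx: "step_gradient ?x = e'"
    by (rule good_sourceE[OF xg])
  have e: "norm e = 1" "U ?x = U y + \<eta>" and e': "norm e' = 1" "U (?x + t *\<^sub>R e') = U ?x + t"
    using r r' by (auto simp: ray_point_def)
  \<comment> \<open>The ray through \<open>y\<close> reaches \<open>?x\<close> in direction
    \<open>e\<close>, so by non-branching the ray above \<open>?x\<close> continues in this
    direction, and the gradients at \<open>y\<close> and \<open>?x\<close> coincide.\<close>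
  have "?x + t *\<^sub>R e' = ?x + norm ((?x + t *\<^sub>R e') - ?x) *\<^sub>R e"
    by (rule ray_direction_unique[OF U e(1) \<eta>(1)]) (use e e' t in simp_all)
  then have "t *\<^sub>R e' = t *\<^sub>R e" using e' t by simp
  then have "e' = e" using t by simp
  then show "(y + \<eta> *\<^sub>R step_gradient y) - \<eta> *\<^sub>R step_gradient (y + \<eta> *\<^sub>R step_gradient y) = y"
    unfolding sy sx by simp
qed

lemma good_target_borel: "good_target \<in> sets borel"
proof -
  note [measurable] = step_gradient_borel good_source_borel
  have "(\<lambda>y. y + \<eta> *\<^sub>R step_gradient y) \<in> borel_measurable borel" by measurable
  then have "(\<lambda>y. y + \<eta> *\<^sub>R step_gradient y) -` good_source \<in> sets borel"
    by (rule measurable_sets_borel[OF _ good_source_borel])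
  moreover have "{y. \<exists>e. ray_point U (l - \<eta>) \<eta> y e} \<in> sets borel" by (intro borel_closed closed_ray_points[OF U])
  moreover have "good_target = interior \<Omega> \<inter> {y. \<exists>e. ray_point U (l - \<eta>) \<eta> y e}
      \<inter> (\<lambda>y. y + \<eta> *\<^sub>R step_gradient y) -` good_source"
    by (auto simp: good_target_def)
  ultimately show ?thesis by simp
qed

lemma ascent_lipschitz_on_good_target:
  "(1 + \<eta> * (1 / min (l - \<eta>) \<eta>))-lipschitz_on good_target (\<lambda>y. y + \<eta> *\<^sub>R step_gradient y)"
proof -
  have pos: "0 < l - \<eta>" "0 \<le> \<eta>" using \<eta> by auto
  have "(1 + \<eta> * (1 / min (l - \<eta>) \<eta>))-lipschitz_on good_target (\<lambda>y. y + \<eta> *\<^sub>R gradient U y)"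
    by (rule lipschitz_on_subset[OF ascent_lipschitz_on_ray_points[OF U pos(1) \<eta>(1) pos(2)]])
      (auto simp: good_target_def)
  moreover have "y + \<eta> *\<^sub>R step_gradient y = y + \<eta> *\<^sub>R gradient U y" if "y \<in> good_target" for y
    using good_targetD(1)[OF that] ray_point_gradient[OF U _ pos(1) \<eta>(1)] by metis
  ultimately show ?thesis by (auto intro: lipschitz_on_transform)
qed

end

text \<open>\<open>U\<close> has at least the dual value of the approximating \<open>v\<close>, and
  \<open>T\<close> costs at most as much as the approximating \<open>S\<close>; the error is
  arbitrarily small.\<close>

lemma optimal_map_cost_le:
  fixes \<Omega> :: "'a::euclidean_space set" and \<mu> \<nu> :: "'a measure"
  assumes \<Omega>: "compact \<Omega>" and \<mu>: "\<mu> \<in> prob_measures_on \<Omega>" and \<nu>: "\<nu> \<in> prob_measures_on \<Omega>"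
    and ac: "\<And>A. A \<in> null_sets lborel \<Longrightarrow> emeasure \<mu> A = 0"
    and U: "1-lipschitz_on UNIV U" and pot: "kantorovich_potential \<Omega> \<mu> \<nu> U"
    and opt: "optimal_transport_map \<Omega> \<mu> \<nu> T"
  shows "(LINT x:\<Omega>|\<mu>. norm (x - T x)) \<le> (LINT x|\<mu>. U x) - (LINT x|\<nu>. U x)"
proof (rule field_le_epsilon)
  fix e :: real assume "0 < e"
  then obtain S v where S: "transport_map \<Omega> \<mu> \<nu> S" and v: "1-lipschitz_on UNIV v"
    and le: "(LINT x:\<Omega>|\<mu>. norm (x - S x)) \<le> (LINT x|\<mu>. v x) - (LINT x|\<nu>. v x) + e"
    using approximately_optimal_transport_map[OF \<Omega> \<mu> \<nu> ac] by blast
  have \<Omega>b: "\<Omega> \<in> sets borel" using compact_imp_closed[OF \<Omega>] by simp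
  have eq: "(LINT x:\<Omega>|\<alpha>. w x) = (LINT x|\<alpha>. w x)" if "1-lipschitz_on UNIV w" "\<alpha> \<in> prob_measures_on \<Omega>"
    for w :: "'a \<Rightarrow> real" and \<alpha>
    by (rule set_integral_eq_integral[OF that(2) \<Omega>b])
      (simp_all add: borel_measurable_continuous_onI[OF lipschitz_on_continuous_on[OF that(1)]])
  have "1-lipschitz_on \<Omega> v" by (rule lipschitz_on_subset[OF v]) simp
  then have "(LINT x|\<mu>. v x) - (LINT x|\<nu>. v x) \<le> (LINT x|\<mu>. U x) - (LINT x|\<nu>. U x)"
    using pot unfolding kantorovich_potential_def eq[OF v \<mu>, symmetric] eq[OF v \<nu>, symmetric]
      eq[OF U \<mu>, symmetric] eq[OF U \<nu>, symmetric] by blast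
  moreover have "(LINT x:\<Omega>|\<mu>. norm (x - T x)) \<le> (LINT x:\<Omega>|\<mu>. norm (x - S x))"
    using opt S by (simp add: optimal_transport_map_def)
  ultimately show "(LINT x:\<Omega>|\<mu>. norm (x - T x)) \<le> (LINT x|\<mu>. U x) - (LINT x|\<nu>. U x) + e"
    using le by linarith
qed

lemma ell0_mono_shift:
  assumes \<Omega>: "compact \<Omega>" and \<mu>: "\<mu> \<in> prob_measures_on \<Omega>" and \<mu>': "\<mu>' \<in> prob_measures_on \<Omega>"
    and T': "\<And>x. x \<in> \<Omega> \<Longrightarrow> T' x \<in> \<Omega>"
    and shift: "\<And>l. AE x in \<mu>. \<not> (x \<in> \<Omega> \<and> norm (x - T x) < l) \<Longrightarrow> AE x in \<mu>'. \<not> (x \<in> \<Omega> \<and> norm (x - T' x) < l - \<eta>)"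
  shows "ell0 \<Omega> \<mu> T - \<eta> \<le> ell0 \<Omega> \<mu>' T'"
proof -
  let ?S = "{l. AE x in \<mu>. \<not> (x \<in> \<Omega> \<and> norm (x - T x) < l)}"
  let ?S' = "{l. AE x in \<mu>'. \<not> (x \<in> \<Omega> \<and> norm (x - T' x) < l)}"
  interpret prob_space \<mu>' by (rule prob_measures_onD[OF \<mu>'])
  obtain D where D: "\<And>x. x \<in> \<Omega> \<Longrightarrow> norm x \<le> D"
    using compact_imp_bounded[OF \<Omega>] by (auto simp: bounded_iff)
  \<comment> \<open>A real supremum needs an upper bound: distances within \<open>\<Omega>\<close>
    are at most \<open>2 * D\<close>, and a probability measure leaves some point where this
    applies.\<close>
  have bdd: "bdd_above ?S'"
  proof (rule bdd_aboveI)
    fix l assume "l \<in> ?S'"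
    then have "AE x in \<mu>'. \<not> (x \<in> \<Omega> \<and> norm (x - T' x) < l)" by simp
    moreover have "AE x in \<mu>'. x \<in> \<Omega>"
      by (rule AE_in_domain[OF \<mu>']) (use compact_imp_closed[OF \<Omega>] in simp)
    ultimately have "AE x in \<mu>'. l \<le> 2 * D"
    proof eventually_elim
      case (elim x)
      then have "l \<le> norm (x - T' x)" by simp
      also have "\<dots> \<le> norm x + norm (T' x)" by (rule norm_triangle_ineq4)
      also have "\<dots> \<le> 2 * D" using D[of x] D[OF T'[of x]] elim by simp
      finally show ?case .
    qed
    then show "l \<le> 2 * D" by simp
  qed
  have "0 \<in> ?S" by simp
  then have "Sup ?S \<le> Sup ?S' + \<eta>"
  proof (intro cSup_least)
    fix l assume "l \<in> ?S"
    then have "l - \<eta> \<in> ?S'" using shift by simp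
    then have "l - \<eta> \<le> Sup ?S'" by (rule cSup_upper[OF _ bdd])
    then show "l \<le> Sup ?S' + \<eta>" by simp
  qed blast
  then show ?thesis by (simp add: ell0_def)
qed

theorem theorem1:
  fixes \<Omega> :: "(real ^ 'n) set"
    and \<mu> \<nu> \<mu>' :: "(real ^ 'n) measure"
    and \<rho> u0 :: "real ^ 'n \<Rightarrow> real"
    and T0 f0 g0 :: "real ^ 'n \<Rightarrow> real ^ 'n"
    and \<eta>0 :: real
  assumes "compact \<Omega>" and "convex \<Omega>"
    and "\<mu> \<in> prob_measures_on \<Omega>" and "\<nu> \<in> prob_measures_on \<Omega>"
    and "lebesgue_density \<mu> \<rho>"
    and "kantorovich_potential \<Omega> \<mu> \<nu> u0"
    and "0 < \<eta>0"
    and "f0 = descent_map \<Omega> \<eta>0 u0"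
    and "\<mu>' = pushforward \<Omega> \<mu> f0"
    and "optimal_transport_map \<Omega> \<mu> \<nu> T0"
    and "\<eta>0 < ell0 \<Omega> \<mu> T0"
    and "g0 = ascent_map \<Omega> \<eta>0 u0"
  shows "\<mu>' \<in> prob_measures_on \<Omega> \<and>
     kantorovich_potential \<Omega> \<mu>' \<nu> u0 \<and>
     W1 \<Omega> \<mu>' \<nu> = W1 \<Omega> \<mu> \<nu> - \<eta>0 \<and>
     (\<exists>T1. (AE y in \<mu>'. g0 y \<in> \<Omega> \<and> T1 y = T0 (g0 y)) \<and>
        optimal_transport_map \<Omega> \<mu>' \<nu> T1 \<and>
        ell0 \<Omega> \<mu>' T1 \<ge> ell0 \<Omega> \<mu> T0 - \<eta>0) \<and>
     (\<exists>\<rho>'. lebesgue_density \<mu>' \<rho>' \<and>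
        (AE x in \<mu>. \<exists>A. has_approx_derivative g0 A \<Omega> (f0 x) \<and>
           \<rho>' (f0 x) = \<rho> x * \<bar>det (matrix A)\<bar>))"
proof -
  note \<Omega> = assms(1) and \<Omega>conv = assms(2) and \<mu> = assms(3) and \<nu> = assms(4) and \<rho> = assms(5)
    and pot0 = assms(6) and \<eta> = assms(7) and opt = assms(10)
  note m = prob_measures_onD[OF \<mu>] and n = prob_measures_onD[OF \<nu>]
  interpret \<mu>: prob_space \<mu> by (rule m(1))
  have \<Omega>b: "\<Omega> \<in> sets borel" using compact_imp_closed[OF \<Omega>] by simp
  have AE\<Omega>: "AE x in \<mu>. x \<in> \<Omega>" by (rule AE_in_domain[OF \<mu> \<Omega>b])
  have \<rho>b: "\<rho> \<in> borel_measurable borel" and \<mu>_def: "\<mu> = density lborel (\<lambda>x. ennreal (\<rho> x))"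
    using \<rho> by (auto simp: lebesgue_density_def)
  have ac: "emeasure \<mu> A = 0" if "A \<in> null_sets lborel" for A
  proof -
    have "AE x in lborel. x \<in> A \<longrightarrow> ennreal (\<rho> x) = 0" using AE_not_in[OF that] by eventually_elim simp
    then have "A \<in> null_sets (density lborel (\<lambda>x. ennreal (\<rho> x)))"
      using that \<rho>b by (subst null_sets_density_iff) auto
    then show ?thesis unfolding \<mu>_def by blast
  qed
  have AE_neg: "AE x in \<mu>. x \<notin> A" if "negligible A" for A
  proof -
    obtain N where N: "N \<in> null_sets lborel" "A \<subseteq> N"
      using \<open>negligible A\<close> by (auto simp: negligible_iff_null_sets null_sets_completion_iff2)
    then have "N \<in> null_sets \<mu>" using ac[OF N(1)] by (auto simp: null_sets_def m(2))
    from AE_not_in[OF this] show ?thesis by eventually_elim (use N(2) in blast)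
  qed
  have lip0: "1-lipschitz_on \<Omega> u0" using pot0 by (simp add: kantorovich_potential_def)
  \<comment> \<open>The extension lets rays be studied without regard to the boundary of
    \<open>\<Omega>\<close>; at interior points it has the same gradient as
    \<open>u0\<close>.\<close>
  obtain U where U: "1-lipschitz_on UNIV U" and Uu: "\<And>x. x \<in> \<Omega> \<Longrightarrow> U x = u0 x"
    by (rule mcshane_extension[OF lip0]) (rule that)
  have U\<Omega>: "1-lipschitz_on \<Omega> U" by (rule lipschitz_on_subset[OF U]) simp
  have Ub: "U \<in> borel_measurable borel" by (rule borel_measurable_continuous_onI[OF lipschitz_on_continuous_on[OF U]])
  have u0_int: "(LINT x:\<Omega>|\<alpha>. u0 x) = (LINT x|\<alpha>. U x)" if "\<alpha> \<in> prob_measures_on \<Omega>" for \<alpha>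
    by (rule set_integral_eq_integral[OF that \<Omega>b Ub]) (simp add: Uu)
  have U_int: "(LINT x:\<Omega>|\<alpha>. U x) = (LINT x|\<alpha>. U x)" if "\<alpha> \<in> prob_measures_on \<Omega>" for \<alpha>
    by (rule set_integral_eq_integral[OF that \<Omega>b Ub]) simp
  have pot: "kantorovich_potential \<Omega> \<mu> \<nu> U"
    using pot0 U\<Omega> unfolding kantorovich_potential_def by (simp add: u0_int U_int \<mu> \<nu>)
  define D where "D = (LINT x|\<mu>. U x) - (LINT x|\<nu>. U x)"
  obtain x0 where x0: "x0 \<in> \<Omega>"
  proof -
    have "\<Omega> \<noteq> {}" using m(4) \<mu>.emeasure_space_1 m(3) by auto
    then show ?thesis using that by blast
  qed
  have tm: "transport_map \<Omega> \<mu> \<nu> T0" using opt by (simp add: optimal_transport_map_def)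
  obtain T where T: "T \<in> borel_measurable borel" "\<And>x. T x \<in> \<Omega>" and TT0: "\<And>x. x \<in> \<Omega> \<Longrightarrow> T x = T0 x"
    and Td: "distr \<mu> borel T = \<nu>"
    by (rule transport_mapE[OF tm \<mu> \<Omega>b x0]) (rule that)
  have T\<mu>: "T \<in> borel_measurable \<mu>" using T(1) m(2) by (simp cong: measurable_cong_sets)
  have id\<mu>: "distr \<mu> borel (\<lambda>x. x) = \<mu>" by (rule distr_id2) (simp add: m(2))
  have idb: "(\<lambda>x::real^'n. x) \<in> borel_measurable borel" by simp
  note idT = \<Omega> m(1,2) \<mu> \<nu> idb id\<mu> T(1) Td
  have cost_T: "(LINT x|\<mu>. norm (x - T x)) = D"
  proof (rule antisym)
    have "(LINT x|\<mu>. norm (x - T x)) = (LINT x:\<Omega>|\<mu>. norm (x - T0 x))"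
      by (rule set_integral_eq_integral[OF \<mu> \<Omega>b, symmetric]) (use T(1) TT0 in auto)
    also have "\<dots> \<le> D"
      unfolding D_def by (rule optimal_map_cost_le[OF \<Omega> \<mu> \<nu> ac U pot opt])
    finally show "(LINT x|\<mu>. norm (x - T x)) \<le> D" .
    show "D \<le> (LINT x|\<mu>. norm (x - T x))" unfolding D_def by (rule pair_dual(3)[OF idT U])
  qed
  \<comment> \<open>Cost and dual value agree, so the nonnegative function
    \<open>norm (x - T x) - (U x - U (T x))\<close> has integral 0.\<close>
  have AE_ray: "AE x in \<mu>. U x - U (T x) = norm (x - T x)"
  proof -
    note i = pair_dual(1)[OF idT U] and j = pair_cost_integrable[OF idT]
    have nn: "0 \<le> norm (x - T x) - (U x - U (T x))" for x
      using lipschitz_onD[OF U, of x "T x"] by (simp add: dist_norm dist_real_def)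
    have "(LINT x|\<mu>. norm (x - T x) - (U x - U (T x))) = 0"
      using i j pair_dual(2)[OF idT U] cost_T by (simp add: D_def)
    then have "AE x in \<mu>. norm (x - T x) - (U x - U (T x)) = 0"
      using i j nn by (subst (asm) integral_nonneg_eq_0_iff_AE) auto
    then show ?thesis by eventually_elim simp
  qed
  \<comment> \<open>The difference \<open>l - \<eta>0\<close> is the length of ray that is sure to
    remain below a moved point.\<close>
  obtain l where l: "\<eta>0 < l" and AE_l: "AE x in \<mu>. \<not> (x \<in> \<Omega> \<and> norm (x - T0 x) < l)"
  proof -
    let ?S = "{l. AE x in \<mu>. \<not> (x \<in> \<Omega> \<and> norm (x - T0 x) < l)}"
    have ne: "?S \<noteq> {}"
    proof
      assume "?S = {}"
      moreover have "0 \<in> ?S" by simp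
      ultimately show False by blast
    qed
    have "\<eta>0 < Sup ?S" using assms(11) by (simp only: ell0_def)
    from less_cSupE[OF this ne] obtain l where "l \<in> ?S" "\<eta>0 < l" .
    then show ?thesis by (intro that[of l]) (simp_all only: mem_Collect_eq)
  qed
  note setting = \<Omega> \<Omega>conv U T \<eta> l
  let ?w = "step_gradient \<Omega> U"
  let ?X = "good_source \<Omega> U T l" and ?Y = "good_target \<Omega> U T \<eta>0 l"
  have wb: "?w \<in> borel_measurable borel" by (rule step_gradient_borel[OF setting])
  have X: "?X \<in> sets borel" by (rule good_source_borel[OF setting])
  have Y: "?Y \<in> sets borel" by (rule good_target_borel[OF setting])
  have ge: "gradient_exists \<Omega> u0 x \<longleftrightarrow> x \<in> interior \<Omega> \<and> (\<exists>q. GDERIV U x :> q)" for x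
    using gderiv_interior_iff[of x \<Omega> u0 U] Uu by (auto simp: gradient_exists_def)
  have gr: "gradient u0 x = gradient U x" if "x \<in> interior \<Omega>" for x
    using gderiv_interior_iff[OF that, of u0 U] Uu by (simp add: gradient_def)
  have f0: "f0 = (\<lambda>x. x - \<eta>0 *\<^sub>R ?w x)"
    unfolding assms(8) descent_map_def by (intro ext) (auto simp: step_gradient_def[OF setting] ge gr)
  have g0: "g0 = (\<lambda>x. x + \<eta>0 *\<^sub>R ?w x)"
    unfolding assms(12) ascent_map_def by (intro ext) (auto simp: step_gradient_def[OF setting] ge gr)
  have f0b: "f0 \<in> borel_measurable borel" and g0b: "g0 \<in> borel_measurable borel"
    unfolding f0 g0 using wb by measurable
  have f0\<mu>: "f0 \<in> borel_measurable \<mu>" using f0b m(2) by (simp cong: measurable_cong_sets)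
  \<comment> \<open>The frontier of a convex set and the upper end points of the rays in question
    are Lebesgue-null, hence null for \<open>\<mu>\<close>.\<close>
  have AE_X: "AE x in \<mu>. x \<in> ?X"
  proof -
    have "AE x in \<mu>. x \<notin> frontier \<Omega>" by (rule AE_neg[OF negligible_convex_frontier[OF \<Omega>conv]])
    moreover have "AE x in \<mu>. x \<notin> down_points \<Omega> U T l - up_points U"
      by (rule AE_neg[OF end_points_negligible[OF setting]])
    ultimately show ?thesis
      using AE\<Omega> AE_ray AE_l
    proof eventually_elim
      case (elim x)
      have "x \<in> interior \<Omega>" using elim(1,3) closure_subset[of \<Omega>] by (auto simp: frontier_def)
      then have "x \<in> down_points \<Omega> U T l" using elim TT0 by (simp add: down_points_def[OF setting])
      then show ?case using elim(2) by (simp add: good_source_def[OF setting])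
    qed
  qed
  have X\<Omega>: "x \<in> \<Omega>" if "x \<in> ?X" for x
    using that interior_subset by (auto simp: good_source_def[OF setting] down_points_def[OF setting])
  have Y\<Omega>: "?Y \<subseteq> \<Omega>" using interior_subset by (auto simp: good_target_def[OF setting])
  have X0: "emeasure \<mu> (- ?X) = 0"
    using emeasure_eq_0_AE[of "\<lambda>x. x \<notin> ?X" \<mu>] AE_X m(3) by (simp add: Compl_eq)
  have fX: "f0 x \<in> ?Y" "g0 (f0 x) = x" "U (f0 x) = U x - \<eta>0" "norm (f0 x - T x) = norm (x - T x) - \<eta>0" if "x \<in> ?X" for x
    unfolding f0 g0 by (rule step_target[OF setting that])+
  have gY: "g0 y \<in> ?X" "f0 (g0 y) = y" if "y \<in> ?Y" for y
    unfolding f0 g0 by (rule good_targetD[OF setting that])+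
  have lipg: "(1 + \<eta>0 * (1 / min (l - \<eta>0) \<eta>0))-lipschitz_on ?Y g0"
    unfolding g0 by (rule ascent_lipschitz_on_good_target[OF setting])
  have \<mu>'_distr: "distr \<mu> borel f0 = \<mu>'" unfolding assms(9) by (rule pushforward_eq_distr[OF \<mu> \<Omega>b f0b, symmetric])
  have AE_Y: "AE y in \<mu>'. y \<in> ?Y"
    unfolding \<mu>'_distr[symmetric] using Y f0\<mu> AE_X by (subst AE_distr_iff) (auto elim!: eventually_mono simp: fX)
  have \<mu>': "\<mu>' \<in> prob_measures_on \<Omega>"
  proof -
    have "prob_space \<mu>'" unfolding \<mu>'_distr[symmetric] by (rule \<mu>.prob_space_distr[OF f0\<mu>])
    moreover have s: "sets \<mu>' = sets borel" unfolding \<mu>'_distr[symmetric] by simp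
    moreover have "emeasure \<mu>' {y \<in> space \<mu>'. y \<notin> \<Omega>} = 0"
      by (rule emeasure_eq_0_AE) (use AE_Y Y\<Omega> in \<open>auto elim!: eventually_mono\<close>)
    then have "emeasure \<mu>' (- \<Omega>) = 0" using sets_eq_imp_space_eq[OF s] by (simp add: Compl_eq)
    ultimately show ?thesis by (simp add: prob_measures_on_def)
  qed
  note fT = \<Omega> m(1,2) \<mu>' \<nu> f0b \<mu>'_distr T(1) Td
  have cost_fT: "(LINT x|\<mu>. norm (f0 x - T x)) = D - \<eta>0"
  proof -
    have "(LINT x|\<mu>. norm (f0 x - T x)) = (LINT x|\<mu>. norm (x - T x) - \<eta>0)"
      using AE_X pair_cost_integrable[OF fT] pair_cost_integrable[OF idT]
      by (intro integral_cong_AE) (auto elim!: eventually_mono simp: fX)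
    then show ?thesis using pair_cost_integrable[OF idT] cost_T \<mu>.prob_space by simp
  qed
  \<comment> \<open>The dual value of \<open>U\<close> drops by the same \<open>\<eta>0\<close> as
    the cost of the pair \<open>(f0, T)\<close>; this pair certifies that \<open>U\<close> is
    optimal for the new measure.\<close>
  have dual_\<mu>': "(LINT x|\<mu>'. U x) - (LINT x|\<nu>. U x) = D - \<eta>0"
  proof -
    have "(LINT x|\<mu>. U (f0 x) - U (T x)) = (LINT x|\<mu>. (U x - U (T x)) - \<eta>0)"
      using AE_X pair_dual(1)[OF fT U] pair_dual(1)[OF idT U]
      by (intro integral_cong_AE) (auto elim!: eventually_mono simp: fX)
    also have "\<dots> = D - \<eta>0"
      using pair_dual(1)[OF idT U] pair_dual(2)[OF idT U] \<mu>.prob_space by (simp add: D_def)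
    finally show ?thesis using pair_dual(2)[OF fT U] by simp
  qed
  have pot': "kantorovich_potential \<Omega> \<mu>' \<nu> u0"
    unfolding kantorovich_potential_def
  proof (intro conjI allI impI lip0)
    fix v :: "real^'n \<Rightarrow> real" assume "1-lipschitz_on \<Omega> v"
    then obtain V where V: "1-lipschitz_on UNIV V" and Vv: "\<And>x. x \<in> \<Omega> \<Longrightarrow> V x = v x"
      using mcshane_extension by blast
    have Vb: "V \<in> borel_measurable borel" by (rule borel_measurable_continuous_onI[OF lipschitz_on_continuous_on[OF V]])
    have "(LINT x:\<Omega>|\<alpha>. v x) = (LINT x|\<alpha>. V x)" if "\<alpha> \<in> prob_measures_on \<Omega>" for \<alpha>
      by (rule set_integral_eq_integral[OF that \<Omega>b Vb]) (simp add: Vv)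
    then have "(LINT x:\<Omega>|\<mu>'. v x) - (LINT x:\<Omega>|\<nu>. v x) \<le> (LINT x|\<mu>. norm (f0 x - T x))"
      using pair_dual(3)[OF fT V] \<mu>' \<nu> by simp
    then show "(LINT x:\<Omega>|\<mu>'. v x) - (LINT x:\<Omega>|\<nu>. v x) \<le> (LINT x:\<Omega>|\<mu>'. u0 x) - (LINT x:\<Omega>|\<nu>. u0 x)"
      by (simp add: u0_int \<mu>' \<nu> dual_\<mu>' cost_fT)
  qed
  have W: "W1 \<Omega> \<mu>' \<nu> = W1 \<Omega> \<mu> \<nu> - \<eta>0"
    using W1_eq_dual[OF idT U] W1_eq_dual[OF fT U] cost_T cost_fT dual_\<mu>' by (simp add: D_def)
  \<comment> \<open>A total Borel version of \<open>T0\<close> after \<open>g0\<close>; the default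
    \<open>x0\<close> is used off the good targets, a null set for \<open>\<mu>'\<close>.\<close>
  define T1 where "T1 y = (if y \<in> ?Y then T (g0 y) else x0)" for y
  have T1b: "T1 \<in> borel_measurable borel"
    unfolding T1_def using Y T(1) g0b by measurable
  have T1\<Omega>: "T1 y \<in> \<Omega>" for y using T(2) x0 by (simp add: T1_def)
  have T1f: "T1 (f0 x) = T x" if "x \<in> ?X" for x using fX[OF that] by (simp add: T1_def)
  have T1\<mu>': "T1 \<in> borel_measurable \<mu>'" unfolding \<mu>'_distr[symmetric] using T1b by simp
  have T1d: "distr \<mu>' borel T1 = \<nu>"
  proof -
    have "distr \<mu>' borel T1 = distr \<mu> borel (T1 \<circ> f0)"
      unfolding \<mu>'_distr[symmetric] by (rule distr_distr[OF T1b f0\<mu>])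
    also have "\<dots> = distr \<mu> borel T"
      using AE_X T\<mu> measurable_comp[OF f0\<mu> T1b] by (intro distr_cong_AE) (auto elim!: eventually_mono simp: T1f)
    finally show ?thesis using Td by simp
  qed
  have id\<mu>': "distr \<mu>' borel (\<lambda>x. x) = \<mu>'" by (rule distr_id2) (simp add: prob_measures_onD[OF \<mu>'])
  note p' = prob_measures_onD[OF \<mu>']
  have tm1: "transport_map \<Omega> \<mu>' \<nu> T1" by (rule transport_mapI[OF \<mu>' \<Omega>b T1b T1\<Omega> T1d])
  have cost_T1: "(LINT x:\<Omega>|\<mu>'. norm (x - T1 x)) = D - \<eta>0"
  proof -
    have "(LINT x:\<Omega>|\<mu>'. norm (x - T1 x)) = (LINT x|\<mu>'. norm (x - T1 x))"
      by (rule set_integral_eq_integral[OF \<mu>' \<Omega>b]) (use T1b in auto)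
    also have "\<dots> = (LINT x|\<mu>. norm (f0 x - T1 (f0 x)))"
      unfolding \<mu>'_distr[symmetric] using T1b f0\<mu> by (intro integral_distr) auto
    also have "\<dots> = (LINT x|\<mu>. norm (f0 x - T x))"
      using AE_X T\<mu> f0\<mu> measurable_compose[OF f0\<mu> T1b]
      by (intro integral_cong_AE) (auto elim!: eventually_mono simp: T1f)
    finally show ?thesis by (simp add: cost_fT)
  qed
  have opt1: "optimal_transport_map \<Omega> \<mu>' \<nu> T1"
    unfolding optimal_transport_map_def
  proof (intro conjI allI impI tm1)
    fix S assume "transport_map \<Omega> \<mu>' \<nu> S"
    then obtain S' where S': "S' \<in> borel_measurable borel" "\<And>x. x \<in> \<Omega> \<Longrightarrow> S' x = S x" "distr \<mu>' borel S' = \<nu>"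
      by (rule transport_mapE[OF _ \<mu>' \<Omega>b x0]) (rule that)
    have "D - \<eta>0 \<le> (LINT x|\<mu>'. norm (x - S' x))"
      using pair_dual(3)[OF \<Omega> p'(1,2) \<mu>' \<nu> idb id\<mu>' S'(1,3) U] dual_\<mu>' by simp
    also have "\<dots> = (LINT x:\<Omega>|\<mu>'. norm (x - S x))"
      by (rule set_integral_eq_integral[OF \<mu>' \<Omega>b, symmetric]) (use S' in auto)
    finally show "(LINT x:\<Omega>|\<mu>'. norm (x - T1 x)) \<le> (LINT x:\<Omega>|\<mu>'. norm (x - S x))" by (simp add: cost_T1)
  qed
  have ell: "ell0 \<Omega> \<mu> T0 - \<eta>0 \<le> ell0 \<Omega> \<mu>' T1"
  proof (rule ell0_mono_shift[OF \<Omega> \<mu> \<mu>' T1\<Omega>])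
    fix r assume r: "AE x in \<mu>. \<not> (x \<in> \<Omega> \<and> norm (x - T0 x) < r)"
    have "{y \<in> space borel. \<not> (y \<in> \<Omega> \<and> norm (y - T1 y) < r - \<eta>0)} \<in> sets borel"
      using T1b \<Omega>b by measurable
    moreover have "AE x in \<mu>. \<not> (f0 x \<in> \<Omega> \<and> norm (f0 x - T1 (f0 x)) < r - \<eta>0)"
      using AE_X r
    proof eventually_elim
      case (elim x)
      then have "r \<le> norm (x - T x)" using X\<Omega> TT0 by auto
      then show ?case using fX(4)[OF elim(1)] T1f[OF elim(1)] by simp
    qed
    ultimately show "AE y in \<mu>'. \<not> (y \<in> \<Omega> \<and> norm (y - T1 y) < r - \<eta>0)"
      unfolding \<mu>'_distr[symmetric] by (subst AE_distr_iff[OF f0\<mu>])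
  qed
  have AE_T1: "AE y in \<mu>'. g0 y \<in> \<Omega> \<and> T1 y = T0 (g0 y)"
    using AE_Y by eventually_elim (use gY(1) X\<Omega> TT0 in \<open>simp add: T1_def\<close>)
  have "\<exists>\<rho>'. lebesgue_density (distr \<mu> borel f0) \<rho>' \<and>
    (AE x in \<mu>. \<exists>A. has_approx_derivative g0 A \<Omega> (f0 x) \<and> \<rho>' (f0 x) = \<rho> x * \<bar>det (matrix A)\<bar>)"
    by (rule pushforward_lebesgue_density[OF \<rho> m(1) X X0 Y Y\<Omega> f0b fX(1,2) g0b gY lipg])
  then show ?thesis using \<mu>' pot' W AE_T1 opt1 ell unfolding \<mu>'_distr by blast
qed

end
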